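(* Let $G$ be a weighted undirected cubic planar graph without tension, equipped with a semi-Pfaffian orientation, and suppose that all the edge weights of $G$ are nonzero. Let $p$ be the product of the weights of all the edges of $G$, let $A$ be the skew symmetric adjacency matrix of $G$ with the given orientation, and let $A_{inv}$ be the matrix obtained from $A$ by replacing each nonzero entry of $A$ by an inverse, as follows: the nonzero entries of $A_{inv}$ are the inverses of the corresponding nonzero entries of $A$, and all other entries are $0$. Then, up to sign, $$\operatorname{u-det} G = p\cdot \operatorname{Pfaffian}(A_{inv}),$$ that is, $\operatorname{u-det} G=\pm\, p\cdot\operatorname{Pfaffian}(A_{inv})$.
   Context: All graphs are finite, undirected, without loops and multiple edges; cubic means $3$-regular. Weights are given by $w:E(G)\to F$, where $F$ is a field of characteristic not equal to $2$ (for instance $\mathbb{Q}$). A planar graph is considered as drawn in (a subset of) the plane. Undirected determinant. A cycle cover of $G$ is a spanning subgraph all of whose vertices have degree $2$; $cc(G)$ is the set of all cycle covers. For $c\in cc(G)$, $w(c)$ is the product of the weights of the edges of $c$ and $|c|$ is the number of connected components of $c$. If $G$ has $N$ vertices, $\operatorname{u-det} G=(-1)^N\sum_{c\in cc(G)}(-1)^{|c|}w(c)$. Orientation and skew symmetric adjacency matrix. An orientation of $G$ is a choice, independently for every edge, of a direction from one of its end points to the other. If $G$ has vertices $1,2,\ldots,N$ and is equipped with an orientation, its skew symmetric adjacency matrix is $A=[a_{ij}]$, where for every edge of weight $e$ oriented from $i$ to $j$ we have $a_{ij}=e$ and $a_{ji}=-e$, and $a_{ij}=0$ if there is no edge $\{i,j\}$.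 Pfaffian. Let $N=2n$ and let $pm(G)$ be the set of perfect matchings of $G$. For $a=\{i_1j_1,\ldots,i_nj_n\}\in pm(G)$, with every edge $i_kj_k$ listed so that it is directed from $i_k$ to $j_k$, $\operatorname{sgn}_G(a)$ is the sign of the permutation sending $1,2,3,4,\ldots,2n-1,2n$ to $i_1,j_1,i_2,j_2,\ldots,i_n,j_n$ respectively. Then $\operatorname{Pfaffian} A=\sum_{a\in pm(G)}\operatorname{sgn}_G(a)w(a)$, where $w(a)$ is the product of the weights of the edges in $a$; this is the usual Pfaffian of the skew symmetric matrix $A$. Semi-Pfaffian orientation. A cycle $c$ of $G$ is even if it has even length, and central if $G\setminus V(c)$ has a perfect matching. An even cycle $c$ is oddly oriented if, for either choice of direction of traversal around $c$, the number of edges of $c$ directed in the direction of the traversal is odd. An orientation of $G$ is semi-Pfaffian if every central cycle in $G$ of length $2k$ is oddly oriented if and only if $k$ is odd. Tension. A cycle $c$ in the plane cubic graph $G$ decomposes the plane into two closed subsets, a bounded one $P_*$ and an unbounded one $P_\infty$, with $P_*\cap P_\infty=c$; put $G_*=G\cap P_*$ and $G_\infty=G\cap P_\infty$. A vertex $v\in c$ is an in-vertex if the unique edge adjacent to $v$ but not in $c$ belongs to $G_*$, and otherwise it is an out-vertex. If $c$ is even, let $V_1,V_2$ be the bipartition of its vertices (as a bipartite graph). The tension of $c$ is the absolute value of the difference between the number of out-vertices in $V_1$ and the number of out-vertices in $V_2$. The graph $G$ is without tension if the tension of every even central cycle in $G$ is zero. *)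

theory Defs
  imports
    "HOL-Analysis.Analysis"
    "HOL-Combinatorics.Permutations"
    "Jordan_Normal_Form.Matrix"
begin

hide_const (open) Finite_Cartesian_Product.mat Finite_Cartesian_Product.vec

text \<open>
  Vertices are numbered from 0, as are matrix indices: a graph has vertex set
  \<^term>\<open>{0..<N}\<close>, and its edges are two-element sets of vertices.
\<close>

section \<open>Graphs\<close>

definition simple_graph :: "nat \<Rightarrow> nat set set \<Rightarrow> bool" where
  "simple_graph N E \<longleftrightarrow> (\<forall>e\<in>E. e \<subseteq> {0..<N} \<and> card e = 2)"

definition degree_in :: "nat set set \<Rightarrow> nat \<Rightarrow> nat" where
  "degree_in E v = card {e \<in> E. v \<in> e}"

definition cubic :: "nat \<Rightarrow> nat set set \<Rightarrow> bool" where
  "cubic N E \<longleftrightarrow> (\<forall>v<N. degree_in E v = 3)"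

definition perfect_matchings :: "nat set \<Rightarrow> nat set set \<Rightarrow> nat set set set" where
  "perfect_matchings V E =
     {M. M \<subseteq> E \<and> (\<forall>e\<in>M. e \<subseteq> V) \<and> (\<forall>v\<in>V. \<exists>!e. e \<in> M \<and> v \<in> e)}"

definition cycle_covers :: "nat \<Rightarrow> nat set set \<Rightarrow> nat set set set" where
  "cycle_covers N E = {c. c \<subseteq> E \<and> (\<forall>v<N. degree_in c v = 2)}"

definition num_components :: "nat \<Rightarrow> nat set set \<Rightarrow> nat" where
  "num_components N c =
     card ({0..<N} // {(u, v). u < N \<and> v < N \<and> (u, v) \<in> {(x, y). {x, y} \<in> c}\<^sup>*})"

definition u_det :: "nat \<Rightarrow> nat set set \<Rightarrow> (nat set \<Rightarrow> 'a::field) \<Rightarrow> 'a" where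
  "u_det N E w =
     (- 1) ^ N * (\<Sum>c\<in>cycle_covers N E. (- 1) ^ num_components N c * (\<Prod>e\<in>c. w e))"

section \<open>Orientations and Pfaffians\<close>

text \<open>\<^term>\<open>(i, j) \<in> D\<close> means that the edge \<^term>\<open>{i, j}\<close> is directed from \<^term>\<open>i\<close> to \<^term>\<open>j\<close>.\<close>

definition is_orientation :: "nat set set \<Rightarrow> (nat \<times> nat) set \<Rightarrow> bool" where
  "is_orientation E D \<longleftrightarrow>
     (\<forall>(i, j)\<in>D. {i, j} \<in> E) \<and> (\<forall>i j. {i, j} \<in> E \<longrightarrow> ((i, j) \<in> D \<longleftrightarrow> (j, i) \<notin> D))"

definition skew_adjacency :: "nat \<Rightarrow> (nat \<times> nat) set \<Rightarrow> (nat set \<Rightarrow> 'a::field) \<Rightarrow> 'a mat" where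
  "skew_adjacency N D w =
     Matrix.mat N N (\<lambda>(i, j). if (i, j) \<in> D then w {i, j}
                              else if (j, i) \<in> D then - w {i, j} else 0)"

text \<open>Each perfect matching of the index set is listed exactly once, with its pairs and the
  sequence of their first elements increasing.\<close>

definition matching_perms :: "nat \<Rightarrow> (nat \<Rightarrow> nat) set" where
  "matching_perms n =
     {\<sigma>. \<sigma> permutes {0..<2 * n} \<and> (\<forall>k<n. \<sigma> (2 * k) < \<sigma> (2 * k + 1))
         \<and> (\<forall>k l. k < l \<and> l < n \<longrightarrow> \<sigma> (2 * k) < \<sigma> (2 * l))}"

definition pfaffian :: "'a::field mat \<Rightarrow> 'a" where
  "pfaffian A =
     (if odd (dim_row A) then 0
      else \<Sum>\<sigma>\<in>matching_perms (dim_row A div 2).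
        of_int (sign \<sigma>) * (\<Prod>k<dim_row A div 2. A $$ (\<sigma> (2 * k), \<sigma> (2 * k + 1))))"

text \<open>The sign of a perfect matching of an oriented graph. It does not depend on the listing
  of the edges chosen, so that for skew symmetric adjacency matrices \<open>pfaffian\<close> is a signed
  sum over perfect matchings; see \<open>pfaffian_skew_adjacency\<close> below.\<close>

definition lists_matching :: "nat \<Rightarrow> nat set set \<Rightarrow> (nat \<Rightarrow> nat) \<Rightarrow> bool" where
  "lists_matching n a \<sigma> \<longleftrightarrow>
     \<sigma> permutes {0..<2 * n} \<and> (\<lambda>k. {\<sigma> (2 * k), \<sigma> (2 * k + 1)}) ` {..<n} = a"

definition matching_sgn :: "nat \<Rightarrow> (nat \<times> nat) set \<Rightarrow> nat set set \<Rightarrow> int" where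
  "matching_sgn n D a =
     sign (SOME \<sigma>. lists_matching n a \<sigma> \<and> (\<forall>k<n. (\<sigma> (2 * k), \<sigma> (2 * k + 1)) \<in> D))"

section \<open>Cycles\<close>

text \<open>A cycle is given by the list of its vertices in the order of a traversal; the same cycle
  has several such lists (starting points and directions).\<close>

definition next_vertex :: "nat list \<Rightarrow> nat \<Rightarrow> nat" where
  "next_vertex vs i = vs ! (Suc i mod length vs)"

definition cycle_edges :: "nat list \<Rightarrow> nat set set" where
  "cycle_edges vs = (\<lambda>i. {vs ! i, next_vertex vs i}) ` {..<length vs}"

definition is_cycle :: "nat set set \<Rightarrow> nat list \<Rightarrow> bool" where
  "is_cycle E vs \<longleftrightarrow> 3 \<le> length vs \<and> distinct vs \<and> cycle_edges vs \<subseteq> E"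

definition central :: "nat \<Rightarrow> nat set set \<Rightarrow> nat list \<Rightarrow> bool" where
  "central N E vs \<longleftrightarrow> perfect_matchings ({0..<N} - set vs) E \<noteq> {}"

definition forward_edges :: "(nat \<times> nat) set \<Rightarrow> nat list \<Rightarrow> nat" where
  "forward_edges D vs = card {i. i < length vs \<and> (vs ! i, next_vertex vs i) \<in> D}"

definition oddly_oriented :: "(nat \<times> nat) set \<Rightarrow> nat list \<Rightarrow> bool" where
  "oddly_oriented D vs \<longleftrightarrow> odd (forward_edges D vs) \<and> odd (forward_edges D (rev vs))"

definition semi_pfaffian :: "nat \<Rightarrow> nat set set \<Rightarrow> (nat \<times> nat) set \<Rightarrow> bool" where
  "semi_pfaffian N E D \<longleftrightarrow>
     (\<forall>vs k. is_cycle E vs \<and> central N E vs \<and> length vs = 2 * k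
        \<longrightarrow> (oddly_oriented D vs \<longleftrightarrow> odd k))"

section \<open>Plane drawings and tension\<close>

text \<open>The plane is \<^typ>\<open>complex\<close>. Vertices are drawn as distinct points and edges as simple
  arcs joining their end points; arcs meet vertices and each other only in common end points.\<close>

definition plane_drawing ::
  "nat \<Rightarrow> nat set set \<Rightarrow> (nat \<Rightarrow> complex) \<Rightarrow> (nat set \<Rightarrow> real \<Rightarrow> complex) \<Rightarrow> bool" where
  "plane_drawing N E pos \<gamma> \<longleftrightarrow>
     inj_on pos {0..<N} \<and>
     (\<forall>e\<in>E. arc (\<gamma> e) \<and> {pathstart (\<gamma> e), pathfinish (\<gamma> e)} = pos ` e) \<and>
     (\<forall>e\<in>E. \<forall>v<N. pos v \<in> path_image (\<gamma> e) \<longrightarrow> v \<in> e) \<and>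
     (\<forall>e\<in>E. \<forall>e'\<in>E. e \<noteq> e' \<longrightarrow> path_image (\<gamma> e) \<inter> path_image (\<gamma> e') \<subseteq> pos ` (e \<inter> e'))"

definition cycle_curve :: "(nat set \<Rightarrow> real \<Rightarrow> complex) \<Rightarrow> nat list \<Rightarrow> complex set" where
  "cycle_curve \<gamma> vs = (\<Union>e\<in>cycle_edges vs. path_image (\<gamma> e))"

text \<open>The closed bounded region cut out by the cycle is the curve together with its inside.
  In a cubic graph, exactly one edge at a vertex of a cycle does not belong to that cycle.\<close>

definition in_vertex ::
  "nat set set \<Rightarrow> (nat set \<Rightarrow> real \<Rightarrow> complex) \<Rightarrow> nat list \<Rightarrow> nat \<Rightarrow> bool" where
  "in_vertex E \<gamma> vs v \<longleftrightarrow>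
     (\<exists>e\<in>E - cycle_edges vs. v \<in> e \<and>
        path_image (\<gamma> e) \<subseteq> cycle_curve \<gamma> vs \<union> inside (cycle_curve \<gamma> vs))"

text \<open>The bipartition of an even cycle consists of the vertices at even and at odd positions.\<close>

definition tension ::
  "nat set set \<Rightarrow> (nat set \<Rightarrow> real \<Rightarrow> complex) \<Rightarrow> nat list \<Rightarrow> int" where
  "tension E \<gamma> vs =
     \<bar>int (card {i. i < length vs \<and> even i \<and> \<not> in_vertex E \<gamma> vs (vs ! i)})
      - int (card {i. i < length vs \<and> odd i \<and> \<not> in_vertex E \<gamma> vs (vs ! i)})\<bar>"

definition without_tension ::
  "nat \<Rightarrow> nat set set \<Rightarrow> (nat set \<Rightarrow> real \<Rightarrow> complex) \<Rightarrow> bool" where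
  "without_tension N E \<gamma> \<longleftrightarrow>
     (\<forall>vs. is_cycle E vs \<and> even (length vs) \<and> central N E vs \<longrightarrow> tension E \<gamma> vs = 0)"

section \<open>The Pfaffian as a signed sum over perfect matchings\<close>

text \<open>\<open>block_perm r\<close> permutes the blocks \<^term>\<open>{2 * k, 2 * k + 1}\<close> according to \<open>r\<close>;
  \<open>flip_perm S\<close> exchanges the two elements of the blocks with number in \<open>S\<close>.\<close>

definition block_perm :: "(nat \<Rightarrow> nat) \<Rightarrow> nat \<Rightarrow> nat" where
  "block_perm r j = 2 * r (j div 2) + j mod 2"

definition flip_perm :: "nat set \<Rightarrow> nat \<Rightarrow> nat" where
  "flip_perm S j = (if j div 2 \<in> S then (if even j then j + 1 else j - 1) else j)"

lemma block_perm_transpose: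
  assumes "a \<noteq> b"
  shows "block_perm (Transposition.transpose a b) =
    Transposition.transpose (2 * a) (2 * b) \<circ> Transposition.transpose (2 * a + 1) (2 * b + 1)"
proof
  fix j :: nat
  obtain m c where j: "j = 2 * m + c" "c = 0 \<or> c = 1"
    by (rule that[of "j div 2" "j mod 2"]) auto
  show "block_perm (Transposition.transpose a b) j =
      (Transposition.transpose (2 * a) (2 * b) \<circ> Transposition.transpose (2 * a + 1) (2 * b + 1)) j"
    using j(2) assms unfolding j(1) block_perm_def
    by (elim disjE) (auto simp: Transposition.transpose_def)
qed

lemma block_perm:
  assumes "r permutes {..<n}"
  shows "block_perm r permutes {0..<2 * n} \<and> sign (block_perm r) = 1"
  using assms finite_lessThan
proof (induction rule: permutes_induct)
  case id
  have "block_perm id = id" by (auto simp: block_perm_def fun_eq_iff)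
  then show ?case by (metis permutes_id sign_id)
next
  case (swap a b p)
  show ?case
  proof (cases "a = b")
    case True
    then show ?thesis using swap by simp
  next
    case False
    have eq: "block_perm (Transposition.transpose a b \<circ> p) =
        Transposition.transpose (2 * a) (2 * b) \<circ> (Transposition.transpose (2 * a + 1) (2 * b + 1) \<circ> block_perm p)"
      unfolding o_assoc block_perm_transpose[OF False, symmetric]
      by (simp add: block_perm_def fun_eq_iff)
    have p: "permutation (block_perm p)"
      using swap.IH permutation_permutes by blast
    have t: "Transposition.transpose (2 * a) (2 * b) permutes {0..<2 * n}"
      "Transposition.transpose (2 * a + 1) (2 * b + 1) permutes {0..<2 * n}"
      using swap.hyps by (auto intro!: permutes_swap_id)
    have "sign (block_perm (Transposition.transpose a b \<circ> p)) = 1"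
      unfolding eq
      by (subst sign_compose sign_swap_id, simp_all add: False permutation_swap_id permutation_compose p
          sign_compose sign_swap_id swap.IH del: comp_apply)
    moreover have "block_perm (Transposition.transpose a b \<circ> p) permutes {0..<2 * n}"
      unfolding eq using swap.IH by (intro permutes_compose[OF _ t(1)] permutes_compose[OF _ t(2)]) blast
    ultimately show ?thesis by blast
  qed
qed

lemma flip_perm:
  assumes "finite S" "S \<subseteq> {..<n}"
  shows "flip_perm S permutes {0..<2 * n} \<and> sign (flip_perm S) = (- 1) ^ card S"
  using assms
proof (induction S rule: finite_induct)
  case empty
  have "flip_perm {} = id" by (auto simp: flip_perm_def fun_eq_iff)
  then show ?case by (metis permutes_id sign_id card.empty power_0)
next
  case (insert x S)
  have eq: "flip_perm (insert x S) = Transposition.transpose (2 * x) (2 * x + 1) \<circ> flip_perm S"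
  proof
    fix j :: nat
    obtain m c where j: "j = 2 * m + c" "c = 0 \<or> c = 1"
      by (rule that[of "j div 2" "j mod 2"]) auto
    show "flip_perm (insert x S) j = (Transposition.transpose (2 * x) (2 * x + 1) \<circ> flip_perm S) j"
      using j(2) insert.hyps unfolding j(1) flip_perm_def
      by (elim disjE) (auto simp: Transposition.transpose_def)
  qed
  have p: "permutation (flip_perm S)"
    using insert permutation_permutes by blast
  have t: "Transposition.transpose (2 * x) (2 * x + 1) permutes {0..<2 * n}"
    using insert.prems by (intro permutes_swap_id) auto
  have "sign (flip_perm (insert x S)) = (- 1) ^ card (insert x S)"
    unfolding eq using insert p by (simp add: sign_compose permutation_swap_id sign_swap_id)
  moreover have "flip_perm (insert x S) permutes {0..<2 * n}"
    unfolding eq using insert by (intro permutes_compose[OF _ t]) simp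
  ultimately show ?case by blast
qed

lemma same_matching_decomp:
  assumes \<sigma>: "lists_matching n a \<sigma>" and \<tau>: "lists_matching n a \<tau>"
  obtains r S where "r permutes {..<n}" "S \<subseteq> {..<n}" "\<tau> = \<sigma> \<circ> (block_perm r \<circ> flip_perm S)"
proof -
  have ps: "\<sigma> permutes {0..<2 * n}" and pt: "\<tau> permutes {0..<2 * n}"
    using assms by (auto simp: lists_matching_def)
  have "\<exists>m<n. {\<tau> (2 * k), \<tau> (2 * k + 1)} = {\<sigma> (2 * m), \<sigma> (2 * m + 1)}" if "k < n" for k
  proof -
    have "{\<tau> (2 * k), \<tau> (2 * k + 1)} \<in> (\<lambda>k. {\<sigma> (2 * k), \<sigma> (2 * k + 1)}) ` {..<n}"
      using assms that unfolding lists_matching_def by auto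
    then show ?thesis by auto
  qed
  then obtain r0 where r0: "\<And>k. k < n \<Longrightarrow> r0 k < n"
      "\<And>k. k < n \<Longrightarrow> {\<tau> (2 * k), \<tau> (2 * k + 1)} = {\<sigma> (2 * r0 k), \<sigma> (2 * r0 k + 1)}"
    by metis
  define r where "r k = (if k < n then r0 k else k)" for k
  have r: "r k < n" "{\<tau> (2 * k), \<tau> (2 * k + 1)} = {\<sigma> (2 * r k), \<sigma> (2 * r k + 1)}" if "k < n" for k
    using r0 that by (auto simp: r_def)
  have injt: "\<tau> i = \<tau> j \<longleftrightarrow> i = j" for i j using pt permutes_inj by (metis injD)
  have injs: "\<sigma> i = \<sigma> j \<longleftrightarrow> i = j" for i j using ps permutes_inj by (metis injD)
  have "inj_on r {..<n}"
  proof (rule inj_onI)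
    fix k l assume kl: "k \<in> {..<n}" "l \<in> {..<n}" "r k = r l"
    then have "{\<tau> (2 * k), \<tau> (2 * k + 1)} = {\<tau> (2 * l), \<tau> (2 * l + 1)}"
      using r(2) by simp
    then show "k = l" by (auto simp: doubleton_eq_iff injt)
  qed
  then have "bij_betw r {..<n} {..<n}"
    using r(1) endo_inj_surj[of "{..<n}" r] by (auto simp: bij_betw_def)
  then have rp: "r permutes {..<n}"
    by (rule bij_imp_permutes) (auto simp: r_def)
  define S where "S = {k. k < n \<and> \<tau> (2 * k) \<noteq> \<sigma> (2 * r k)}"
  have "\<tau> = \<sigma> \<circ> (block_perm r \<circ> flip_perm S)"
  proof
    fix j :: nat
    obtain m c where j: "j = 2 * m + c" "c = 0 \<or> c = 1"
      by (rule that[of "j div 2" "j mod 2"]) auto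
    show "\<tau> j = (\<sigma> \<circ> (block_perm r \<circ> flip_perm S)) j"
    proof (cases "m < n")
      case True
      have *: "{\<tau> (2 * m), \<tau> (2 * m + 1)} = {\<sigma> (2 * r m), \<sigma> (2 * r m + 1)}"
        using r(2)[OF True] .
      show ?thesis
      proof (cases "m \<in> S")
        case True
        with * have "\<tau> (2 * m) = \<sigma> (2 * r m + 1)" "\<tau> (2 * m + 1) = \<sigma> (2 * r m)"
          by (auto simp: S_def doubleton_eq_iff)
        with True j show ?thesis
          by (auto simp: flip_perm_def block_perm_def)
      next
        case False
        then have "\<tau> (2 * m) = \<sigma> (2 * r m)" using True by (auto simp: S_def)
        moreover with * have "\<tau> (2 * m + 1) = \<sigma> (2 * r m + 1)"
          by (auto simp: doubleton_eq_iff)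
        ultimately show ?thesis using False j
          by (auto simp: flip_perm_def block_perm_def)
      qed
    next
      case False
      then have "j \<notin> {0..<2 * n}" "m \<notin> S" "r m = m"
        using j by (auto simp: S_def r_def)
      moreover from this have "\<tau> j = j" "\<sigma> j = j"
        using permutes_not_in[OF pt] permutes_not_in[OF ps] by auto
      ultimately show ?thesis using j
        by (auto simp: flip_perm_def block_perm_def)
    qed
  qed
  moreover have "S \<subseteq> {..<n}" by (auto simp: S_def)
  ultimately show ?thesis using that rp by blast
qed

lemma pfaffian_term_cong:
  fixes A :: "'a::field mat"
  assumes "lists_matching n a \<sigma>" "lists_matching n a \<tau>"
    and skew: "\<And>i j. i < 2 * n \<Longrightarrow> j < 2 * n \<Longrightarrow> A $$ (j, i) = - A $$ (i, j)"
  shows "of_int (sign \<sigma>) * (\<Prod>k<n. A $$ (\<sigma> (2 * k), \<sigma> (2 * k + 1))) =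
         of_int (sign \<tau>) * (\<Prod>k<n. A $$ (\<tau> (2 * k), \<tau> (2 * k + 1)))"
proof -
  obtain r S where r: "r permutes {..<n}" and S: "S \<subseteq> {..<n}"
    and \<tau>: "\<tau> = \<sigma> \<circ> (block_perm r \<circ> flip_perm S)"
    using same_matching_decomp assms(1,2) by metis
  have ps: "\<sigma> permutes {0..<2 * n}" using assms by (auto simp: lists_matching_def)
  have fin: "finite S" using S finite_subset by blast
  have perms: "permutation \<sigma>" "permutation (block_perm r)" "permutation (flip_perm S)"
    using ps block_perm[OF r] flip_perm[OF fin S] permutation_permutes by blast+
  have sign: "sign \<tau> = sign \<sigma> * (- 1) ^ card S"
    unfolding \<tau> using perms block_perm[OF r] flip_perm[OF fin S]
    by (simp add: sign_compose permutation_compose)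
  have lt: "\<sigma> i < 2 * n" if "i < 2 * n" for i
    using permutes_in_image[OF ps, of i] that by simp
  have entry: "A $$ (\<tau> (2 * k), \<tau> (2 * k + 1)) =
      (if k \<in> S then - 1 else 1) * A $$ (\<sigma> (2 * r k), \<sigma> (2 * r k + 1))" if "k < n" for k
  proof -
    have "r k < n" using permutes_in_image[OF r, of k] that by simp
    then have "\<sigma> (2 * r k) < 2 * n" "\<sigma> (2 * r k + 1) < 2 * n" by (auto intro!: lt)
    from skew[OF this] show ?thesis
      by (auto simp: \<tau> flip_perm_def block_perm_def)
  qed
  have "(\<Prod>k<n. A $$ (\<tau> (2 * k), \<tau> (2 * k + 1))) =
      (\<Prod>k<n. if k \<in> S then - 1 else 1) * (\<Prod>k<n. A $$ (\<sigma> (2 * r k), \<sigma> (2 * r k + 1)))"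
    by (subst prod.distrib[symmetric]) (intro prod.cong, auto simp: entry[simplified])
  also have "(\<Prod>k<n. if k \<in> S then - 1 else (1::'a)) = (- 1) ^ card S"
  proof -
    have "(\<Prod>k<n. if k \<in> S then - 1 else (1::'a)) = (\<Prod>k\<in>S. - 1)"
      using S by (intro prod.mono_neutral_cong_right) auto
    then show ?thesis by simp
  qed
  also have "(\<Prod>k<n. A $$ (\<sigma> (2 * r k), \<sigma> (2 * r k + 1))) =
      (\<Prod>k<n. A $$ (\<sigma> (2 * k), \<sigma> (2 * k + 1)))"
    using prod.permute[OF r, of "\<lambda>k. A $$ (\<sigma> (2 * k), \<sigma> (2 * k + 1))"] by (simp add: o_def)
  finally show ?thesis
    by (simp add: sign power_add[symmetric] mult_2[symmetric] mult.assoc[symmetric]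
        flip: power_mult_distrib)
qed

lemma matching_perms_inj:
  assumes "\<sigma> \<in> matching_perms n" "\<tau> \<in> matching_perms n"
    and "lists_matching n a \<sigma>" "lists_matching n a \<tau>"
  shows "\<sigma> = \<tau>"
proof -
  obtain r S where r: "r permutes {..<n}" and S: "S \<subseteq> {..<n}"
    and \<tau>: "\<tau> = \<sigma> \<circ> (block_perm r \<circ> flip_perm S)"
    using same_matching_decomp assms(3,4) by metis
  have rlt: "r k < n" if "k < n" for k using permutes_in_image[OF r, of k] that by simp
  have "k \<notin> S" if "k < n" for k
  proof
    assume "k \<in> S"
    then have "\<tau> (2 * k) = \<sigma> (2 * r k + 1)" "\<tau> (2 * k + 1) = \<sigma> (2 * r k)"
      unfolding \<tau> by (simp_all add: flip_perm_def block_perm_def)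
    moreover have "\<tau> (2 * k) < \<tau> (2 * k + 1)" "\<sigma> (2 * r k) < \<sigma> (2 * r k + 1)"
      using assms(1,2) that rlt by (auto simp: matching_perms_def)
    ultimately show False by simp
  qed
  then have S0: "S = {}" using S by auto
  have st: "\<tau> (2 * k) = \<sigma> (2 * r k)" for k
    unfolding \<tau> S0 by (simp add: flip_perm_def block_perm_def)
  have mono: "r k < r l" if "k < l" "l < n" for k l
  proof (rule ccontr)
    assume "\<not> r k < r l"
    moreover have "r k \<noteq> r l" using injD[OF permutes_inj[OF r], of k l] that by auto
    ultimately have "\<sigma> (2 * r l) < \<sigma> (2 * r k)"
      using assms(1) rlt[of k] that by (auto simp: matching_perms_def)
    moreover have "\<tau> (2 * k) < \<tau> (2 * l)" using assms(2) that by (auto simp: matching_perms_def)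
    ultimately show False unfolding st by simp
  qed
  have ge: "k \<le> r k" if "k < n" for k
    using that
  proof (induction k)
    case (Suc k)
    then show ?case using mono[of k "Suc k"] by linarith
  qed simp
  have "r k = k" for k
  proof -
    have "\<forall>k\<in>{..<n}. r k = k"
    proof -
      have "(\<Sum>k<n. r k) = (\<Sum>k<n. k)"
        using sum.permute[OF r, of "\<lambda>k. k"] by (simp add: o_def)
      note sum = this
      show ?thesis
      proof (intro ballI)
        fix k assume k: "k \<in> {..<n}"
        show "r k = k"
          by (rule sum_mono_inv[OF sum[symmetric] _ k, symmetric]) (simp_all add: ge)
      qed
    qed
    then show ?thesis using permutes_not_in[OF r] by blast
  qed
  then have "block_perm r \<circ> flip_perm S = id"
    by (auto simp: S0 flip_perm_def block_perm_def fun_eq_iff)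
  then show ?thesis by (simp add: \<tau>)
qed

lemma lists_matching_perfect:
  assumes "lists_matching n a \<sigma>"
  shows "a \<in> perfect_matchings {0..<2 * n} {e. e \<subseteq> {0..<2 * n} \<and> card e = 2}"
proof -
  have ps: "\<sigma> permutes {0..<2 * n}" and a: "a = (\<lambda>k. {\<sigma> (2 * k), \<sigma> (2 * k + 1)}) ` {..<n}"
    using assms by (auto simp: lists_matching_def)
  have inj: "\<sigma> i = \<sigma> j \<longleftrightarrow> i = j" for i j using ps permutes_inj by (metis injD)
  have lt: "\<sigma> i < 2 * n" if "i < 2 * n" for i
    using permutes_in_image[OF ps, of i] that by simp
  have sub: "a \<subseteq> {e. e \<subseteq> {0..<2 * n} \<and> card e = 2}"
    unfolding a by (auto simp: inj card_insert_if intro!: lt)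
  have "\<exists>!e. e \<in> a \<and> v \<in> e" if v: "v < 2 * n" for v
  proof -
    define j where "j = inv_into UNIV \<sigma> v"
    have vj: "v = \<sigma> j" using ps by (simp add: j_def permutes_inverses)
    have j: "j < 2 * n" using v vj permutes_in_image[OF ps, of j] by simp
    have mem: "v \<in> {\<sigma> (2 * k), \<sigma> (2 * k + 1)} \<longleftrightarrow> k = j div 2" for k
      by (auto simp: vj inj)
    show ?thesis
    proof (rule ex1I)
      show "{\<sigma> (2 * (j div 2)), \<sigma> (2 * (j div 2) + 1)} \<in> a \<and>
          v \<in> {\<sigma> (2 * (j div 2)), \<sigma> (2 * (j div 2) + 1)}"
        using j unfolding a mem by auto
    next
      fix e assume "e \<in> a \<and> v \<in> e"
      then obtain k where "e = {\<sigma> (2 * k), \<sigma> (2 * k + 1)}" "v \<in> e" unfolding a by blast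
      then show "e = {\<sigma> (2 * (j div 2)), \<sigma> (2 * (j div 2) + 1)}"
        using mem[of k] by simp
    qed
  qed
  with sub show ?thesis unfolding perfect_matchings_def by auto
qed

lemma ex_matching_perm:
  assumes "a \<in> perfect_matchings {0..<2 * n} {e. e \<subseteq> {0..<2 * n} \<and> card e = 2}"
  shows "\<exists>\<sigma>\<in>matching_perms n. lists_matching n a \<sigma>"
proof -
  have sub: "\<And>e. e \<in> a \<Longrightarrow> e \<subseteq> {0..<2 * n}" and c2: "\<And>e. e \<in> a \<Longrightarrow> card e = 2"
    and cov: "\<And>v. v < 2 * n \<Longrightarrow> \<exists>!e. e \<in> a \<and> v \<in> e"
    using assms by (auto simp: perfect_matchings_def)
  have fa: "finite a" using sub by (intro finite_subset[of a "Pow {0..<2 * n}"]) auto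
  have mm: "e = {Min e, Max e} \<and> Min e < Max e" if "e \<in> a" for e
  proof -
    obtain x y where "e = {x, y}" "x \<noteq> y" using c2[OF \<open>e \<in> a\<close>] by (auto simp: card_2_iff)
    then show ?thesis by (cases "x < y") (auto simp: min_def max_def)
  qed
  have disj: "e = f" if "e \<in> a" "f \<in> a" "v \<in> e" "v \<in> f" for e f v
    using cov[of v] sub that by fastforce
  have injM: "inj_on Min a"
  proof (rule inj_onI)
    fix e f assume "e \<in> a" "f \<in> a" "Min e = Min f"
    then show "e = f" using mm[of e] mm[of f] disj[of e f "Min e"] by (metis insertI1)
  qed
  have "\<Union> a = {0..<2 * n}" using sub cov by fastforce
  then have "2 * card a = 2 * n"
    using card_partition[of a 2] fa c2 disj by (metis (no_types, lifting) card_atLeastLessThan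
        diff_zero disjoint_iff finite_atLeastLessThan)
  then have card_a: "card a = n" by simp
  define xs where "xs = sorted_list_of_set (Min ` a)"
  have xs: "length xs = n" "set xs = Min ` a" "sorted_wrt (<) xs"
    using card_image[OF injM] fa card_a by (auto simp: xs_def)
  define ed where "ed k = (THE e. e \<in> a \<and> Min e = xs ! k)" for k
  have ed: "ed k \<in> a \<and> Min (ed k) = xs ! k" if "k < n" for k
  proof -
    have "xs ! k \<in> Min ` a" using that xs nth_mem by metis
    then have "\<exists>!e. e \<in> a \<and> Min e = xs ! k" using injM by (metis (no_types, lifting) imageE inj_onD)
    then show ?thesis unfolding ed_def by (rule theI')
  qed
  have ed_img: "ed ` {..<n} = a"
  proof
    show "ed ` {..<n} \<subseteq> a" using ed by auto
    show "a \<subseteq> ed ` {..<n}"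
    proof
      fix e assume e: "e \<in> a"
      then obtain k where k: "k < n" "xs ! k = Min e"
        using xs by (metis imageI in_set_conv_nth)
      then have "ed k = e" using ed[OF k(1)] e injM by (auto simp: inj_on_def)
      then show "e \<in> ed ` {..<n}" using k by auto
    qed
  qed
  define \<sigma> where "\<sigma> j = (if j < 2 * n then if even j then Min (ed (j div 2)) else Max (ed (j div 2))
      else j)" for j
  have s: "\<sigma> (2 * k) = Min (ed k)" "\<sigma> (2 * k + 1) = Max (ed k)" if "k < n" for k
    using that by (auto simp: \<sigma>_def)
  have pair: "{\<sigma> (2 * k), \<sigma> (2 * k + 1)} = ed k" if "k < n" for k
    using s[OF that] mm ed[OF that] by metis
  have "{0..<2 * n} \<subseteq> \<sigma> ` {0..<2 * n}"
  proof
    fix v assume "v \<in> {0..<2 * n}"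
    then obtain e where "e \<in> a" "v \<in> e" using cov by fastforce
    then obtain k where k: "k < n" "v \<in> ed k" using ed_img by blast
    then have "v = \<sigma> (2 * k) \<or> v = \<sigma> (2 * k + 1)" using pair[OF k(1)] by blast
    moreover have "2 * k \<in> {0..<2 * n}" "2 * k + 1 \<in> {0..<2 * n}" using k by auto
    ultimately show "v \<in> \<sigma> ` {0..<2 * n}" by blast
  qed
  moreover have "\<sigma> ` {0..<2 * n} \<subseteq> {0..<2 * n}"
  proof
    fix v assume "v \<in> \<sigma> ` {0..<2 * n}"
    then obtain j where j: "j < 2 * n" "v = \<sigma> j" by auto
    then have k: "j div 2 < n" by auto
    have "v \<in> ed (j div 2)"
      using j mm[of "ed (j div 2)"] ed[OF k] by (auto simp: \<sigma>_def)
    then show "v \<in> {0..<2 * n}" using sub ed[OF k] by blast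
  qed
  ultimately have img: "\<sigma> ` {0..<2 * n} = {0..<2 * n}" by blast
  then have "inj_on \<sigma> {0..<2 * n}" by (intro eq_card_imp_inj_on) auto
  with img have "bij_betw \<sigma> {0..<2 * n} {0..<2 * n}" by (simp add: bij_betw_def)
  then have ps: "\<sigma> permutes {0..<2 * n}"
    by (rule bij_imp_permutes) (auto simp: \<sigma>_def)
  have "(\<lambda>k. {\<sigma> (2 * k), \<sigma> (2 * k + 1)}) ` {..<n} = a"
    using pair ed_img by auto
  then have "lists_matching n a \<sigma>" using ps by (simp add: lists_matching_def)
  moreover have "\<sigma> \<in> matching_perms n"
    unfolding matching_perms_def
  proof (intro CollectI conjI ps allI impI)
    fix k assume "k < n"
    then show "\<sigma> (2 * k) < \<sigma> (2 * k + 1)" using s mm ed by metis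
  next
    fix k l assume "k < l \<and> l < n"
    then show "\<sigma> (2 * k) < \<sigma> (2 * l)"
      using s(1) ed xs by (auto simp: sorted_wrt_iff_nth_less)
  qed
  ultimately show ?thesis by blast
qed

lemma pfaffian_skew_adjacency:
  fixes w :: "nat set \<Rightarrow> 'a::field"
  assumes E: "simple_graph (2 * n) E" and D: "is_orientation E D"
  shows "pfaffian (skew_adjacency (2 * n) D w) =
    (\<Sum>a\<in>perfect_matchings {0..<2 * n} E. of_int (matching_sgn n D a) * (\<Prod>e\<in>a. w e))"
proof -
  define A where "A = skew_adjacency (2 * n) D w"
  define K where "K = {e. e \<subseteq> {0..<2 * n} \<and> card e = 2}"
  define M where "M \<sigma> = (\<lambda>k. {\<sigma> (2 * k), \<sigma> (2 * k + 1)}) ` {..<n}" for \<sigma> :: "nat \<Rightarrow> nat"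
  define T where "T \<sigma> = of_int (sign \<sigma>) * (\<Prod>k<n. A $$ (\<sigma> (2 * k), \<sigma> (2 * k + 1)))" for \<sigma>
  have EK: "E \<subseteq> K" using E by (auto simp: simple_graph_def K_def)
  have entry: "A $$ (i, j) = (if (i, j) \<in> D then w {i, j}
      else if (j, i) \<in> D then - w {i, j} else 0)" if "i < 2 * n" "j < 2 * n" for i j
    using that by (simp add: A_def skew_adjacency_def)
  have DE: "{i, j} \<in> E" if "(i, j) \<in> D" for i j using D that by (auto simp: is_orientation_def)
  have D1: "(i, j) \<in> D \<longleftrightarrow> (j, i) \<notin> D" if "{i, j} \<in> E" for i j
    using D that by (auto simp: is_orientation_def)
  have skew: "A $$ (j, i) = - A $$ (i, j)" if "i < 2 * n" "j < 2 * n" for i j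
    using D1 DE that by (auto simp: entry insert_commute)
  have lm: "lists_matching n (M \<sigma>) \<sigma>" if "\<sigma> \<in> matching_perms n" for \<sigma>
    using that by (auto simp: lists_matching_def matching_perms_def M_def)
  have lmM: "a = M \<sigma>" if "lists_matching n a \<sigma>" for a \<sigma>
    using that by (auto simp: lists_matching_def M_def)
  have bij: "bij_betw M (matching_perms n) (perfect_matchings {0..<2 * n} K)"
    unfolding bij_betw_def
  proof (intro conjI inj_onI equalityI subsetI)
    fix \<sigma> \<tau> assume "\<sigma> \<in> matching_perms n" "\<tau> \<in> matching_perms n" "M \<sigma> = M \<tau>"
    then show "\<sigma> = \<tau>" using matching_perms_inj lm by metis
  next
    fix a assume "a \<in> M ` matching_perms n"
    then show "a \<in> perfect_matchings {0..<2 * n} K"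
      using lm lists_matching_perfect unfolding K_def by blast
  next
    fix a assume "a \<in> perfect_matchings {0..<2 * n} K"
    then show "a \<in> M ` matching_perms n"
      using ex_matching_perm lmM unfolding K_def by blast
  qed
  define C where "C a = (SOME \<sigma>. lists_matching n a \<sigma> \<and> (\<forall>k<n. (\<sigma> (2 * k), \<sigma> (2 * k + 1)) \<in> D))"
    for a
  have zero: "T \<sigma> = 0" if \<sigma>: "\<sigma> \<in> matching_perms n" and "M \<sigma> \<notin> perfect_matchings {0..<2 * n} E" for \<sigma>
  proof -
    have ps: "\<sigma> permutes {0..<2 * n}" using \<sigma> by (auto simp: matching_perms_def)
    have "M \<sigma> \<in> perfect_matchings {0..<2 * n} K" using bij \<sigma> by (auto simp: bij_betw_def)
    then have "\<not> M \<sigma> \<subseteq> E" using that(2) by (auto simp: perfect_matchings_def)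
    then obtain k where k: "k < n" "{\<sigma> (2 * k), \<sigma> (2 * k + 1)} \<notin> E" by (auto simp: M_def)
    have "\<sigma> (2 * k) < 2 * n" "\<sigma> (2 * k + 1) < 2 * n"
      using permutes_in_image[OF ps] k by auto
    then have "A $$ (\<sigma> (2 * k), \<sigma> (2 * k + 1)) = 0"
      using k(2) DE DE[of "\<sigma> (2 * k + 1)" "\<sigma> (2 * k)"] by (auto simp: entry insert_commute)
    then show ?thesis using k(1) by (auto simp: T_def intro!: prod_zero)
  qed
  have val: "T \<sigma> = of_int (matching_sgn n D (M \<sigma>)) * (\<Prod>e\<in>M \<sigma>. w e)"
    if \<sigma>: "\<sigma> \<in> matching_perms n" and a: "M \<sigma> \<in> perfect_matchings {0..<2 * n} E" for \<sigma>
  proof -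
    have ps: "\<sigma> permutes {0..<2 * n}" using \<sigma> by (auto simp: matching_perms_def)
    define S where "S = {k. k < n \<and> (\<sigma> (2 * k), \<sigma> (2 * k + 1)) \<notin> D}"
    have S: "finite S" "S \<subseteq> {..<n}" by (auto simp: S_def)
    define \<tau>0 where "\<tau>0 = \<sigma> \<circ> flip_perm S"
    have t: "\<tau>0 (2 * k) = (if k \<in> S then \<sigma> (2 * k + 1) else \<sigma> (2 * k))"
        "\<tau>0 (2 * k + 1) = (if k \<in> S then \<sigma> (2 * k) else \<sigma> (2 * k + 1))" for k
      by (auto simp: \<tau>0_def flip_perm_def)
    have "{\<tau>0 (2 * k), \<tau>0 (2 * k + 1)} = {\<sigma> (2 * k), \<sigma> (2 * k + 1)}" for k
      by (auto simp only: t split: if_splits)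
    then have "lists_matching n (M \<sigma>) \<tau>0"
      using permutes_compose[OF conjunct1[OF flip_perm[OF S]] ps]
      by (simp add: lists_matching_def M_def \<tau>0_def)
    moreover have "(\<tau>0 (2 * k), \<tau>0 (2 * k + 1)) \<in> D" if "k < n" for k
    proof -
      have "{\<sigma> (2 * k), \<sigma> (2 * k + 1)} \<in> E"
        using a that by (auto simp: perfect_matchings_def M_def)
      then show ?thesis using D1 that unfolding t by (auto simp: S_def)
    qed
    ultimately have "\<exists>\<sigma>'. lists_matching n (M \<sigma>) \<sigma>' \<and> (\<forall>k<n. (\<sigma>' (2 * k), \<sigma>' (2 * k + 1)) \<in> D)"
      by blast
    from someI_ex[OF this] obtain \<tau> where \<tau>: "\<tau> = C (M \<sigma>)" "lists_matching n (M \<sigma>) \<tau>"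
      "\<And>k. k < n \<Longrightarrow> (\<tau> (2 * k), \<tau> (2 * k + 1)) \<in> D"
      by (auto simp: C_def)
    have "T \<sigma> = T \<tau>"
      unfolding T_def using lm[OF \<sigma>] \<tau>(2) skew by (rule pfaffian_term_cong)
    moreover have "(\<Prod>k<n. A $$ (\<tau> (2 * k), \<tau> (2 * k + 1))) = (\<Prod>e\<in>M \<sigma>. w e)"
    proof -
      have pt: "\<tau> permutes {0..<2 * n}" using \<tau>(2) by (simp add: lists_matching_def)
      have inj: "\<tau> i = \<tau> j \<longleftrightarrow> i = j" for i j using pt permutes_inj by (metis injD)
      have "inj_on (\<lambda>k. {\<tau> (2 * k), \<tau> (2 * k + 1)}) {..<n}"
      proof (rule inj_onI)
        fix k l assume "{\<tau> (2 * k), \<tau> (2 * k + 1)} = {\<tau> (2 * l), \<tau> (2 * l + 1)}"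
        then show "k = l" by (auto simp: doubleton_eq_iff inj)
      qed
      then have "(\<Prod>e\<in>M \<sigma>. w e) = (\<Prod>k<n. w {\<tau> (2 * k), \<tau> (2 * k + 1)})"
        using lmM[OF \<tau>(2)] by (simp add: M_def prod.reindex)
      also have "\<dots> = (\<Prod>k<n. A $$ (\<tau> (2 * k), \<tau> (2 * k + 1)))"
      proof (rule prod.cong[OF refl])
        fix k assume "k \<in> {..<n}"
        then have "k < n" by simp
        then have "\<tau> (2 * k) < 2 * n" "\<tau> (2 * k + 1) < 2 * n"
          using permutes_in_image[OF pt] by auto
        then show "w {\<tau> (2 * k), \<tau> (2 * k + 1)} = A $$ (\<tau> (2 * k), \<tau> (2 * k + 1))"
          using \<tau>(3)[OF \<open>k < n\<close>] by (simp add: entry)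
      qed
      finally show ?thesis by simp
    qed
    ultimately show ?thesis
      unfolding T_def matching_sgn_def C_def[symmetric] \<tau>(1)[symmetric] by simp
  qed
  have "pfaffian A = (\<Sum>\<sigma>\<in>matching_perms n. T \<sigma>)"
    by (simp add: pfaffian_def T_def A_def skew_adjacency_def)
  also have "\<dots> = (\<Sum>\<sigma>\<in>matching_perms n. if M \<sigma> \<in> perfect_matchings {0..<2 * n} E
      then of_int (matching_sgn n D (M \<sigma>)) * (\<Prod>e\<in>M \<sigma>. w e) else 0)"
    by (rule sum.cong) (auto simp: zero val)
  also have "\<dots> = (\<Sum>a\<in>perfect_matchings {0..<2 * n} K. if a \<in> perfect_matchings {0..<2 * n} E
      then of_int (matching_sgn n D a) * (\<Prod>e\<in>a. w e) else 0)"
    by (rule sum.reindex_bij_betw[OF bij])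
  also have "\<dots> = (\<Sum>a\<in>perfect_matchings {0..<2 * n} E.
      of_int (matching_sgn n D a) * (\<Prod>e\<in>a. w e))"
  proof (rule sum.mono_neutral_cong_right)
    show "finite (perfect_matchings {0..<2 * n} K)"
      by (rule finite_subset[of _ "Pow (Pow {0..<2 * n})"])
        (auto simp: perfect_matchings_def)
    show "perfect_matchings {0..<2 * n} E \<subseteq> perfect_matchings {0..<2 * n} K"
      using EK by (auto simp: perfect_matchings_def)
  qed auto
  finally show ?thesis by (simp add: A_def)
qed

end

theory Submission
  imports Defs "HOL-Combinatorics.Cycles"
begin

text \<open>
  In a cubic graph the cycle covers are exactly the complements of the perfect matchings \<open>a\<close>. So
  the undirected determinant is the sum of \<open>(- 1) ^ c(a)\<close> times the weights outside \<open>a\<close>, where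
  \<open>c(a)\<close> counts the components of the complement of \<open>a\<close>, while \<open>p\<close> times the Pfaffian of the
  inverted matrix is the sum of \<open>sgn a\<close> times the same products. It has to be shown that
  \<open>sgn a * (- 1) ^ c(a)\<close> is the same for all perfect matchings (\<open>complement_sign_constant\<close>). Two
  perfect matchings are connected by a chain in which consecutive ones differ along a single
  alternating cycle (\<open>exists_alternating_cycle\<close>); such a cycle is central and has an even length
  \<open>2 * k\<close>. It remains to compare \<open>a\<close> with the matching \<open>flipped\<close> along it.

  Rotating the cycle by one step is an odd permutation that turns \<open>a\<close> into \<open>flipped\<close>. Therefore
  the two signs multiply to \<open>- 1\<close> to the number of forward edges plus one
  (\<open>matching_sgn_flipped\<close>), which is \<open>(- 1) ^ (k + 1)\<close> for a semi-Pfaffian orientation.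

  Outside the cycle the two complements agree. Their edges there form closed cycles, which count
  equally on both sides, and paths with both ends on the cycle, so that the vertices of the cycle
  are paired; each complement closes these paths up to loops by every other edge of the cycle.
  Planarity enters here: a path stays on one side of the cycle, and two paths on the same side do
  not cross (\<open>chords_do_not_cross\<close>). The inside case is the theta curve theorem, and the
  outside case follows from it by an inversion of the plane. So two paired vertices are separated
  by an even number of vertices of their own kind (in or out). This determines consistent
  directions on all loops, and turns the numbers of loops into signs of permutations. The
  two permutations list the same pairing, and can be compared without knowing it; the outcome
  depends only on the positions of the out-vertices, and for tension zero the two numbers of
  loops have a sum of the same parity as \<open>k + 1\<close> (\<open>chord_diagram_parity\<close>). This cancels the
  sign \<open>(- 1) ^ (k + 1)\<close> above.
\<close>

section \<open>Signs of permutations and numbers of classes\<close>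

text \<open>
  Elements of \<^term>\<open>S\<close> are classified by the part of \<^term>\<open>S\<close> that they reach; a path between them may
  leave \<^term>\<open>S\<close>. For symmetric relations and for permutations of finite sets, where reachability
  is an equivalence relation, these parts are its classes.
\<close>

definition num_classes :: "'a set \<Rightarrow> ('a \<times> 'a) set \<Rightarrow> nat" where
  "num_classes S r = card ((\<lambda>x. {y \<in> S. (x, y) \<in> r\<^sup>*}) ` S)"

abbreviation fun_rel :: "('a \<Rightarrow> 'a) \<Rightarrow> ('a \<times> 'a) set" where
  "fun_rel f \<equiv> {(x, y). y = f x}"

lemma num_components_eq_num_classes:
  "num_components N c = num_classes {0..<N} {(x, y). {x, y} \<in> c}"
proof -
  have "{0..<N} // {(u, v). u < N \<and> v < N \<and> (u, v) \<in> {(x, y). {x, y} \<in> c}\<^sup>*}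
      = (\<lambda>x. {y \<in> {0..<N}. (x, y) \<in> {(x, y). {x, y} \<in> c}\<^sup>*}) ` {0..<N}"
    unfolding quotient_def by (auto simp: image_def)
  then show ?thesis by (simp add: num_components_def num_classes_def)
qed

lemma num_classes_cong:
  assumes "\<And>x y. x \<in> S \<Longrightarrow> y \<in> S \<Longrightarrow> (x, y) \<in> r\<^sup>* \<longleftrightarrow> (x, y) \<in> r'\<^sup>*"
  shows "num_classes S r = num_classes S r'"
proof -
  have "(\<lambda>x. {y \<in> S. (x, y) \<in> r\<^sup>*}) ` S = (\<lambda>x. {y \<in> S. (x, y) \<in> r'\<^sup>*}) ` S"
    using assms by (intro image_cong refl) auto
  then show ?thesis by (simp add: num_classes_def)
qed

lemma rtrancl_closed:
  assumes "(x, y) \<in> r\<^sup>*" "x \<in> S" "\<And>x y. (x, y) \<in> r \<Longrightarrow> x \<in> S \<Longrightarrow> y \<in> S"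
  shows "y \<in> S"
  using assms by (induction rule: rtrancl_induct) auto

lemma num_classes_Un:
  assumes fin: "finite S" "finite T" and disj: "S \<inter> T = {}"
    and S: "\<And>x y. (x, y) \<in> r \<Longrightarrow> x \<in> S \<Longrightarrow> y \<in> S"
    and T: "\<And>x y. (x, y) \<in> r \<Longrightarrow> x \<in> T \<Longrightarrow> y \<in> T"
  shows "num_classes (S \<union> T) r = num_classes S r + num_classes T r"
proof -
  have s: "{y \<in> S \<union> T. (x, y) \<in> r\<^sup>*} = {y \<in> S. (x, y) \<in> r\<^sup>*}" if "x \<in> S" for x
    using rtrancl_closed[of x _ r S] S that disj by blast
  have t: "{y \<in> S \<union> T. (x, y) \<in> r\<^sup>*} = {y \<in> T. (x, y) \<in> r\<^sup>*}" if "x \<in> T" for x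
    using rtrancl_closed[of x _ r T] T that disj by blast
  have "(\<lambda>x. {y \<in> S \<union> T. (x, y) \<in> r\<^sup>*}) ` (S \<union> T)
      = (\<lambda>x. {y \<in> S. (x, y) \<in> r\<^sup>*}) ` S \<union> (\<lambda>x. {y \<in> T. (x, y) \<in> r\<^sup>*}) ` T"
    unfolding image_Un using s t by simp
  moreover have "(\<lambda>x. {y \<in> S. (x, y) \<in> r\<^sup>*}) ` S \<inter> (\<lambda>x. {y \<in> T. (x, y) \<in> r\<^sup>*}) ` T = {}"
  proof -
    have "{y \<in> S. (x, y) \<in> r\<^sup>*} \<noteq> {y \<in> T. (x', y) \<in> r\<^sup>*}" if "x \<in> S" for x x'
      using that disj by blast
    then show ?thesis by blast
  qed
  ultimately show ?thesis
    using fin by (simp add: num_classes_def card_Un_disjoint)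
qed

lemma num_classes_eq_1:
  assumes "S \<noteq> {}" "\<And>x y. x \<in> S \<Longrightarrow> y \<in> S \<Longrightarrow> (x, y) \<in> r\<^sup>*"
  shows "num_classes S r = 1"
proof -
  have "(\<lambda>x. {y \<in> S. (x, y) \<in> r\<^sup>*}) ` S = (\<lambda>x. S) ` S"
    using assms by (intro image_cong refl) auto
  with assms show ?thesis by (simp add: num_classes_def image_constant_conv)
qed

lemma cycle_of_list_nth:
  assumes "distinct cs" "i < length cs"
  shows "cycle_of_list cs (cs ! i) = cs ! (Suc i mod length cs)"
proof -
  have "map (cycle_of_list cs) cs = rotate 1 cs"
    using cyclic_rotation[OF assms(1), of 1] by simp
  then have "map (cycle_of_list cs) cs ! i = rotate 1 cs ! i" by simp
  then show ?thesis using assms by (simp add: nth_rotate del: rotate_Suc)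
qed

lemma sign_cycle_of_list:
  assumes "distinct cs" "cs \<noteq> []"
  shows "sign (cycle_of_list cs) = (- 1) ^ (length cs - 1)"
  using assms
proof (induction cs rule: cycle_of_list.induct)
  case (1 i j cs)
  have "permutation (cycle_of_list (j # cs))" by (rule permutation_of_cycle)
  with 1 show ?case
    by (simp add: sign_compose permutation_swap_id sign_swap_id del: comp_apply flip: comp_def)
qed simp_all

lemma num_classes_cycle_of_list:
  assumes "distinct cs" "cs \<noteq> []"
  shows "num_classes (set cs) (fun_rel (cycle_of_list cs)) = 1"
proof (rule num_classes_eq_1)
  let ?r = "fun_rel (cycle_of_list cs)"
  have step: "(cs ! i, cs ! ((i + m) mod length cs)) \<in> ?r\<^sup>*" if "i < length cs" for i m
  proof (induction m)
    case 0
    then show ?case using that by simp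
  next
    case (Suc m)
    have "cycle_of_list cs (cs ! ((i + m) mod length cs)) = cs ! ((i + Suc m) mod length cs)"
      using assms by (subst cycle_of_list_nth) (auto simp: mod_Suc_eq)
    then show ?case using Suc rtrancl.rtrancl_into_rtrancl[OF Suc] by simp
  qed
  fix x y assume "x \<in> set cs" "y \<in> set cs"
  then obtain i j where ij: "i < length cs" "x = cs ! i" "j < length cs" "y = cs ! j"
    by (metis in_set_conv_nth)
  have "(i + (length cs - i + j)) mod length cs = j" using ij by simp
  then show "(x, y) \<in> ?r\<^sup>*" using step[OF ij(1), of "length cs - i + j"] ij by simp
qed (use assms in simp)

text \<open>
  In a decomposition into disjoint cycles, a cycle of length \<open>l\<close> has the sign \<open>(- 1) ^ (l - 1)\<close>
  and contributes one class and \<open>l\<close> elements.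
\<close>

lemma sign_eq_num_classes:
  assumes "p permutes S" "finite S"
  shows "sign p = (- 1) ^ (card S + num_classes S (fun_rel p))"
proof -
  have "cycle_decomp S p" by (rule cycle_decomposition[OF assms])
  then have "finite S \<and> p permutes S \<and> sign p = (- 1) ^ (card S + num_classes S (fun_rel p))"
  proof (induction rule: cycle_decomp.induct)
    case empty
    then show ?case by (auto simp: num_classes_def permutes_id sign_id simp flip: id_def)
  next
    case (comp I p cs)
    let ?q = "cycle_of_list cs \<circ> p"
    have IH: "finite I" "p permutes I" "sign p = (- 1) ^ (card I + num_classes I (fun_rel p))"
      using comp.IH by auto
    have q: "?q permutes (set cs \<union> I)"
      using permutes_subset[OF cycle_permutes, of cs "set cs \<union> I"]
        permutes_subset[OF IH(2), of "set cs \<union> I"] by (intro permutes_compose) auto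
    show ?case
    proof (cases "cs = []")
      case True
      then show ?thesis using IH by simp
    next
      case False
      have on_cs: "?q x = cycle_of_list cs x" if "x \<in> set cs" for x
        using comp.hyps(3) that permutes_not_in[OF IH(2), of x] by (auto simp: disjoint_iff)
      have on_I: "?q x = p x" if "x \<in> I" for x
      proof -
        have "p x \<notin> set cs" using that permutes_in_image[OF IH(2), of x] comp.hyps(3) by blast
        then show ?thesis using permutes_not_in[OF cycle_permutes, of "p x" cs] by simp
      qed
      have cs_in: "cycle_of_list cs x \<in> set cs" if "x \<in> set cs" for x
        using that permutes_in_image[OF cycle_permutes, of cs x] by blast
      have p_in: "p x \<in> I" if "x \<in> I" for x
        using that permutes_in_image[OF IH(2), of x] by blast
      have r: "(x, y) \<in> (fun_rel f)\<^sup>* \<longleftrightarrow> (x, y) \<in> (fun_rel g)\<^sup>*"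
        if "x \<in> A" "\<And>z. z \<in> A \<Longrightarrow> f z = g z" "\<And>z. z \<in> A \<Longrightarrow> g z \<in> A" for f g :: "'a \<Rightarrow> 'a" and A x y
      proof -
        have "(x, y) \<in> (fun_rel f)\<^sup>* \<Longrightarrow> (x, y) \<in> (fun_rel g)\<^sup>* \<and> y \<in> A"
          by (induction rule: rtrancl_induct) (use that in \<open>auto intro: rtrancl.rtrancl_into_rtrancl\<close>)
        moreover have "(x, y) \<in> (fun_rel g)\<^sup>* \<Longrightarrow> (x, y) \<in> (fun_rel f)\<^sup>* \<and> y \<in> A"
          by (induction rule: rtrancl_induct) (use that in \<open>auto intro: rtrancl.rtrancl_into_rtrancl\<close>)
        ultimately show ?thesis by blast
      qed
      have "num_classes (set cs \<union> I) (fun_rel ?q)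
          = num_classes (set cs) (fun_rel ?q) + num_classes I (fun_rel ?q)"
        using comp.hyps(3) IH(1) on_cs on_I cs_in p_in
        by (intro num_classes_Un) (auto simp del: comp_apply)
      also have "num_classes (set cs) (fun_rel ?q) = num_classes (set cs) (fun_rel (cycle_of_list cs))"
        by (intro num_classes_cong r[of _ "set cs"]) (use on_cs cs_in in auto)
      also have "\<dots> = 1" using comp.hyps(2) False by (intro num_classes_cycle_of_list) auto
      also have "num_classes I (fun_rel ?q) = num_classes I (fun_rel p)"
        by (intro num_classes_cong r[of _ I]) (use on_I p_in in auto)
      finally have n: "num_classes (set cs \<union> I) (fun_rel ?q) = 1 + num_classes I (fun_rel p)" .
      have c: "card (set cs \<union> I) = length cs + card I"
        using comp.hyps IH(1) by (simp add: card_Un_disjoint distinct_card)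
      have "permutation p" using IH permutation_permutes by blast
      then have "sign ?q = (- 1) ^ (length cs - 1) * (- 1) ^ (card I + num_classes I (fun_rel p))"
        using sign_compose[OF permutation_of_cycle, of p cs] sign_cycle_of_list[OF comp.hyps(2) False] IH(3)
        by simp
      also have "\<dots> = (- 1) ^ (card (set cs \<union> I) + num_classes (set cs \<union> I) (fun_rel ?q))"
        unfolding n c using False by (cases cs) (simp_all add: power_add)
      finally have "sign ?q = (- 1) ^ (card (set cs \<union> I) + num_classes (set cs \<union> I) (fun_rel ?q))" .
      with q IH(1) show ?thesis by blast
    qed
  qed
  then show ?thesis by blast
qed

lemma even_card_involution:
  assumes "finite S" "\<And>x. x \<in> S \<Longrightarrow> f x \<in> S" "\<And>x. x \<in> S \<Longrightarrow> f (f x) = x" "\<And>x. x \<in> S \<Longrightarrow> f x \<noteq> x"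
  shows "even (card S)"
  using assms
proof (induction "card S" arbitrary: S rule: less_induct)
  case less
  show ?case
  proof (cases "S = {}")
    case False
    then obtain x where x: "x \<in> S" by blast
    let ?S = "S - {x, f x}"
    have sub: "{x, f x} \<subseteq> S" and two: "card {x, f x} = 2"
      using x less.prems(2,4)[OF x] by auto
    have le: "2 \<le> card S" using card_mono[OF less.prems(1) sub] two by simp
    have c: "card ?S = card S - 2"
      using card_Diff_subset[OF _ sub] two by simp
    have "even (card ?S)"
    proof (rule less.hyps)
      show "card ?S < card S" using c le by simp
      show "f y \<in> ?S" if "y \<in> ?S" for y
        using that less.prems(2,3)[of y] less.prems(3)[of x] x by auto
    qed (use less.prems in auto)
    then show ?thesis using c le by simp
  qed simp
qed

lemma card_split: "finite A \<Longrightarrow> card A = card {x \<in> A. Q x} + card {x \<in> A. \<not> Q x}"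
  by (subst card_Un_disjoint[symmetric]) (auto intro: arg_cong[where f = card])

lemma odd_add_of_minus_one_power: "(- 1 :: int) ^ x = - ((- 1) ^ y) \<Longrightarrow> odd (x + y)"
  by (cases "even x"; cases "even y") auto

text \<open>
  A power of a permutation of finite order is its inverse, so the orbits can be traversed backwards.
\<close>

lemma rtrancl_permutation_sym:
  assumes "permutation p" "(x, y) \<in> (fun_rel p)\<^sup>*"
  shows "(y, x) \<in> (fun_rel p)\<^sup>*"
  using assms(2)
proof (induction rule: rtrancl_induct)
  case (step y z)
  obtain n where n: "p ^^ n = id" "n > 0" using permutation_is_nilpotent[OF assms(1)] .
  have pow: "(u, (p ^^ m) u) \<in> (fun_rel p)\<^sup>*" for u m
    by (induction m) (auto intro: rtrancl.rtrancl_into_rtrancl)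
  have "(p ^^ (n - 1)) (p y) = (p ^^ n) y" using n(2) by (cases n) (simp_all add: funpow_swap1)
  then have "(p y, y) \<in> (fun_rel p)\<^sup>*" using pow[of "p y" "n - 1"] n(1) by simp
  then show ?case using step by (auto intro: rtrancl_trans)
qed simp


section \<open>Loops of chord diagrams\<close>

text \<open>
  Points \<open>0, ..., n - 1\<close> on a circle are joined by chords (from \<^term>\<open>i\<close> to \<^term>\<open>mate i\<close>) and by arcs
  (from \<^term>\<open>i\<close> to \<^term>\<open>\<mu> i\<close>); the classes of this relation are the loops that chords and arcs form.
\<close>

definition link_rel :: "nat \<Rightarrow> (nat \<Rightarrow> nat) \<Rightarrow> (nat \<Rightarrow> nat) \<Rightarrow> (nat \<times> nat) set" where
  "link_rel n mate \<mu> = {(i, j). i < n \<and> (j = mate i \<or> j = \<mu> i)}"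

text \<open>
  The predicate \<open>Q\<close> orients the loops: a chord is traversed from its end in \<open>Q\<close>, an arc towards its
  end in \<open>Q\<close>. Following this orientation is a permutation \<open>\<psi>\<close> whose cycles are the loops, so its
  sign gives their number modulo 2. If \<open>L\<close> lists the arcs in the direction of traversal, then
  \<open>\<psi> \<circ> L\<close> lists the chords in the direction of traversal. The benefit of \<open>X\<close> is that it is a
  listing of the chords alone, so that listings arising from different arcs can be compared.
\<close>

lemma loops_sign:
  assumes mate: "\<And>i. i < 2 * k \<Longrightarrow> mate i < 2 * k" "\<And>i. i < 2 * k \<Longrightarrow> mate (mate i) = i"
    and mateQ: "\<And>i. i < 2 * k \<Longrightarrow> Q (mate i) \<longleftrightarrow> \<not> Q i"
    and L: "L permutes {0..<2 * k}"
    and LQ: "\<And>m. m < k \<Longrightarrow> \<not> Q (L (2 * m)) \<and> Q (L (2 * m + 1))"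
    and \<mu>: "\<And>m. m < k \<Longrightarrow> \<mu> (L (2 * m)) = L (2 * m + 1) \<and> \<mu> (L (2 * m + 1)) = L (2 * m)"
  obtains X where "lists_matching k ((\<lambda>i. {i, mate i}) ` {0..<2 * k}) X"
    "\<And>m. m < k \<Longrightarrow> Q (X (2 * m)) \<and> \<not> Q (X (2 * m + 1))"
    "sign X = (- 1) ^ num_classes {0..<2 * k} (link_rel (2 * k) mate \<mu>) * sign L"
proof -
  have L_lt: "L i < 2 * k" if "i < 2 * k" for i using permutes_in_image[OF L, of i] that by simp
  have slot: "\<exists>m<k. i = (if Q i then L (2 * m + 1) else L (2 * m))" if "i < 2 * k" for i
  proof -
    obtain j where j: "j < 2 * k" "i = L j"
    proof -
      have "i \<in> L ` {0..<2 * k}" using \<open>i < 2 * k\<close> unfolding permutes_image[OF L] by simp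
      then show ?thesis using that by auto
    qed
    have m: "j div 2 < k" using j by linarith
    show ?thesis
    proof (cases "even j")
      case True
      then have "i = L (2 * (j div 2))" using j by simp
      then show ?thesis using LQ[OF m] m by auto
    next
      case False
      then have "i = L (2 * (j div 2) + 1)" using j by simp
      then show ?thesis using LQ[OF m] m by auto
    qed
  qed
  have \<mu>_lt: "\<mu> i < 2 * k" "\<mu> (\<mu> i) = i" "Q (\<mu> i) \<longleftrightarrow> \<not> Q i" if "i < 2 * k" for i
  proof -
    obtain m where m: "m < k" "i = L (2 * m + 1) \<or> i = L (2 * m)"
      using slot[OF \<open>i < 2 * k\<close>] by (auto split: if_splits)
    have lt: "L (2 * m) < 2 * k" "L (2 * m + 1) < 2 * k" using m(1) by (auto intro!: L_lt)
    from m(2) have "\<mu> i < 2 * k \<and> \<mu> (\<mu> i) = i \<and> (Q (\<mu> i) \<longleftrightarrow> \<not> Q i)"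
    proof
      assume "i = L (2 * m + 1)"
      then show ?thesis using \<mu>[OF m(1)] LQ[OF m(1)] lt by simp
    next
      assume "i = L (2 * m)"
      then show ?thesis using \<mu>[OF m(1)] LQ[OF m(1)] lt by simp
    qed
    then show "\<mu> i < 2 * k" "\<mu> (\<mu> i) = i" "Q (\<mu> i) \<longleftrightarrow> \<not> Q i" by blast+
  qed
  define \<psi> where "\<psi> i = (if i < 2 * k then if Q i then mate i else \<mu> i else i)" for i
  have \<psi>Q: "Q (\<psi> i) \<longleftrightarrow> \<not> Q i" if "i < 2 * k" for i
    using that mateQ \<mu>_lt by (simp add: \<psi>_def)
  have "inj_on \<psi> {0..<2 * k}"
  proof (rule inj_onI)
    fix i j assume "i \<in> {0..<2 * k}" "j \<in> {0..<2 * k}" and eq: "\<psi> i = \<psi> j"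
    then have ij: "i < 2 * k" "j < 2 * k" by auto
    then have Q: "Q i \<longleftrightarrow> Q j" using \<psi>Q[of i] \<psi>Q[of j] eq by simp
    show "i = j"
    proof (cases "Q i")
      case True
      then have "mate i = mate j" using eq Q ij by (simp add: \<psi>_def)
      then show ?thesis using mate(2)[OF ij(1)] mate(2)[OF ij(2)] by metis
    next
      case False
      then have "\<mu> i = \<mu> j" using eq Q ij by (simp add: \<psi>_def)
      then show ?thesis using \<mu>_lt(2)[OF ij(1)] \<mu>_lt(2)[OF ij(2)] by metis
    qed
  qed
  moreover have "\<psi> ` {0..<2 * k} \<subseteq> {0..<2 * k}" using mate(1) \<mu>_lt(1) by (auto simp: \<psi>_def)
  ultimately have "bij_betw \<psi> {0..<2 * k} {0..<2 * k}"
    by (simp add: bij_betw_def endo_inj_surj)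
  then have \<psi>: "\<psi> permutes {0..<2 * k}" by (rule bij_imp_permutes) (auto simp: \<psi>_def)
  then have perm: "permutation \<psi>" "permutation L" using L permutation_permutes by blast+
  let ?R = "link_rel (2 * k) mate \<mu>"
  have step: "(i, j) \<in> (fun_rel \<psi>)\<^sup>*" if "(i, j) \<in> ?R" for i j
  proof -
    have i: "i < 2 * k" and j: "j = mate i \<or> j = \<mu> i" using that by (auto simp: link_rel_def)
    have "j = \<psi> i \<or> i = \<psi> j"
      using j i mate(1)[OF i] mate(2)[OF i] \<mu>_lt[OF i] mateQ[OF i] by (auto simp: \<psi>_def)
    then show ?thesis using rtrancl_permutation_sym[OF perm(1)] by blast
  qed
  have "num_classes {0..<2 * k} ?R = num_classes {0..<2 * k} (fun_rel \<psi>)"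
  proof (rule num_classes_cong, rule iffI)
    fix x y assume "(x, y) \<in> ?R\<^sup>*"
    then show "(x, y) \<in> (fun_rel \<psi>)\<^sup>*"
      by (induction rule: rtrancl_induct) (auto intro: rtrancl_trans step)
  next
    fix x y :: nat assume x: "x \<in> {0..<2 * k}" and "(x, y) \<in> (fun_rel \<psi>)\<^sup>*"
    from this(2) have "(x, y) \<in> ?R\<^sup>* \<and> y < 2 * k"
    proof (induction rule: rtrancl_induct)
      case (step y z)
      then have "(y, z) \<in> ?R" "z < 2 * k"
        using mate(1) \<mu>_lt(1) by (auto simp: \<psi>_def link_rel_def)
      then show ?case using step by (auto intro: rtrancl.rtrancl_into_rtrancl)
    qed (use x in simp)
    then show "(x, y) \<in> ?R\<^sup>*" ..
  qed
  then have sign\<psi>: "sign \<psi> = (- 1) ^ num_classes {0..<2 * k} ?R"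
    using sign_eq_num_classes[OF \<psi>] by (simp add: power_add power_mult)
  define X where "X = \<psi> \<circ> L"
  have X: "X permutes {0..<2 * k}" unfolding X_def by (rule permutes_compose[OF L \<psi>])
  have Xm: "X (2 * m) = L (2 * m + 1)" "X (2 * m + 1) = mate (L (2 * m + 1))" if "m < k" for m
  proof -
    have "2 * m < 2 * k" "2 * m + 1 < 2 * k" using that by auto
    then show "X (2 * m) = L (2 * m + 1)" "X (2 * m + 1) = mate (L (2 * m + 1))"
      using L_lt LQ[OF that] \<mu>[OF that] by (auto simp: X_def \<psi>_def)
  qed
  have "(\<lambda>m. {X (2 * m), X (2 * m + 1)}) ` {..<k} = (\<lambda>i. {i, mate i}) ` {0..<2 * k}"
  proof (intro equalityI subsetI)
    fix e assume "e \<in> (\<lambda>m. {X (2 * m), X (2 * m + 1)}) ` {..<k}"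
    then obtain m where m: "m < k" "e = {X (2 * m), X (2 * m + 1)}" by auto
    have "2 * m + 1 < 2 * k" using m(1) by simp
    then show "e \<in> (\<lambda>i. {i, mate i}) ` {0..<2 * k}"
      using L_lt[of "2 * m + 1"] Xm[OF m(1)] m(2) by auto
  next
    fix e assume "e \<in> (\<lambda>i. {i, mate i}) ` {0..<2 * k}"
    then obtain i where i: "i < 2 * k" "e = {i, mate i}" by auto
    obtain i' where i': "i' < 2 * k" "e = {i', mate i'}" "Q i'"
    proof (cases "Q i")
      case True then show ?thesis using that i by blast
    next
      case False
      then show ?thesis using that[of "mate i"] i mate mateQ by (simp add: insert_commute)
    qed
    obtain m where "m < k" "i' = L (2 * m + 1)" using slot[OF i'(1)] i'(3) by auto
    then show "e \<in> (\<lambda>m. {X (2 * m), X (2 * m + 1)}) ` {..<k}" using Xm i' by auto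
  qed
  then have "lists_matching k ((\<lambda>i. {i, mate i}) ` {0..<2 * k}) X" using X by (simp add: lists_matching_def)
  moreover have "Q (X (2 * m)) \<and> \<not> Q (X (2 * m + 1))" if "m < k" for m
  proof -
    have "2 * m + 1 < 2 * k" using that by simp
    then show ?thesis using Xm[OF that] LQ[OF that] mateQ L_lt by simp
  qed
  moreover have "sign X = (- 1) ^ num_classes {0..<2 * k} ?R * sign L"
    unfolding X_def using perm by (simp add: sign_compose sign\<psi>)
  ultimately show ?thesis by (rule that)
qed

text \<open>
  The arcs join the positions \<open>2 * m\<close> and \<open>2 * m + 1\<close>, or cyclically \<open>2 * m + 1\<close> and
  \<open>2 * m + 2\<close>. The summand \<open>n\<close> avoids a truncated subtraction at position 0.
\<close>

definition even_partner :: "nat \<Rightarrow> nat" where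
  "even_partner i = (if even i then i + 1 else i - 1)"

definition odd_partner :: "nat \<Rightarrow> nat \<Rightarrow> nat" where
  "odd_partner n i = (if odd i then Suc i mod n else (i + n - 1) mod n)"

text \<open>
  Call points with \<open>In\<close> inner and the others outer. By assumption a chord joins points of the same
  kind and has evenly many points of that kind between its ends; so exactly one of its ends has
  even rank among the points of its kind. Traversing every chord from this end orients the loops
  with the arcs at odd positions consistently; for the arcs at even positions the outer chords have
  to be reversed. Both ways of traversing the loops list the same chords, with different directions
  exactly on the outer ones. So the signs of the two listings differ by \<open>(- 1) ^ q\<close>, where \<open>q\<close> is
  the number of outer chords. The signs of the two listings of arcs are known as well, and what is
  left is a count of points by kind, by parity of the position and by direction. It yields the
  parity of \<open>k + 1\<close> if as many outer points are at even as at odd positions.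
\<close>

theorem chord_diagram_parity:
  fixes In :: "nat \<Rightarrow> bool"
  assumes k: "0 < k"
    and mate: "\<And>i. i < 2 * k \<Longrightarrow> mate i < 2 * k" "\<And>i. i < 2 * k \<Longrightarrow> mate (mate i) = i"
      "\<And>i. i < 2 * k \<Longrightarrow> mate i \<noteq> i" "\<And>i. i < 2 * k \<Longrightarrow> In (mate i) = In i"
    and between: "\<And>i. i < 2 * k \<Longrightarrow> i < mate i \<Longrightarrow> even (card {l. i < l \<and> l < mate i \<and> In l = In i})"
    and tension: "card {i. i < 2 * k \<and> even i \<and> \<not> In i} = card {i. i < 2 * k \<and> odd i \<and> \<not> In i}"
  shows "even (num_classes {0..<2 * k} (link_rel (2 * k) mate even_partner)
    + num_classes {0..<2 * k} (link_rel (2 * k) mate (odd_partner (2 * k))) + k + 1)"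
proof -
  define c where "c s i = card {l. l < i \<and> In l = s}" for s i
  have c0: "c s 0 = 0" for s by (simp add: c_def)
  have cS: "c s (Suc i) = c s i + (if In i = s then 1 else 0)" for s i
  proof -
    have "{l. l < Suc i \<and> In l = s} = (if In i = s then insert i {l. l < i \<and> In l = s} else {l. l < i \<and> In l = s})"
      by (auto simp: less_Suc_eq)
    then show ?thesis by (simp add: c_def)
  qed
  have csum: "c s i + c (\<not> s) i = i" for s i
    by (induction i) (auto simp: c0 cS)
  \<comment> \<open>\<open>c s i\<close> counts the points of kind \<open>s\<close> before \<open>i\<close>; so \<open>P\<close> holds at the points of even rank
    among their kind. \<open>P\<close> orients the chords for the arcs at odd positions, \<open>P'\<close> for those at even
    positions.\<close>
  define P where "P i \<longleftrightarrow> even (c (In i) i)" for i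
  define P' where "P' i \<longleftrightarrow> (P i \<longleftrightarrow> In i)" for i
  have mateP_less: "P (mate i) \<longleftrightarrow> \<not> P i" if i: "i < 2 * k" and less: "i < mate i" for i
  proof -
    have "{l. l < mate i \<and> In l = In i}
        = {l. l < i \<and> In l = In i} \<union> insert i {l. i < l \<and> l < mate i \<and> In l = In i}"
      using less by auto
    moreover have "card ({l. l < i \<and> In l = In i} \<union> insert i {l. i < l \<and> l < mate i \<and> In l = In i})
        = c (In i) i + card (insert i {l. i < l \<and> l < mate i \<and> In l = In i})"
      unfolding c_def by (rule card_Un_disjoint) auto
    moreover have "card (insert i {l. i < l \<and> l < mate i \<and> In l = In i})
        = Suc (card {l. i < l \<and> l < mate i \<and> In l = In i})"
      by (rule card_insert_disjoint) auto
    ultimately have "c (In i) (mate i) = c (In i) i + Suc (card {l. i < l \<and> l < mate i \<and> In l = In i})"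
      by (simp only: c_def)
    then show ?thesis using between[OF i less] mate(4)[OF i] by (simp add: P_def)
  qed
  have mateP: "P (mate i) \<longleftrightarrow> \<not> P i" if i: "i < 2 * k" for i
  proof (cases "i < mate i")
    case False
    then have "mate i < mate (mate i)" using mate(2,3)[OF i] by simp
    then show ?thesis using mateP_less[of "mate i"] mate(1,2)[OF i] by simp
  qed (use mateP_less i in blast)
  have mateP': "P' (mate i) \<longleftrightarrow> \<not> P' i" if "i < 2 * k" for i
    using mateP[OF that] mate(4)[OF that] by (auto simp: P'_def)
  have c_even: "even (c s (2 * k))" for s
    unfolding c_def by (rule even_card_involution[where f = mate]) (use mate in auto)
  \<comment> \<open>Since both counts add up to \<open>i\<close>, going to a neighbour of the other kind changes the parity of
    the rank exactly if \<open>i\<close> is odd.\<close>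
  have P_Suc: "P (Suc i) \<longleftrightarrow> (if In (Suc i) = In i then \<not> P i else (P i \<longleftrightarrow> even i))" for i
  proof (cases "In (Suc i) = In i")
    case False
    then have "In (Suc i) = (\<not> In i)" by blast
    then have "P (Suc i) \<longleftrightarrow> even (c (\<not> In i) i)" by (simp add: P_def cS)
    moreover have "even (c (In i) i + c (\<not> In i) i) \<longleftrightarrow> even i" by (simp only: csum)
    ultimately show ?thesis using False by (auto simp: P_def)
  qed (simp add: P_def cS)
  have \<alpha>P': "P' (2 * m + 1) \<longleftrightarrow> \<not> P' (2 * m)" for m
    using P_Suc[of "2 * m"] by (auto simp: P'_def)
  have \<beta>P: "P ((2 * m + 2) mod (2 * k)) \<longleftrightarrow> \<not> P (2 * m + 1)" if "m < k" for m
  proof (cases "m + 1 = k")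
    case True
    \<comment> \<open>The arc that closes the circle: point 0 has rank 0, and the last point of a kind has odd
      rank, as the number of points of each kind is even.\<close>
    then have m: "(2 * m + 2) mod (2 * k) = 0" "2 * k = Suc (2 * m + 1)" by auto
    have "even (c (In (2 * m + 1)) (Suc (2 * m + 1)))" using c_even unfolding m(2) .
    then have "odd (c (In (2 * m + 1)) (2 * m + 1))" unfolding cS by simp
    then show ?thesis unfolding m(1) by (simp add: P_def c0)
  next
    case False
    then have "(2 * m + 2) mod (2 * k) = Suc (2 * m + 1)" using that by simp
    then show ?thesis using P_Suc[of "2 * m + 1"] by (auto split: if_splits)
  qed
  define S\<^sub>a where "S\<^sub>a = {m. m < k \<and> P' (2 * m)}"
  define S\<^sub>b where "S\<^sub>b = {m. m < k \<and> P (2 * m + 1)}"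
  have S: "finite S\<^sub>a" "S\<^sub>a \<subseteq> {..<k}" "finite S\<^sub>b" "S\<^sub>b \<subseteq> {..<k}" by (auto simp: S\<^sub>a_def S\<^sub>b_def)
  define shift where "shift = cycle_of_list [0..<2 * k]"
  have shift: "shift i = Suc i mod (2 * k)" if "i < 2 * k" for i
    using cycle_of_list_nth[of "[0..<2 * k]" i] that by (simp add: shift_def)
  have shift_perm: "shift permutes {0..<2 * k}"
    using cycle_permutes[of "[0..<2 * k]"] by (simp add: shift_def)
  have shift_sign: "sign shift = - 1"
    using sign_cycle_of_list[of "[0..<2 * k]"] k by (simp add: shift_def)
  have fp: "flip_perm S (2 * m) = (if m \<in> S then 2 * m + 1 else 2 * m)"
    "flip_perm S (2 * m + 1) = (if m \<in> S then 2 * m else 2 * m + 1)" for S m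
    by (auto simp: flip_perm_def)
  have sh: "shift (2 * m) = 2 * m + 1" "shift (2 * m + 1) = (2 * m + 2) mod (2 * k)" if "m < k" for m
    using that by (simp_all add: shift)
  let ?L = "shift \<circ> flip_perm S\<^sub>b"
  have Lm: "?L (2 * m) = (if m \<in> S\<^sub>b then (2 * m + 2) mod (2 * k) else 2 * m + 1)"
    "?L (2 * m + 1) = (if m \<in> S\<^sub>b then 2 * m + 1 else (2 * m + 2) mod (2 * k))" if "m < k" for m
    using sh[OF that] fp[of S\<^sub>b m] by auto
  have op: "odd_partner (2 * k) (2 * m + 1) = (2 * m + 2) mod (2 * k)"
    "odd_partner (2 * k) ((2 * m + 2) mod (2 * k)) = 2 * m + 1" if "m < k" for m
  proof -
    show "odd_partner (2 * k) (2 * m + 1) = (2 * m + 2) mod (2 * k)" by (simp add: odd_partner_def)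
    show "odd_partner (2 * k) ((2 * m + 2) mod (2 * k)) = 2 * m + 1"
    proof (cases "m + 1 = k")
      case True
      then have "(2 * m + 2) mod (2 * k) = 0" "2 * k - 1 = 2 * m + 1" by auto
      then show ?thesis using k by (simp add: odd_partner_def)
    next
      case False
      then have "(2 * m + 2) mod (2 * k) = 2 * m + 2" using that by simp
      moreover have "(2 * m + 2 + 2 * k - 1) mod (2 * k) = 2 * m + 1"
        using that by (simp add: mod_if)
      ultimately show ?thesis by (simp add: odd_partner_def)
    qed
  qed
  obtain X where X: "lists_matching k ((\<lambda>i. {i, mate i}) ` {0..<2 * k}) X"
    "\<And>m. m < k \<Longrightarrow> P' (X (2 * m)) \<and> \<not> P' (X (2 * m + 1))"
    "sign X = (- 1) ^ num_classes {0..<2 * k} (link_rel (2 * k) mate even_partner) * sign (flip_perm S\<^sub>a)"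
  proof (rule loops_sign[of k mate P' "flip_perm S\<^sub>a" even_partner])
    show "flip_perm S\<^sub>a permutes {0..<2 * k}" using flip_perm[OF S(1,2)] ..
    show "\<not> P' (flip_perm S\<^sub>a (2 * m)) \<and> P' (flip_perm S\<^sub>a (2 * m + 1))" if "m < k" for m
      using \<alpha>P'[of m] that unfolding fp by (simp add: S\<^sub>a_def)
    show "even_partner (flip_perm S\<^sub>a (2 * m)) = flip_perm S\<^sub>a (2 * m + 1) \<and>
        even_partner (flip_perm S\<^sub>a (2 * m + 1)) = flip_perm S\<^sub>a (2 * m)" for m
      unfolding fp by (simp add: even_partner_def)
  qed (use mate mateP' in blast)+
  obtain Y where Y: "lists_matching k ((\<lambda>i. {i, mate i}) ` {0..<2 * k}) Y"
    "\<And>m. m < k \<Longrightarrow> P (Y (2 * m)) \<and> \<not> P (Y (2 * m + 1))"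
    "sign Y = (- 1) ^ num_classes {0..<2 * k} (link_rel (2 * k) mate (odd_partner (2 * k))) * sign ?L"
  proof (rule loops_sign[of k mate P ?L "odd_partner (2 * k)"])
    show "?L permutes {0..<2 * k}"
      using permutes_compose[OF conjunct1[OF flip_perm[OF S(3,4)]] shift_perm] .
    show "\<not> P (?L (2 * m)) \<and> P (?L (2 * m + 1))" if "m < k" for m
      using \<beta>P[OF that] that unfolding Lm[OF that] by (simp add: S\<^sub>b_def)
    show "odd_partner (2 * k) (?L (2 * m)) = ?L (2 * m + 1) \<and>
        odd_partner (2 * k) (?L (2 * m + 1)) = ?L (2 * m)" if "m < k" for m
      unfolding Lm[OF that] using op[OF that] by simp
  qed (use mate mateP in blast)+
  have signs: "sign (flip_perm S\<^sub>a) = (- 1) ^ card S\<^sub>a" "sign ?L = - ((- 1) ^ card S\<^sub>b)"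
  proof -
    show "sign (flip_perm S\<^sub>a) = (- 1) ^ card S\<^sub>a" using flip_perm[OF S(1,2)] ..
    have "permutation (flip_perm S\<^sub>b)" using flip_perm[OF S(3,4)] permutation_permutes by blast
    moreover have "permutation shift" using shift_perm permutation_permutes by blast
    ultimately show "sign ?L = - ((- 1) ^ card S\<^sub>b)"
      using flip_perm[OF S(3,4)] by (simp add: sign_compose shift_sign)
  qed
  define q where "q = card {i. i < 2 * k \<and> \<not> In i \<and> \<not> P i}"
  have XY: "sign X * (- 1) ^ q = sign Y"
  proof -
    \<comment> \<open>A skew symmetric matrix that is 1 on chords directed by \<open>P\<close>: its Pfaffian terms for the two
      listings of the same chords agree.\<close>
    define A :: "rat mat" where "A = Matrix.mat (2 * k) (2 * k)
      (\<lambda>(i, j). if P i = P j then 0 else if P i then 1 else - 1)"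
    have A: "A $$ (i, j) = (if P i = P j then 0 else if P i then 1 else - 1)"
      if "i < 2 * k" "j < 2 * k" for i j using that by (simp add: A_def)
    have lt: "X i < 2 * k" "Y i < 2 * k" if "i < 2 * k" for i
      using X(1) Y(1) that permutes_in_image[of X "{0..<2 * k}" i] permutes_in_image[of Y "{0..<2 * k}" i]
      by (auto simp: lists_matching_def)
    have "of_int (sign X) * (\<Prod>m<k. A $$ (X (2 * m), X (2 * m + 1)))
        = of_int (sign Y) * (\<Prod>m<k. A $$ (Y (2 * m), Y (2 * m + 1)))"
      by (rule pfaffian_term_cong[OF X(1) Y(1)]) (simp add: A)
    moreover have "(\<Prod>m<k. A $$ (Y (2 * m), Y (2 * m + 1))) = 1"
      by (rule prod.neutral) (use Y(2) lt in \<open>simp add: A\<close>)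
    moreover have "(\<Prod>m<k. A $$ (X (2 * m), X (2 * m + 1))) = (- 1) ^ q"
    proof -
      have XP: "{X (2 * m), X (2 * m + 1)} \<in> (\<lambda>i. {i, mate i}) ` {0..<2 * k}" if "m < k" for m
        using X(1) that by (auto simp: lists_matching_def)
      have neq: "P (X (2 * m + 1)) \<longleftrightarrow> \<not> P (X (2 * m))" if "m < k" for m
      proof -
        obtain i where "i < 2 * k" "{X (2 * m), X (2 * m + 1)} = {i, mate i}" using XP[OF \<open>m < k\<close>] by auto
        then show ?thesis using mateP[of i] by (auto simp: doubleton_eq_iff)
      qed
      have "(\<Prod>m<k. A $$ (X (2 * m), X (2 * m + 1))) = (\<Prod>m<k. if P (X (2 * m)) then 1 else - 1)"
        by (rule prod.cong) (use neq lt in \<open>auto simp: A\<close>)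
      also have "\<dots> = (\<Prod>m\<in>{m. m < k \<and> \<not> P (X (2 * m))}. - 1)"
        by (rule prod.mono_neutral_cong_right) auto
      also have "\<dots> = (- 1) ^ card {m. m < k \<and> \<not> P (X (2 * m))}" by simp
      also have "card {m. m < k \<and> \<not> P (X (2 * m))} = q"
        unfolding q_def
      proof (rule bij_betw_same_card[of "\<lambda>m. X (2 * m)"], unfold bij_betw_def, intro conjI)
        have pX: "X permutes {0..<2 * k}" using X(1) by (simp add: lists_matching_def)
        show "inj_on (\<lambda>m. X (2 * m)) {m. m < k \<and> \<not> P (X (2 * m))}"
        proof (rule inj_onI)
          fix m m' assume "X (2 * m) = X (2 * m')"
          then have "2 * m = 2 * m'" by (rule injD[OF permutes_inj[OF pX]])
          then show "m = m'" by simp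
        qed
        show "(\<lambda>m. X (2 * m)) ` {m. m < k \<and> \<not> P (X (2 * m))} = {i. i < 2 * k \<and> \<not> In i \<and> \<not> P i}"
        proof (intro equalityI subsetI)
          fix i assume "i \<in> (\<lambda>m. X (2 * m)) ` {m. m < k \<and> \<not> P (X (2 * m))}"
          then show "i \<in> {i. i < 2 * k \<and> \<not> In i \<and> \<not> P i}"
            using X(2) lt by (auto simp: P'_def)
        next
          fix i assume i: "i \<in> {i. i < 2 * k \<and> \<not> In i \<and> \<not> P i}"
          then have "P' i" by (simp add: P'_def)
          obtain j where j: "j < 2 * k" "i = X j"
            using i permutes_image[OF pX] by (metis (lifting) atLeastLessThan_iff imageE mem_Collect_eq zero_le)
          have m: "j div 2 < k" using j by linarith
          moreover have "j = 2 * (j div 2) \<or> j = 2 * (j div 2) + 1" by linarith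
          ultimately have "j = 2 * (j div 2)" using X(2)[OF m] j(2) \<open>P' i\<close> by metis
          then show "i \<in> (\<lambda>m. X (2 * m)) ` {m. m < k \<and> \<not> P (X (2 * m))}"
            using m i j(2) by (intro image_eqI[of _ _ "j div 2"]) auto
        qed
      qed
      finally show ?thesis .
    qed
    ultimately have "rat_of_int (sign X * (- 1) ^ q) = rat_of_int (sign Y)" by simp
    then show ?thesis by (simp only: of_int_eq_iff)
  qed
  define d where "d e s p = card {i. i < 2 * k \<and> even i = e \<and> In i = s \<and> P i = p}" for e s p
  have fin: "finite {i. i < 2 * k \<and> T i}" for T by simp
  have d_even: "card {i. i < 2 * k \<and> even i = e} = k" for e
  proof -
    have "{i. i < 2 * k \<and> even i = e} = (\<lambda>m. 2 * m + (if e then 0 else 1)) ` {..<k}"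
    proof (intro equalityI subsetI)
      fix i assume "i \<in> {i. i < 2 * k \<and> even i = e}"
      then have "i = 2 * (i div 2) + (if e then 0 else 1)" "i div 2 < k" by (auto simp: odd_two_times_div_two_succ)
      then show "i \<in> (\<lambda>m. 2 * m + (if e then 0 else 1)) ` {..<k}" by blast
    qed (auto split: if_splits)
    moreover have "inj_on (\<lambda>m. 2 * m + (if e then 0 else 1 :: nat)) {..<k}" by (auto simp: inj_on_def)
    ultimately show ?thesis by (simp add: card_image)
  qed
  have split: "card {i. i < 2 * k \<and> T i} = card {i. i < 2 * k \<and> T i \<and> U i} + card {i. i < 2 * k \<and> T i \<and> \<not> U i}" for T U
    using card_split[OF fin[of T], of U] by (simp add: conj_assoc)
  have d1: "card {i. i < 2 * k \<and> even i = e \<and> In i = s} = d e s True + d e s False" for e s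
    using split[of "\<lambda>i. even i = e \<and> In i = s" P] by (simp only: d_def conj_assoc simp_thms)
  have d2: "k = d e True True + d e True False + d e False True + d e False False" for e
    using split[of "\<lambda>i. even i = e" In] d1[of e True] d1[of e False] d_even[of e]
    by (simp only: simp_thms)
  have d3: "card {i. i < 2 * k \<and> In i = s \<and> P i = p} = d True s p + d False s p" for s p
  proof -
    have "{i. i < 2 * k \<and> (In i = s \<and> P i = p) \<and> even i} = {i. i < 2 * k \<and> even i = True \<and> In i = s \<and> P i = p}"
      "{i. i < 2 * k \<and> (In i = s \<and> P i = p) \<and> odd i} = {i. i < 2 * k \<and> even i = False \<and> In i = s \<and> P i = p}"
      by auto
    then show ?thesis unfolding d_def using split[of "\<lambda>i. In i = s \<and> P i = p" even] by simp
  qed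
  have d4: "card {i. i < 2 * k \<and> In i = s \<and> P i = True} = card {i. i < 2 * k \<and> In i = s \<and> P i = False}" for s
    by (rule bij_betw_same_card[of mate], rule bij_betwI[where g = mate]) (use mate mateP in auto)
  have d5: "d True False True + d True False False = d False False True + d False False False"
    using tension d1[of True False] d1[of False False] by simp
  have q: "q = d True False False + d False False False" using d3[of False False] by (simp only: q_def simp_thms)
  have half: "card {m. m < k \<and> T (2 * m + b)} = card {i. i < 2 * k \<and> even i = (b = 0) \<and> T i}"
    if "b = 0 \<or> b = 1" for b :: nat and T
  proof (rule bij_betw_same_card[of "\<lambda>m. 2 * m + b"], rule bij_betwI[where g = "\<lambda>i. i div 2"])
    show "(\<lambda>i. i div 2) \<in> {i. i < 2 * k \<and> even i = (b = 0) \<and> T i} \<rightarrow> {m. m < k \<and> T (2 * m + b)}"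
      using that by (auto simp: odd_two_times_div_two_succ)
  qed (use that in \<open>auto simp: odd_two_times_div_two_succ\<close>)
  have Sa: "card S\<^sub>a = d True True True + d True False False"
  proof -
    have "card S\<^sub>a = card {i. i < 2 * k \<and> even i = True \<and> P' i}"
      using half[of 0 P'] by (simp add: S\<^sub>a_def)
    also have "\<dots> = card {i \<in> {i. i < 2 * k \<and> even i = True \<and> P' i}. In i} +
        card {i \<in> {i. i < 2 * k \<and> even i = True \<and> P' i}. \<not> In i}"
      by (rule card_split) simp
    also have "{i \<in> {i. i < 2 * k \<and> even i = True \<and> P' i}. In i}
        = {i. i < 2 * k \<and> even i = True \<and> In i = True \<and> P i = True}" by (auto simp: P'_def)
    also have "{i \<in> {i. i < 2 * k \<and> even i = True \<and> P' i}. \<not> In i}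
        = {i. i < 2 * k \<and> even i = True \<and> In i = False \<and> P i = False}" by (auto simp: P'_def)
    finally show ?thesis by (simp only: d_def)
  qed
  have Sb: "card S\<^sub>b = d False True True + d False False True"
  proof -
    have "card S\<^sub>b = card {i. i < 2 * k \<and> even i = False \<and> P i}"
      using half[of 1 P] by (simp add: S\<^sub>b_def)
    also have "\<dots> = card {i \<in> {i. i < 2 * k \<and> even i = False \<and> P i}. In i} +
        card {i \<in> {i. i < 2 * k \<and> even i = False \<and> P i}. \<not> In i}"
      by (rule card_split) simp
    also have "{i \<in> {i. i < 2 * k \<and> even i = False \<and> P i}. In i}
        = {i. i < 2 * k \<and> even i = False \<and> In i = True \<and> P i = True}" by auto
    also have "{i \<in> {i. i < 2 * k \<and> even i = False \<and> P i}. \<not> In i}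
        = {i. i < 2 * k \<and> even i = False \<and> In i = False \<and> P i = True}" by auto
    finally show ?thesis by (simp only: d_def)
  qed
  have in_half: "d True True True + d False True True = d True True False + d False True False"
    and out_half: "d True False True + d False False True = d True False False + d False False False"
    using d4[of True] d4[of False] unfolding d3 by blast+
  have count: "card S\<^sub>a + card S\<^sub>b + q = k + 2 * d True False False"
    using d2[of True] d2[of False] in_half out_half d5 unfolding q Sa Sb by linarith
  let ?a = "num_classes {0..<2 * k} (link_rel (2 * k) mate even_partner)"
  let ?b = "num_classes {0..<2 * k} (link_rel (2 * k) mate (odd_partner (2 * k)))"
  have "(- 1) ^ ?a * (- 1) ^ card S\<^sub>a * (- 1) ^ q = (- 1) ^ ?b * - ((- 1) ^ card S\<^sub>b :: int)"
    using XY unfolding X(3) Y(3) signs .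
  then have "(- 1 :: int) ^ (?a + card S\<^sub>a + q) = - ((- 1) ^ (?b + card S\<^sub>b))"
    by (simp only: power_add mult_minus_right)
  then have "odd (?a + card S\<^sub>a + q + (?b + card S\<^sub>b))"
    by (rule odd_add_of_minus_one_power)
  then have "odd (?a + ?b + (card S\<^sub>a + card S\<^sub>b + q))" by (simp add: add_ac)
  then show ?thesis unfolding count by simp
qed

section \<open>Chords of a Jordan curve\<close>

lemma arc_compose_inj:
  assumes "arc g" "continuous_on (path_image g) f" "inj_on f (path_image g)"
  shows "arc (f \<circ> g)"
  using assms by (auto simp: arc_def path_image_def intro: path_continuous_image comp_inj_on)

lemma arc_midpoint:
  assumes "arc g"
  shows "g (1/2) \<in> path_image g - {pathstart g, pathfinish g}"
proof -
  have "inj_on g {0..1}" using assms by (simp add: arc_def)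
  then have "g (1/2) \<noteq> g 0" "g (1/2) \<noteq> g 1" 
    using inj_on_eq_iff[of g "{0..1}" "1/2" 0] inj_on_eq_iff[of g "{0..1}" "1/2" 1] by auto
  then show ?thesis by (auto simp: path_image_def pathstart_def pathfinish_def)
qed

text \<open>
  The parameter interval without one or both of its ends is still an interval.
\<close>

lemma connected_arc_minus_ends:
  assumes g: "arc g" and A: "A \<subseteq> {pathstart g, pathfinish g}"
  shows "connected (path_image g - A)"
proof -
  have inj: "inj_on g {0..1}" and cont: "continuous_on {0..1} g"
    using g by (auto simp: arc_def path_def)
  have img: "path_image g - g ` B = g ` ({0..1} - B)" if "B \<subseteq> {0..1}" for B
    using inj_on_image_set_diff[OF inj _ that, of "{0..1}"] by (simp add: path_image_def)
  define B where "B = {t \<in> {0, 1::real}. g t \<in> A}"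
  have "A = g ` B" using A by (auto simp: B_def pathstart_def pathfinish_def)
  moreover have "B \<subseteq> {0..1}" by (auto simp: B_def)
  ultimately have "path_image g - A = g ` ({0..1} - B)" using img[of B] by simp
  moreover have "connected ({0..1} - B)"
  proof -
    consider "B = {}" | "B = {0}" | "B = {1}" | "B = {0, 1}" by (auto simp: B_def)
    then have "{0..1} - B = {0..1} \<or> {0..1} - B = {0<..1} \<or> {0..1} - B = {0..<1} \<or> {0..1} - B = {0<..<1}"
      by cases auto
    then show ?thesis by (elim disjE) (simp_all only: connected_Icc connected_Ioc connected_Ico connected_Ioo)
  qed
  ultimately show ?thesis
    by (metis Diff_subset cont connected_continuous_image continuous_on_subset)
qed

lemma connected_inside_or_outside:
  assumes "connected D" "D \<inter> S = {}"
  shows "D \<subseteq> inside S \<or> D \<subseteq> outside S"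
proof -
  have "D \<subseteq> inside S \<union> outside S" using assms(2) by (auto simp: inside_Un_outside)
  moreover have "inside S \<inter> D = {} \<or> outside S \<inter> D = {}"
    using inside_outside_intersect_connected[OF assms(1), of S] assms(2) by blast
  ultimately show ?thesis by blast
qed

lemma Jordan_two_arcs:
  fixes c1 c2 :: "real \<Rightarrow> complex"
  assumes "arc c1" "arc c2" "pathstart c1 = a" "pathfinish c1 = b" "pathstart c2 = a" "pathfinish c2 = b"
    and "path_image c1 \<inter> path_image c2 = {a, b}"
  defines "\<Gamma> \<equiv> path_image c1 \<union> path_image c2"
  shows "inside \<Gamma> \<noteq> {}" "open (inside \<Gamma>)" "connected (inside \<Gamma>)" "connected (outside \<Gamma>)"
    "bounded (inside \<Gamma>)" "inside \<Gamma> \<inter> outside \<Gamma> = {}" "inside \<Gamma> \<union> outside \<Gamma> = - \<Gamma>"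
proof -
  let ?c = "c1 +++ reversepath c2"
  have "simple_path ?c" "pathfinish ?c = pathstart ?c" "path_image ?c = \<Gamma>"
    using assms by (auto simp: simple_path_join_loop_eq arc_reversepath path_image_join)
  then show "inside \<Gamma> \<noteq> {}" "open (inside \<Gamma>)" "connected (inside \<Gamma>)" "connected (outside \<Gamma>)"
    "bounded (inside \<Gamma>)" "inside \<Gamma> \<inter> outside \<Gamma> = {}" "inside \<Gamma> \<union> outside \<Gamma> = - \<Gamma>"
    using Jordan_inside_outside[of ?c] by auto
qed

text \<open>
  The arc \<open>c\<close> divides the inside of the curve into the insides of \<open>c1 \<union> c\<close> and \<open>c2 \<union> c\<close>. The
  interior of \<open>d\<close> is connected and avoids \<open>c\<close>, so it lies in one of the two parts; but then \<open>d\<close> lies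
  in the closure of that part, which contains only one of the end points of \<open>d\<close>.
\<close>

lemma no_crossing_chords_inside:
  fixes c1 c2 c d :: "real \<Rightarrow> complex"
  assumes c1: "arc c1" "pathstart c1 = a" "pathfinish c1 = b"
    and c2: "arc c2" "pathstart c2 = a" "pathfinish c2 = b"
    and c: "arc c" "pathstart c = a" "pathfinish c = b"
    and d: "arc d" "pathstart d \<in> path_image c1 - {a, b}" "pathfinish d \<in> path_image c2 - {a, b}"
    and meet: "path_image c1 \<inter> path_image c2 = {a, b}"
    and disj: "path_image c \<inter> path_image d = {}"
    and c_in: "path_image c - {a, b} \<subseteq> inside (path_image c1 \<union> path_image c2)"
    and d_in: "path_image d - {pathstart d, pathfinish d} \<subseteq> inside (path_image c1 \<union> path_image c2)"
  shows False
proof -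
  let ?G = "path_image c1 \<union> path_image c2"
  have ab: "a \<noteq> b" using c arc_distinct_ends by blast
  have G: "?G \<inter> inside ?G = {}" using inside_no_overlap by blast
  have abc: "a \<in> path_image c" "b \<in> path_image c" "a \<in> path_image c1" "b \<in> path_image c1"
    "a \<in> path_image c2" "b \<in> path_image c2"
    using c pathstart_in_path_image[of c] pathfinish_in_path_image[of c] meet by blast+
  have c1c: "path_image c1 \<inter> path_image c = {a, b}" and c2c: "path_image c2 \<inter> path_image c = {a, b}"
    using c_in G abc by blast+
  have ne: "path_image c \<inter> inside ?G \<noteq> {}"
    using arc_midpoint[OF c(1)] c_in c by blast
  have split: "inside (path_image c1 \<union> path_image c) \<inter> inside (path_image c2 \<union> path_image c) = {}"
    "inside (path_image c1 \<union> path_image c) \<union> inside (path_image c2 \<union> path_image c) \<union>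
      (path_image c - {a, b}) = inside ?G"
    using split_inside_simple_closed_curve[OF arc_imp_simple_path[OF c1(1)] c1(2,3)
        arc_imp_simple_path[OF c2(1)] c2(2,3) arc_imp_simple_path[OF c(1)] c(2,3) ab meet c1c c2c ne]
    by blast+
  let ?D = "path_image d - {pathstart d, pathfinish d}"
  have D: "connected ?D" by (rule connected_arc_minus_ends[OF d(1)]) simp
  have Dcov: "?D \<subseteq> inside (path_image c1 \<union> path_image c) \<union> inside (path_image c2 \<union> path_image c)"
    using d_in split(2) disj by blast
  have opn: "open (inside (path_image c1 \<union> path_image c))" "open (inside (path_image c2 \<union> path_image c))"
    using c1(1) c2(1) c(1) by (auto intro!: open_inside simp: closed_arc_image closed_Un)
  have "?D \<subseteq> inside (path_image c1 \<union> path_image c) \<or> ?D \<subseteq> inside (path_image c2 \<union> path_image c)"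
  proof (rule ccontr)
    assume "\<not> ?thesis"
    then have "inside (path_image c1 \<union> path_image c) \<inter> ?D \<noteq> {}" "inside (path_image c2 \<union> path_image c) \<inter> ?D \<noteq> {}"
      using Dcov by blast+
    then show False using connectedD[OF D opn _ Dcov] split(1) by blast
  qed
  moreover have cl: "path_image d \<subseteq> closure ?D"
  proof -
    have "?D = d ` {0<..<1}"
    proof -
      have "inj_on d {0..1}" using d(1) by (simp add: arc_def)
      from inj_on_image_set_diff[OF this, of "{0..1}" "{0, 1}"] have "d ` ({0..1} - {0, 1}) = d ` {0..1} - d ` {0, 1}"
        by auto
      moreover have "{0..1} - {0, 1} = {0<..<1::real}" by auto
      ultimately show ?thesis by (simp add: path_image_def pathstart_def pathfinish_def)
    qed
    moreover have "continuous_on (closure {0<..<1}) d" using d(1) by (simp add: arc_def path_def)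
    then have "d ` closure {0<..<1} \<subseteq> closure (d ` {0<..<1})"
      by (rule image_closure_subset) (simp_all add: closure_subset)
    ultimately show ?thesis by (simp add: path_image_def)
  qed
  moreover have clos: "closure (inside S) \<subseteq> S \<union> inside S" if "closed S" for S :: "complex set"
    using closure_inside_subset[OF that] by blast
  moreover have "closed (path_image c1 \<union> path_image c)" "closed (path_image c2 \<union> path_image c)"
    using c1(1) c2(1) c(1) by (auto simp: closed_arc_image)
  ultimately have "path_image d \<subseteq> (path_image c1 \<union> path_image c) \<union> inside (path_image c1 \<union> path_image c)
      \<or> path_image d \<subseteq> (path_image c2 \<union> path_image c) \<union> inside (path_image c2 \<union> path_image c)"
    using closure_mono by (meson order_trans)
  moreover have "pathstart d \<notin> (path_image c2 \<union> path_image c) \<union> inside (path_image c2 \<union> path_image c)"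
    using d(2) meet disj split(2) G pathstart_in_path_image[of d] by blast
  moreover have "pathfinish d \<notin> (path_image c1 \<union> path_image c) \<union> inside (path_image c1 \<union> path_image c)"
    using d(3) meet disj split(2) G pathfinish_in_path_image[of d] by blast
  ultimately show False using pathstart_in_path_image[of d] pathfinish_in_path_image[of d] by blast
qed

text \<open>
  The image of the outside is connected, so it lies on one side of the image curve. If that were
  the unbounded side, then the image of the punctured inside, which is unbounded because of the
  points near \<open>z\<close>, would lie there too. The bounded side could only contain 0, the one point that
  is not a value of the inversion; but it is open and nonempty.
\<close>

lemma inversion_outside_subset_inside:
  fixes c1 c2 :: "real \<Rightarrow> complex"
  assumes c1: "arc c1" "pathstart c1 = a" "pathfinish c1 = b"
    and c2: "arc c2" "pathstart c2 = a" "pathfinish c2 = b"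
    and meet: "path_image c1 \<inter> path_image c2 = {a, b}"
    and z: "z \<in> inside (path_image c1 \<union> path_image c2)"
  defines "f \<equiv> \<lambda>u. inverse (u - z)"
  shows "f ` outside (path_image c1 \<union> path_image c2) \<subseteq> inside (f ` (path_image c1 \<union> path_image c2))"
proof -
  let ?G = "path_image c1 \<union> path_image c2"
  let ?H = "path_image (f \<circ> c1) \<union> path_image (f \<circ> c2)"
  note J = Jordan_two_arcs[OF c1(1) c2(1) c1(2,3) c2(2,3) meet]
  have zG: "z \<notin> ?G" "z \<notin> outside ?G" using z J(6,7) by blast+
  have cont: "continuous_on S f" if "z \<notin> S" for S
    using that unfolding f_def by (intro continuous_intros) auto
  have inj: "f u = f v \<longleftrightarrow> u = v" for u v by (simp add: f_def)
  have H: "?H = f ` ?G" by (simp add: path_image_compose image_Un)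
  have arcs: "arc (f \<circ> c1)" "arc (f \<circ> c2)"
    using c1(1) c2(1) zG by (auto intro!: arc_compose_inj cont simp: inj_on_def inj)
  have "path_image (f \<circ> c1) \<inter> path_image (f \<circ> c2) = f ` (path_image c1 \<inter> path_image c2)"
    unfolding path_image_compose by (auto simp: inj)
  then have fmeet: "path_image (f \<circ> c1) \<inter> path_image (f \<circ> c2) = {f a, f b}" by (simp add: meet)
  note K = Jordan_two_arcs[OF arcs, of "f a" "f b", unfolded pathstart_compose pathfinish_compose c1 c2,
      OF refl refl refl refl fmeet]
  have f_disj: "f ` A \<inter> f ` B = {}" if "A \<inter> B = {}" for A B using that by (auto simp: inj)
  have "f ` outside ?G \<inter> ?H = {}" unfolding H by (intro f_disj outside_no_overlap)
  then have "f ` outside ?G \<subseteq> inside ?H \<or> f ` outside ?G \<subseteq> outside ?H"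
    using zG J(4) by (intro connected_inside_or_outside connected_continuous_image cont)
  moreover have "\<not> f ` outside ?G \<subseteq> outside ?H"
  proof
    assume out: "f ` outside ?G \<subseteq> outside ?H"
    have "connected (inside ?G - {z})"
      using J(2,3) by (intro connected_open_delete) simp_all
    then have "connected (f ` (inside ?G - {z}))" by (intro connected_continuous_image cont) simp_all
    moreover have "(inside ?G - {z}) \<inter> ?G = {}" using inside_no_overlap[of ?G] by blast
    then have "f ` (inside ?G - {z}) \<inter> ?H = {}" unfolding H by (rule f_disj)
    ultimately have "f ` (inside ?G - {z}) \<subseteq> inside ?H \<or> f ` (inside ?G - {z}) \<subseteq> outside ?H"
      by (rule connected_inside_or_outside)
    moreover have "\<not> f ` (inside ?G - {z}) \<subseteq> inside ?H"
    proof
      assume "f ` (inside ?G - {z}) \<subseteq> inside ?H"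
      then have "bounded (f ` (inside ?G - {z}))" using K(5) bounded_subset by blast
      then obtain B where B: "B > 0" "\<And>u. u \<in> inside ?G - {z} \<Longrightarrow> norm (f u) \<le> B"
        unfolding bounded_pos by blast
      obtain e where e: "e > 0" "ball z e \<subseteq> inside ?G" using J(2) z open_contains_ball by blast
      define \<delta> where "\<delta> = min (e / 2) (1 / (B + 1))"
      have \<delta>: "\<delta> > 0" "\<delta> < e" "\<delta> \<le> 1 / (B + 1)" using e B by (auto simp: \<delta>_def)
      have "z + of_real \<delta> \<in> inside ?G - {z}" using \<delta> e by (auto simp: dist_norm)
      then have "norm (f (z + of_real \<delta>)) \<le> B" by (rule B(2))
      then have "1 / \<delta> \<le> B" using \<delta>(1) by (simp add: f_def norm_inverse divide_inverse)
      moreover have "B + 1 \<le> 1 / \<delta>" using \<delta> B by (simp add: field_simps)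
      ultimately show False by simp
    qed
    ultimately have inn: "f ` (inside ?G - {z}) \<subseteq> outside ?H" by blast
    have "inside ?H \<subseteq> {0}"
    proof
      fix u assume u: "u \<in> inside ?H"
      show "u \<in> {0}"
      proof (rule ccontr)
        assume "u \<notin> {0}"
        define v where "v = z + inverse u"
        have v: "f v = u" "v \<noteq> z" using \<open>u \<notin> {0}\<close> by (auto simp: v_def f_def)
        have "u \<notin> ?H" "u \<notin> outside ?H" using u K(6,7) by blast+
        then have "v \<notin> ?G" "v \<notin> outside ?G" "v \<notin> inside ?G"
          using v out inn unfolding H by blast+
        then show False using J(7) by blast
      qed
    qed
    then have "inside ?H = {0}" using K(1) by blast
    then show False using K(2) not_open_singleton by metis
  qed
  ultimately show ?thesis unfolding H by blast
qed

text \<open>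
  For chords outside of the curve, an inversion at a point of the inside moves everything to the
  inside of another curve.
\<close>

lemma no_crossing_chords:
  fixes c1 c2 c d :: "real \<Rightarrow> complex"
  assumes c1: "arc c1" "pathstart c1 = a" "pathfinish c1 = b"
    and c2: "arc c2" "pathstart c2 = a" "pathfinish c2 = b"
    and c: "arc c" "pathstart c = a" "pathfinish c = b"
    and d: "arc d" "pathstart d \<in> path_image c1 - {a, b}" "pathfinish d \<in> path_image c2 - {a, b}"
    and meet: "path_image c1 \<inter> path_image c2 = {a, b}"
    and disj: "path_image c \<inter> path_image d = {}"
    and side: "S = inside (path_image c1 \<union> path_image c2) \<or> S = outside (path_image c1 \<union> path_image c2)"
    and c_in: "path_image c - {a, b} \<subseteq> S"
    and d_in: "path_image d - {pathstart d, pathfinish d} \<subseteq> S"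
  shows False
  using side
proof
  assume "S = inside (path_image c1 \<union> path_image c2)"
  then show False
    using no_crossing_chords_inside[OF c1 c2 c d meet disj] c_in d_in by blast
next
  let ?G = "path_image c1 \<union> path_image c2"
  assume S: "S = outside ?G"
  note J = Jordan_two_arcs[OF c1(1) c2(1) c1(2,3) c2(2,3) meet]
  obtain z where z: "z \<in> inside ?G" using J(1) by blast
  define f where "f = (\<lambda>u. inverse (u - z))"
  have fS: "f ` S \<subseteq> inside (f ` ?G)"
    using inversion_outside_subset_inside[OF c1 c2 meet z] unfolding f_def S .
  have zG: "z \<notin> ?G" "z \<notin> outside ?G" using z J(6,7) by blast+
  have inj: "f u = f v \<longleftrightarrow> u = v" for u v by (simp add: f_def)
  have ends: "a \<in> ?G" "b \<in> ?G" "pathstart d \<in> ?G" "pathfinish d \<in> ?G"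
    using d(2,3) meet by blast+
  then have cG: "path_image c \<subseteq> S \<union> ?G" "path_image d \<subseteq> S \<union> ?G" using c_in d_in by blast+
  have arcs: "arc (f \<circ> g)" if "arc g" "path_image g \<subseteq> S \<union> ?G" for g
  proof (rule arc_compose_inj[OF that(1)])
    have "z \<notin> path_image g" using that(2) zG S by blast
    then show "continuous_on (path_image g) f" unfolding f_def by (intro continuous_intros) auto
  qed (simp add: inj_on_def inj)
  have img: "path_image (f \<circ> c1) \<union> path_image (f \<circ> c2) = f ` ?G" by (simp add: path_image_compose image_Un)
  show False
  proof (rule no_crossing_chords_inside[of "f \<circ> c1" "f a" "f b" "f \<circ> c2" "f \<circ> c" "f \<circ> d"])
    show "arc (f \<circ> c1)" "arc (f \<circ> c2)" "arc (f \<circ> c)" "arc (f \<circ> d)"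
      using c1(1) c2(1) c(1) d(1) cG by (auto intro!: arcs)
    show "pathstart (f \<circ> d) \<in> path_image (f \<circ> c1) - {f a, f b}"
      "pathfinish (f \<circ> d) \<in> path_image (f \<circ> c2) - {f a, f b}"
      using d(2,3) by (auto simp: pathstart_compose pathfinish_compose path_image_compose inj)
    have "path_image (f \<circ> c1) \<inter> path_image (f \<circ> c2) = f ` (path_image c1 \<inter> path_image c2)"
      unfolding path_image_compose by (auto simp: inj)
    then show "path_image (f \<circ> c1) \<inter> path_image (f \<circ> c2) = {f a, f b}" by (simp add: meet)
    show "path_image (f \<circ> c) \<inter> path_image (f \<circ> d) = {}"
      using disj unfolding path_image_compose by (auto simp: inj)
    have "f ` A - {f u, f v} \<subseteq> f ` (A - {u, v})" for A u v by blast
    then have sides: "f ` A - {f u, f v} \<subseteq> inside (f ` ?G)" if "A - {u, v} \<subseteq> S" for A u v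
      using fS image_mono[OF that, of f] by (meson order_trans)
    show "path_image (f \<circ> c) - {f a, f b} \<subseteq> inside (path_image (f \<circ> c1) \<union> path_image (f \<circ> c2))"
      using sides[OF c_in] unfolding img unfolding path_image_compose .
    show "path_image (f \<circ> d) - {pathstart (f \<circ> d), pathfinish (f \<circ> d)}
        \<subseteq> inside (path_image (f \<circ> c1) \<union> path_image (f \<circ> c2))"
      using sides[OF d_in] unfolding img unfolding path_image_compose pathstart_compose pathfinish_compose .
  qed (simp_all add: pathstart_compose pathfinish_compose c1 c2 c)
qed

section \<open>Degrees, components and linked paths\<close>

abbreviation edge_rel :: "nat set set \<Rightarrow> (nat \<times> nat) set" where
  "edge_rel F \<equiv> {(x, y). {x, y} \<in> F}"

lemma edge_rel_sym: "(x, y) \<in> (edge_rel F)\<^sup>* \<Longrightarrow> (y, x) \<in> (edge_rel F)\<^sup>*"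
proof -
  have "sym (edge_rel F)" by (auto simp: sym_def insert_commute)
  then show "(x, y) \<in> (edge_rel F)\<^sup>* \<Longrightarrow> (y, x) \<in> (edge_rel F)\<^sup>*"
    by (meson symD sym_rtrancl)
qed

lemma edge_rel_mono: "F \<subseteq> G \<Longrightarrow> (edge_rel F)\<^sup>* \<subseteq> (edge_rel G)\<^sup>*"
  by (intro rtrancl_mono) auto

text \<open>
  If every class of \<^term>\<open>r'\<close> has a representative in the image of \<^term>\<open>h\<close>, then taking preimages under
  \<^term>\<open>h\<close> is a bijection of the classes.
\<close>

lemma num_classes_transfer:
  assumes h: "h ` S \<subseteq> S'" and r'_sym: "\<And>x y. (x, y) \<in> r'\<^sup>* \<Longrightarrow> (y, x) \<in> r'\<^sup>*"
    and rel: "\<And>x y. x \<in> S \<Longrightarrow> y \<in> S \<Longrightarrow> (x, y) \<in> r\<^sup>* \<longleftrightarrow> (h x, h y) \<in> r'\<^sup>*"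
    and rep: "\<And>y. y \<in> S' \<Longrightarrow> \<exists>x\<in>S. (h x, y) \<in> r'\<^sup>*"
  shows "num_classes S r = num_classes S' r'"
proof -
  let ?c = "\<lambda>x. {y \<in> S. (x, y) \<in> r\<^sup>*}" and ?c' = "\<lambda>x. {y \<in> S'. (x, y) \<in> r'\<^sup>*}"
  have eq: "?c' u = ?c' v" if "(u, v) \<in> r'\<^sup>*" for u v
    using that r'_sym by (blast intro: rtrancl_trans)
  have img: "?c' ` S' = (\<lambda>x. ?c' (h x)) ` S"
  proof (intro equalityI subsetI)
    fix C assume "C \<in> ?c' ` S'"
    then obtain y where y: "y \<in> S'" "C = ?c' y" by blast
    then obtain x where x: "x \<in> S" "(h x, y) \<in> r'\<^sup>*" using rep by blast
    show "C \<in> (\<lambda>x. ?c' (h x)) ` S" using eq[OF x(2)] x(1) y(2) by blast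
  qed (use h in blast)
  have "inj_on (\<lambda>C. {x \<in> S. h x \<in> C}) ((\<lambda>x. ?c' (h x)) ` S)"
  proof (rule inj_onI)
    fix C1 C2 assume "C1 \<in> (\<lambda>x. ?c' (h x)) ` S" "C2 \<in> (\<lambda>x. ?c' (h x)) ` S"
      and e: "{x \<in> S. h x \<in> C1} = {x \<in> S. h x \<in> C2}"
    then obtain x1 x2 where x: "x1 \<in> S" "x2 \<in> S" "C1 = ?c' (h x1)" "C2 = ?c' (h x2)" by blast
    have "h x1 \<in> C1" using x h by blast
    then have "h x1 \<in> C2" using e x(1) by blast
    then have "(h x2, h x1) \<in> r'\<^sup>*" unfolding x(4) by blast
    from eq[OF this] show "C1 = C2" unfolding x(3,4) by (rule sym)
  qed
  moreover have "(\<lambda>C. {x \<in> S. h x \<in> C}) ` ((\<lambda>x. ?c' (h x)) ` S) = ?c ` S"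
    unfolding image_image by (intro image_cong refl) (use rel h in auto)
  ultimately show ?thesis
    unfolding num_classes_def img by (metis (no_types, lifting) card_image)
qed

text \<open>
  A connected graph has at least as many edges as a spanning tree: growing a set of vertices from
  \<^term>\<open>i\<close>, each new vertex brings a new edge.
\<close>

lemma connected_edge_bound:
  assumes fin: "finite F" "finite K" and i: "i \<in> K"
    and reach: "\<And>v. v \<in> K \<Longrightarrow> (i, v) \<in> (edge_rel F)\<^sup>*"
    and closed: "\<And>x y. {x, y} \<in> F \<Longrightarrow> x \<in> K \<Longrightarrow> y \<in> K"
  shows "card K \<le> Suc (card {e \<in> F. e \<subseteq> K})"
proof -
  have grow: "\<exists>S. S \<subseteq> K \<and> i \<in> S \<and> card S = Suc m \<and> m \<le> card {e \<in> F. e \<subseteq> S}" if "m < card K" for m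
    using that
  proof (induction m)
    case 0
    then show ?case using i by (intro exI[of _ "{i}"]) auto
  next
    case (Suc m)
    then obtain S where S: "S \<subseteq> K" "i \<in> S" "card S = Suc m" "m \<le> card {e \<in> F. e \<subseteq> S}" by auto
    then have "S \<noteq> K" using Suc.prems by auto
    have "\<exists>x y. {x, y} \<in> F \<and> x \<in> S \<and> y \<notin> S"
    proof (rule ccontr)
      assume "\<not> ?thesis"
      then have "v \<in> S" if "v \<in> K" for v
        using rtrancl_closed[OF reach[OF that] S(2)] by blast
      then show False using S(1) \<open>S \<noteq> K\<close> by blast
    qed
    then obtain x y where xy: "{x, y} \<in> F" "x \<in> S" "y \<notin> S" by blast
    have "y \<in> K" using closed xy S(1) by blast
    have finS: "finite S" using S(1) fin(2) finite_subset by blast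
    have "insert {x, y} {e \<in> F. e \<subseteq> S} \<subseteq> {e \<in> F. e \<subseteq> insert y S}" using xy by blast
    from card_mono[OF _ this] have "Suc (card {e \<in> F. e \<subseteq> S}) \<le> card {e \<in> F. e \<subseteq> insert y S}"
      using fin(1) xy by simp
    then show ?case
      using S xy \<open>y \<in> K\<close> finS by (intro exI[of _ "insert y S"]) auto
  qed
  have pos: "card K > 0" using i fin(2) card_gt_0_iff by blast
  then have "card K - 1 < card K" by simp
  from grow[OF this] obtain S where S: "S \<subseteq> K" "card S = card K" "card K - 1 \<le> card {e \<in> F. e \<subseteq> S}"
    using pos by auto
  have "S = K" using card_subset_eq[OF fin(2) S(1,2)] .
  show ?thesis using S(3) unfolding \<open>S = K\<close> by simp
qed

lemma handshake:
  assumes "finite F" "finite V" "\<And>e. e \<in> F \<Longrightarrow> e \<subseteq> V \<and> card e = 2"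
  shows "(\<Sum>v\<in>V. degree_in F v) = 2 * card F"
proof -
  have "(\<Sum>v\<in>V. card {e \<in> F. v \<in> e}) = (\<Sum>e\<in>F. 2)"
  proof (rule sum_multicount_gen[OF assms(2,1)], rule ballI)
    fix e assume "e \<in> F"
    then have "{v \<in> V. v \<in> e} = e" "card e = 2" using assms(3) by auto
    then show "card {v \<in> V. v \<in> e} = 2" by simp
  qed
  then show ?thesis by (simp add: degree_in_def)
qed

text \<open>
  If all degrees are 1 or 2, then a component is a path or a cycle. Let \<open>K\<close> be the component of \<open>s\<close>. The
  degree sum \<open>2 * card K - card (K \<inter> T)\<close> is twice the number of edges, so it is even, and it is at
  least \<open>2 * (card K - 1)\<close> by connectedness; hence \<open>card (K \<inter> T)\<close> is exactly 2.
\<close>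

lemma unique_other_end:
  assumes F: "simple_graph N F"
    and T: "T \<subseteq> {0..<N}" "\<And>v. v \<in> T \<Longrightarrow> degree_in F v = 1"
    and rest: "\<And>v. v < N \<Longrightarrow> v \<notin> T \<Longrightarrow> degree_in F v = 2"
    and s: "s \<in> T"
  shows "\<exists>!t. t \<in> T \<and> t \<noteq> s \<and> (s, t) \<in> (edge_rel F)\<^sup>*"
proof -
  define K where "K = {v. (s, v) \<in> (edge_rel F)\<^sup>*}"
  have edges: "e \<subseteq> {0..<N}" "card e = 2" if "e \<in> F" for e
    using F that by (auto simp: simple_graph_def)
  have finF: "finite F" by (rule finite_subset[of _ "Pow {0..<N}"]) (use edges in auto)
  have sN: "s \<in> {0..<N}" using s T(1) by blast
  have K: "K \<subseteq> {0..<N}"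
  proof
    fix v assume "v \<in> K"
    then have "(s, v) \<in> (edge_rel F)\<^sup>*" by (simp add: K_def)
    then show "v \<in> {0..<N}" by (rule rtrancl_closed[OF _ sN]) (use edges(1) in fastforce)
  qed
  then have finK: "finite K" using finite_subset by blast
  have sK: "s \<in> K" by (simp add: K_def)
  have closed: "y \<in> K" if "{x, y} \<in> F" "x \<in> K" for x y
    using that by (auto simp: K_def intro: rtrancl.rtrancl_into_rtrancl)
  have in_K: "e \<subseteq> K" if "e \<in> F" "v \<in> e" "v \<in> K" for e v
  proof -
    obtain x y where e: "e = {x, y}" using edges(2)[OF \<open>e \<in> F\<close>] by (auto simp: card_2_iff)
    then show ?thesis using closed[of x y] closed[of y x] that by (auto simp: insert_commute)
  qed
  let ?F = "{e \<in> F. e \<subseteq> K}"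
  have deg: "degree_in ?F v = degree_in F v" if "v \<in> K" for v
    unfolding degree_in_def by (rule arg_cong[where f = card]) (use in_K that in auto)
  have "(\<Sum>v\<in>K. degree_in F v) = (\<Sum>v\<in>K. degree_in ?F v)"
    by (rule sum.cong) (simp_all only: deg)
  also have "\<dots> = 2 * card ?F"
  proof (rule handshake)
    show "finite ?F" using finF by simp
    show "e \<subseteq> K \<and> card e = 2" if "e \<in> ?F" for e using that edges(2)[of e] by simp
  qed (rule finK)
  finally have "(\<Sum>v\<in>K. degree_in F v) = 2 * card ?F" .
  moreover have "(\<Sum>v\<in>K. degree_in F v) + card (K \<inter> T) = 2 * card K"
  proof -
    have "(\<Sum>v\<in>K. degree_in F v) + card (K \<inter> T) = (\<Sum>v\<in>K. degree_in F v + (if v \<in> T then 1 else 0))"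
      using finK by (simp add: sum.distrib sum.If_cases)
    also have "\<dots> = (\<Sum>v\<in>K. 2)" by (rule sum.cong) (use T(2) rest K in auto)
    finally show ?thesis by simp
  qed
  moreover have "card K \<le> Suc (card ?F)"
    by (rule connected_edge_bound[OF finF finK sK]) (use closed in \<open>auto simp: K_def\<close>)
  moreover have "card (K \<inter> T) > 0" using sK s finK by (auto simp: card_gt_0_iff)
  ultimately have "card (K \<inter> T) = 2" by presburger
  then obtain x y where xy: "K \<inter> T = {x, y}" "x \<noteq> y" by (auto simp: card_2_iff)
  have "s \<in> {x, y}" unfolding xy(1)[symmetric] using sK s by simp
  then obtain t where t: "K \<inter> T = {s, t}" "t \<noteq> s"
  proof
    assume "s = x"
    then show ?thesis using that[of y] xy by simp
  next
    assume "s \<in> {y}"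
    then show ?thesis using that[of x] xy by (simp add: insert_commute)
  qed
  show ?thesis
  proof (rule ex1I[of _ t])
    show "t \<in> T \<and> t \<noteq> s \<and> (s, t) \<in> (edge_rel F)\<^sup>*" using t by (auto simp: K_def)
    fix u assume "u \<in> T \<and> u \<noteq> s \<and> (s, u) \<in> (edge_rel F)\<^sup>*"
    then have "u \<in> K \<inter> T" "u \<noteq> s" by (auto simp: K_def)
    then show "u = t" using t by blast
  qed
qed

text \<open>
  The components of \<^term>\<open>F\<close> that meet the vertices in \<^term>\<open>vs\<close> are paths from \<open>vs ! i\<close> to
  \<open>vs ! mate i\<close>. Adding the edges \<^term>\<open>M\<close> between such vertices closes these paths to the loops counted
  by \<^const>\<open>link_rel\<close> and does not touch the other components. The first summand is therefore the same for
  all choices of \<^term>\<open>M\<close>.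
\<close>

lemma num_components_link:
  assumes F: "simple_graph N F" and vs: "set vs \<subseteq> {0..<N}" "distinct vs" "length vs = n"
    and mate: "\<And>i. i < n \<Longrightarrow> mate i < n"
      "\<And>i j. i < n \<Longrightarrow> j < n \<Longrightarrow> (vs ! i, vs ! j) \<in> (edge_rel F)\<^sup>* \<longleftrightarrow> j = i \<or> j = mate i"
    and \<mu>: "\<And>i. i < n \<Longrightarrow> \<mu> i < n" "\<And>i. i < n \<Longrightarrow> \<mu> (\<mu> i) = i"
    and M: "M = (\<lambda>i. {vs ! i, vs ! \<mu> i}) ` {0..<n}"
  shows "num_components N (F \<union> M) =
    num_classes {v. v < N \<and> (\<forall>t\<in>set vs. (t, v) \<notin> (edge_rel F)\<^sup>*)} (edge_rel F) +
    num_classes {0..<n} (link_rel n mate \<mu>)"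
proof -
  define V0 where "V0 = {v. v < N \<and> (\<forall>t\<in>set vs. (t, v) \<notin> (edge_rel F)\<^sup>*)}"
  define V1 where "V1 = {v. v < N \<and> (\<exists>t\<in>set vs. (t, v) \<in> (edge_rel F)\<^sup>*)}"
  let ?r = "edge_rel (F \<union> M)"
  have V: "{0..<N} = V0 \<union> V1" "V0 \<inter> V1 = {}" "finite V0" "finite V1" by (auto simp: V0_def V1_def)
  have FN: "x < N" "y < N" if "{x, y} \<in> F" for x y using F that by (auto simp: simple_graph_def)
  have set_vs: "vs ! i \<in> set vs" if "i < n" for i using that vs(3) by simp
  have MT: "x \<in> set vs" "y \<in> set vs" if "{x, y} \<in> M" for x y
    using that set_vs \<mu>(1) unfolding M by (auto simp: doubleton_eq_iff)
  have T1: "set vs \<subseteq> V1" using vs(1) by (auto simp: V1_def)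
  have V1c: "y \<in> V1" if xy: "(x, y) \<in> ?r" and x: "x \<in> V1" for x y
  proof (cases "{x, y} \<in> M")
    case True
    then show ?thesis using MT T1 by blast
  next
    case False
    then have "{x, y} \<in> F" using xy by auto
    then show ?thesis using x FN by (auto simp: V1_def intro: rtrancl.rtrancl_into_rtrancl)
  qed
  have V0c: "y \<in> V0 \<and> {x, y} \<in> F" if xy: "(x, y) \<in> ?r" and x: "x \<in> V0" for x y
  proof -
    have "{x, y} \<notin> M" using MT T1 x V(2) by blast
    then have F': "{x, y} \<in> F" using xy by auto
    have "y \<notin> V1" using V1c[of y x] xy x V(2) by (auto simp: insert_commute)
    then show ?thesis using FN[OF F'] F' V(1) by auto
  qed
  have "num_components N (F \<union> M) = num_classes V0 ?r + num_classes V1 ?r"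
    unfolding num_components_eq_num_classes V(1)
    by (rule num_classes_Un[OF V(3,4,2)]) (use V0c V1c in blast)+
  also have "num_classes V0 ?r = num_classes V0 (edge_rel F)"
  proof (rule num_classes_cong, rule iffI)
    fix x y assume "x \<in> V0" "(x, y) \<in> ?r\<^sup>*"
    from this(2,1) have "(x, y) \<in> (edge_rel F)\<^sup>* \<and> y \<in> V0"
    proof (induction rule: rtrancl_induct)
      case (step y z)
      then have "z \<in> V0" "(y, z) \<in> edge_rel F" using V0c[of y z] by auto
      then show ?case using step by (auto intro: rtrancl.rtrancl_into_rtrancl)
    qed simp
    then show "(x, y) \<in> (edge_rel F)\<^sup>*" ..
  next
    fix x y assume "(x, y) \<in> (edge_rel F)\<^sup>*"
    then show "(x, y) \<in> ?r\<^sup>*" using edge_rel_mono[of F "F \<union> M"] by auto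
  qed
  also have "num_classes V1 ?r = num_classes {0..<n} (link_rel n mate \<mu>)"
  proof (rule num_classes_transfer[symmetric])
    show "(!) vs ` {0..<n} \<subseteq> V1" using T1 set_vs by auto
    show "(y, x) \<in> ?r\<^sup>*" if "(x, y) \<in> ?r\<^sup>*" for x y using that by (rule edge_rel_sym)
    show "\<exists>i\<in>{0..<n}. (vs ! i, y) \<in> ?r\<^sup>*" if y: "y \<in> V1" for y
    proof -
      obtain t where t: "t \<in> set vs" "(t, y) \<in> (edge_rel F)\<^sup>*" using y by (auto simp: V1_def)
      then obtain i where "i < n" "t = vs ! i" using vs(3) by (metis in_set_conv_nth)
      then show ?thesis using t(2) edge_rel_mono[of F "F \<union> M"] by (intro bexI[of _ i]) auto
    qed
    fix i j assume "i \<in> {0..<n}" "j \<in> {0..<n}"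
    then have ij: "i < n" "j < n" by auto
    show "(i, j) \<in> (link_rel n mate \<mu>)\<^sup>* \<longleftrightarrow> (vs ! i, vs ! j) \<in> ?r\<^sup>*"
    proof
      assume "(i, j) \<in> (link_rel n mate \<mu>)\<^sup>*"
      then show "(vs ! i, vs ! j) \<in> ?r\<^sup>*"
      proof (induction rule: rtrancl_induct)
        case (step l m)
        have l: "l < n" and m: "m = mate l \<or> m = \<mu> l" using step by (auto simp: link_rel_def)
        have "(vs ! l, vs ! m) \<in> ?r\<^sup>*"
          using m
        proof
          assume "m = mate l"
          then have "(vs ! l, vs ! m) \<in> (edge_rel F)\<^sup>*" using mate l by auto
          then show ?thesis using edge_rel_mono[of F "F \<union> M"] by auto
        next
          assume "m = \<mu> l"
          then have "{vs ! l, vs ! m} \<in> M" using l unfolding M by auto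
          then show ?thesis by auto
        qed
        then show ?case using step.IH by (rule rtrancl_trans[rotated])
      qed simp
    next
      have "\<exists>l<n. (i, l) \<in> (link_rel n mate \<mu>)\<^sup>* \<and> (vs ! l, z) \<in> (edge_rel F)\<^sup>*" if "(vs ! i, z) \<in> ?r\<^sup>*" for z
        using that
      proof (induction rule: rtrancl_induct)
        case base
        then show ?case using ij(1) by blast
      next
        case (step y z)
        then obtain l where l: "l < n" "(i, l) \<in> (link_rel n mate \<mu>)\<^sup>*" "(vs ! l, y) \<in> (edge_rel F)\<^sup>*" by blast
        show ?case
        proof (cases "{y, z} \<in> M")
          case False
          then have "(y, z) \<in> edge_rel F" using step by auto
          then show ?thesis using l by (blast intro: rtrancl.rtrancl_into_rtrancl)
        next
          case True
          obtain q where q: "q < n" "y = vs ! q" "z = vs ! \<mu> q"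
          proof -
            obtain p where p: "p < n" "{y, z} = {vs ! p, vs ! \<mu> p}" using True unfolding M by auto
            then consider "y = vs ! p" "z = vs ! \<mu> p" | "y = vs ! \<mu> p" "z = vs ! p"
              by (auto simp: doubleton_eq_iff)
            then show ?thesis using that p(1) \<mu> by cases metis+
          qed
          have "q = l \<or> q = mate l" using mate(2)[OF l(1) q(1)] l(3) q(2) by blast
          then have "(i, q) \<in> (link_rel n mate \<mu>)\<^sup>*"
            using l by (auto simp: link_rel_def intro: rtrancl.rtrancl_into_rtrancl)
          moreover have "(q, \<mu> q) \<in> link_rel n mate \<mu>" using q(1) by (simp add: link_rel_def)
          ultimately show ?thesis using \<mu>(1)[OF q(1)] q(3) by (blast intro: rtrancl.rtrancl_into_rtrancl)
        qed
      qed
      moreover assume "(vs ! i, vs ! j) \<in> ?r\<^sup>*"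
      ultimately obtain l where l: "l < n" "(i, l) \<in> (link_rel n mate \<mu>)\<^sup>*" "(vs ! l, vs ! j) \<in> (edge_rel F)\<^sup>*" by blast
      then have "j = l \<or> j = mate l" using mate(2) ij(2) by blast
      then show "(i, j) \<in> (link_rel n mate \<mu>)\<^sup>*"
        using l by (auto simp: link_rel_def intro: rtrancl.rtrancl_into_rtrancl)
    qed
  qed
  finally show ?thesis by (simp add: V0_def)
qed

section \<open>Alternating cycles in cubic graphs\<close>

lemma perfect_matching_edge_unique:
  assumes "a \<in> perfect_matchings V E" "v \<in> V" "e \<in> a" "v \<in> e" "e' \<in> a" "v \<in> e'"
  shows "e = e'"
proof -
  have "\<exists>!e. e \<in> a \<and> v \<in> e" using assms(1,2) by (simp add: perfect_matchings_def)
  then show ?thesis using assms(3-6) by blast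
qed

lemma perfect_matching_edge_ex:
  assumes "a \<in> perfect_matchings V E" "v \<in> V"
  obtains e where "e \<in> a" "v \<in> e"
proof -
  have "\<exists>!e. e \<in> a \<and> v \<in> e" using assms by (simp add: perfect_matchings_def)
  then show ?thesis using that by blast
qed

text \<open>
  The cycle starts with an edge of the matching, so that the edges at even positions are those in
  the matching. The condition \<open>2 \<le> k\<close> excludes a doubled edge, which is not a cycle.
\<close>

locale alternating_cycle =
  fixes N :: nat and E a :: "nat set set" and vs :: "nat list" and k :: nat
  assumes graph: "simple_graph N E" and cubic: "cubic N E"
    and a: "a \<in> perfect_matchings {0..<N} E"
    and len: "length vs = 2 * k" and k: "2 \<le> k" and dist: "distinct vs"
    and edge: "\<And>i. i < 2 * k \<Longrightarrow> {vs ! i, next_vertex vs i} \<in> E"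
    and alt: "\<And>i. i < 2 * k \<Longrightarrow> {vs ! i, next_vertex vs i} \<in> a \<longleftrightarrow> even i"
begin

abbreviation C where "C \<equiv> cycle_edges vs"
abbreviation cyc_edge where "cyc_edge i \<equiv> {vs ! i, next_vertex vs i}"
text \<open>
  \<open>flipped\<close> is the matching after exchange of its edges along the cycle; the graph \<open>rest\<close> is the part
  common to the complements of both matchings.
\<close>

definition rest where "rest = E - a - C"
definition flipped where "flipped = (a - C) \<union> (C - a)"

lemma aE: "a \<subseteq> E" using a by (auto simp: perfect_matchings_def)

lemma cycle_edges_eq: "C = cyc_edge ` {..<2 * k}" by (simp add: cycle_edges_def len)

lemma CE: "C \<subseteq> E" using edge by (auto simp: cycle_edges_eq)

lemma next_vertex: "next_vertex vs i = vs ! (Suc i mod (2 * k))"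
  by (simp add: next_vertex_def len)

lemma edge_subset: "e \<in> E \<Longrightarrow> e \<subseteq> {0..<N} \<and> card e = 2"
  using graph by (auto simp: simple_graph_def)

lemma finE: "finite E"
  by (rule finite_subset[of _ "Pow {0..<N}"]) (use edge_subset in auto)

lemma is_cycle: "is_cycle E vs" using CE dist k by (auto simp: is_cycle_def len)

lemma in_set: "i < 2 * k \<Longrightarrow> vs ! i \<in> set vs" by (simp add: len)

lemma set_exhaust: assumes "v \<in> set vs" obtains i where "i < 2 * k" "v = vs ! i"
  using assms len by (metis in_set_conv_nth)

lemma nth_eq: "i < 2 * k \<Longrightarrow> j < 2 * k \<Longrightarrow> vs ! i = vs ! j \<longleftrightarrow> i = j"
  using dist len by (simp add: nth_eq_iff_index_eq)

lemma cyc_edge_subset: "i < 2 * k \<Longrightarrow> cyc_edge i \<subseteq> set vs" using k by (simp add: next_vertex in_set)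

lemma C_subset: "e \<in> C \<Longrightarrow> e \<subseteq> set vs" using cyc_edge_subset by (auto simp: cycle_edges_eq)

lemma set_N: "set vs \<subseteq> {0..<N}"
proof
  fix v assume "v \<in> set vs"
  then obtain i where "i < 2 * k" "v = vs ! i" by (rule set_exhaust)
  then show "v \<in> {0..<N}" using edge_subset[OF edge[of i]] by auto
qed

definition prev where "prev i = (i + 2 * k - 1) mod (2 * k)"

lemma prev: assumes "i < 2 * k"
  shows "prev i < 2 * k" "Suc (prev i) mod (2 * k) = i" "even (prev i) \<longleftrightarrow> odd i" "cyc_edge (prev i) = {vs ! prev i, vs ! i}"
proof -
  have p: "prev i = (if i = 0 then 2 * k - 1 else i - 1)"
  proof (cases "i = 0")
    case False
    then have "prev i = (i - 1 + 2 * k) mod (2 * k)" by (simp add: prev_def)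
    also have "\<dots> = (i - 1) mod (2 * k)" by (rule mod_add_self2)
    also have "\<dots> = i - 1" using assms by simp
    finally show ?thesis using False by simp
  qed (use k in \<open>simp add: prev_def\<close>)
  show "prev i < 2 * k" "Suc (prev i) mod (2 * k) = i" "even (prev i) \<longleftrightarrow> odd i"
    using assms k unfolding p by auto
  then show "cyc_edge (prev i) = {vs ! prev i, vs ! i}" by (simp add: next_vertex)
qed

lemma incident_cycle_edges:
  assumes i: "i < 2 * k" and j: "j < 2 * k" and in_ed: "vs ! i \<in> cyc_edge j"
  shows "j = i \<or> j = prev i"
proof -
  have "Suc j mod (2 * k) < 2 * k" using k by simp
  then have "i = j \<or> i = Suc j mod (2 * k)"
    using in_ed i j nth_eq by (auto simp: next_vertex)
  moreover have "j = prev i" if "i = Suc j mod (2 * k)"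
  proof (cases "Suc j = 2 * k")
    case True
    then show ?thesis using that by (simp add: prev_def)
  next
    case False
    then have "i = Suc j" using that j by simp
    then show ?thesis using j by (simp add: prev_def)
  qed
  ultimately show ?thesis by blast
qed

lemma incident_C: "i < 2 * k \<Longrightarrow> {e \<in> C. vs ! i \<in> e} = {cyc_edge i, cyc_edge (prev i)}"
proof (intro equalityI subsetI)
  assume i: "i < 2 * k"
  show "e \<in> {cyc_edge i, cyc_edge (prev i)}" if e: "e \<in> {e \<in> C. vs ! i \<in> e}" for e
  proof -
    obtain j where "j < 2 * k" "e = cyc_edge j" using e by (auto simp: cycle_edges_eq)
    then show ?thesis using incident_cycle_edges[OF i, of j] e by blast
  qed
  show "e \<in> {e \<in> C. vs ! i \<in> e}" if "e \<in> {cyc_edge i, cyc_edge (prev i)}" for e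
    using that i prev(1,4)[OF i] unfolding cycle_edges_eq by blast
qed

lemma matching_edge_on_cycle:
  assumes i: "i < 2 * k" and e: "e \<in> a" "vs ! i \<in> e"
  shows "e \<in> C" "e = (if even i then cyc_edge i else cyc_edge (prev i))"
proof -
  let ?e = "if even i then cyc_edge i else cyc_edge (prev i)"
  have "?e \<in> a" "vs ! i \<in> ?e" using alt[OF i] alt[OF prev(1)[OF i]] prev[OF i] by auto
  moreover have "vs ! i \<in> {0..<N}" using set_N in_set[OF i] by blast
  ultimately show "e = ?e" using perfect_matching_edge_unique[OF a _ e] by blast
  then show "e \<in> C" using i prev(1)[OF i] by (auto simp: cycle_edges_eq)
qed

lemma cyc_edge_neq_prev: "i < 2 * k \<Longrightarrow> cyc_edge i \<noteq> cyc_edge (prev i)"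
  using alt[of i] alt[of "prev i"] prev[of i] by metis

lemma cyc_edge_inj: "i < 2 * k \<Longrightarrow> j < 2 * k \<Longrightarrow> cyc_edge i = cyc_edge j \<Longrightarrow> i = j"
  using incident_cycle_edges[of i j] cyc_edge_neq_prev[of i] by blast

text \<open>
  At a vertex of the cycle the matching uses one of the two cycle edges, so only the third edge
  is left.
\<close>

lemma incident_rest:
  assumes i: "i < 2 * k"
  shows "{e \<in> rest. vs ! i \<in> e} = {e \<in> E - C. vs ! i \<in> e}" "degree_in rest (vs ! i) = 1"
proof -
  show eq: "{e \<in> rest. vs ! i \<in> e} = {e \<in> E - C. vs ! i \<in> e}"
    using matching_edge_on_cycle(1)[OF i] by (auto simp: rest_def)
  have "vs ! i < N" using set_N in_set[OF i] by auto
  then have "card {e \<in> E. vs ! i \<in> e} = 3" using cubic by (auto simp: cubic_def degree_in_def)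
  moreover have "{e \<in> E - C. vs ! i \<in> e} = {e \<in> E. vs ! i \<in> e} - {cyc_edge i, cyc_edge (prev i)}"
    unfolding incident_C[OF i, symmetric] by blast
  moreover have "{cyc_edge i, cyc_edge (prev i)} \<subseteq> {e \<in> E. vs ! i \<in> e}"
    unfolding incident_C[OF i, symmetric] using CE by blast
  moreover have "card {cyc_edge i, cyc_edge (prev i)} = 2"
    unfolding card_2_iff using cyc_edge_neq_prev[OF i] by blast
  ultimately show "degree_in rest (vs ! i) = 1"
    unfolding degree_in_def eq by (simp add: card_Diff_subset)
qed

lemma degree_rest_off_cycle:
  assumes v: "v < N" "v \<notin> set vs"
  shows "degree_in rest v = 2"
proof -
  have vN: "v \<in> {0..<N}" using v by simp
  obtain e where e: "e \<in> a" "v \<in> e" by (rule perfect_matching_edge_ex[OF a vN])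
  have "{f \<in> rest. v \<in> f} = {f \<in> E. v \<in> f} - {e}"
  proof (intro equalityI subsetI)
    fix f assume "f \<in> {f \<in> rest. v \<in> f}"
    then show "f \<in> {f \<in> E. v \<in> f} - {e}" using e(1) by (auto simp: rest_def)
  next
    fix f assume f: "f \<in> {f \<in> E. v \<in> f} - {e}"
    have "f \<notin> a"
    proof
      assume "f \<in> a"
      then have "f = e" using perfect_matching_edge_unique[OF a, of v f e] e v f by simp
      then show False using f by simp
    qed
    moreover have "f \<notin> C" using C_subset v(2) f by blast
    ultimately show "f \<in> {f \<in> rest. v \<in> f}" using f by (simp add: rest_def)
  qed
  moreover have "card {f \<in> E. v \<in> f} = 3" using cubic v by (auto simp: cubic_def degree_in_def)
  moreover have "e \<in> {f \<in> E. v \<in> f}" using e aE by blast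
  ultimately show ?thesis by (simp add: degree_in_def card_Diff_singleton)
qed

lemma rest_graph: "simple_graph N rest" using graph by (auto simp: rest_def simple_graph_def)

text \<open>
  The matching edges that do not touch the cycle match all other vertices, because the matching
  edge at a vertex of the cycle runs along the cycle.
\<close>

lemma central: "central N E vs"
proof -
  have "{e \<in> a. e \<inter> set vs = {}} \<in> perfect_matchings ({0..<N} - set vs) E"
    unfolding perfect_matchings_def
  proof (intro CollectI conjI ballI)
    show "{e \<in> a. e \<inter> set vs = {}} \<subseteq> E" using aE by blast
    show "e \<subseteq> {0..<N} - set vs" if "e \<in> {e \<in> a. e \<inter> set vs = {}}" for e
      using that aE edge_subset by blast
    fix v assume v: "v \<in> {0..<N} - set vs"
    then have vN: "v \<in> {0..<N}" by simp
    obtain e where e: "e \<in> a" "v \<in> e" by (rule perfect_matching_edge_ex[OF a vN])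
    have "e \<inter> set vs = {}"
    proof (rule ccontr)
      assume "e \<inter> set vs \<noteq> {}"
      then obtain u where u: "u \<in> e" "u \<in> set vs" by blast
      obtain i where i: "i < 2 * k" "u = vs ! i" using u(2) by (rule set_exhaust)
      have "e \<in> C" using matching_edge_on_cycle(1)[OF i(1) e(1)] u(1) i(2) by blast
      then show False using C_subset[of e] e(2) v by blast
    qed
    then show "\<exists>!e. e \<in> {e \<in> a. e \<inter> set vs = {}} \<and> v \<in> e"
      using e perfect_matching_edge_unique[OF a vN _ _ e] by (intro ex1I[of _ e]) blast+
  qed
  then show ?thesis unfolding central_def by blast
qed

lemma flipped: "flipped \<in> perfect_matchings {0..<N} E"
  unfolding perfect_matchings_def
proof (intro CollectI conjI ballI)
  show "flipped \<subseteq> E" using aE CE by (auto simp: flipped_def)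
  then show "e \<subseteq> {0..<N}" if "e \<in> flipped" for e using that edge_subset by blast
  fix v assume v: "v \<in> {0..<N}"
  show "\<exists>!e. e \<in> flipped \<and> v \<in> e"
  proof (cases "v \<in> set vs")
    case True
    then obtain i where i: "i < 2 * k" "v = vs ! i" by (rule set_exhaust)
    have p: "prev i < 2 * k" "even (prev i) \<longleftrightarrow> odd i" using prev[OF i(1)] by auto
    have "{e \<in> flipped. v \<in> e} = {e \<in> C. v \<in> e} - a"
      using matching_edge_on_cycle(1)[OF i(1)] i(2) by (auto simp: flipped_def)
    also have "\<dots> = {cyc_edge i, cyc_edge (prev i)} - a" unfolding i(2) incident_C[OF i(1)] ..
    also have "\<dots> = {if even i then cyc_edge (prev i) else cyc_edge i}"
      using alt[OF i(1)] alt[OF p(1)] p(2) by auto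
    finally have *: "{e \<in> flipped. v \<in> e} = {if even i then cyc_edge (prev i) else cyc_edge i}" .
    then show ?thesis by (intro ex1I[of _ "if even i then cyc_edge (prev i) else cyc_edge i"]) blast+
  next
    case False
    then have "e \<in> flipped \<and> v \<in> e \<longleftrightarrow> e \<in> a \<and> v \<in> e" for e
      using C_subset by (auto simp: flipped_def)
    then show ?thesis using a v by (simp add: perfect_matchings_def)
  qed
qed

lemma complement_eq: "E - a = rest \<union> (C - a)" "E - flipped = rest \<union> (C \<inter> a)"
  using aE CE by (auto simp: rest_def flipped_def)

lemma C_minus_a: "C - a = (\<lambda>i. {vs ! i, vs ! odd_partner (2 * k) i}) ` {0..<2 * k}"
proof -
  have op: "{vs ! i, vs ! odd_partner (2 * k) i} = (if odd i then cyc_edge i else cyc_edge (prev i))" if "i < 2 * k" for i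
    using prev(4)[OF that] by (auto simp: odd_partner_def next_vertex prev_def)
  show ?thesis
  proof (intro equalityI subsetI)
    fix e assume "e \<in> C - a"
    then obtain i where i: "i < 2 * k" "e = cyc_edge i" by (auto simp: cycle_edges_eq)
    with \<open>e \<in> C - a\<close> have "odd i" using alt by blast
    then show "e \<in> (\<lambda>i. {vs ! i, vs ! odd_partner (2 * k) i}) ` {0..<2 * k}"
      using op[OF i(1)] i by (intro image_eqI[of _ _ i]) auto
  next
    fix e assume "e \<in> (\<lambda>i. {vs ! i, vs ! odd_partner (2 * k) i}) ` {0..<2 * k}"
    then obtain i where i: "i < 2 * k" "e = (if odd i then cyc_edge i else cyc_edge (prev i))" using op by auto
    have "prev i < 2 * k" "even (prev i) \<longleftrightarrow> odd i" using prev[OF i(1)] by auto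
    then show "e \<in> C - a" using i alt by (auto simp: cycle_edges_eq)
  qed
qed

lemma C_inter_a: "C \<inter> a = (\<lambda>i. {vs ! i, vs ! even_partner i}) ` {0..<2 * k}"
proof -
  have ep: "{vs ! i, vs ! even_partner i} = (if even i then cyc_edge i else cyc_edge (i - 1))" if "i < 2 * k" for i
  proof (cases "even i")
    case True
    then have "Suc i < 2 * k" using that by presburger
    then show ?thesis using True by (simp add: even_partner_def next_vertex)
  next
    case False
    then have "Suc (i - 1) = i" by presburger
    then show ?thesis using False that by (auto simp: even_partner_def next_vertex)
  qed
  show ?thesis
  proof (intro equalityI subsetI)
    fix e assume "e \<in> C \<inter> a"
    then obtain i where i: "i < 2 * k" "e = cyc_edge i" by (auto simp: cycle_edges_eq)
    with \<open>e \<in> C \<inter> a\<close> have "even i" using alt by blast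
    then show "e \<in> (\<lambda>i. {vs ! i, vs ! even_partner i}) ` {0..<2 * k}"
      using ep[OF i(1)] i by (intro image_eqI[of _ _ i]) auto
  next
    fix e assume "e \<in> (\<lambda>i. {vs ! i, vs ! even_partner i}) ` {0..<2 * k}"
    then obtain i where i: "i < 2 * k" "e = (if even i then cyc_edge i else cyc_edge (i - 1))" using ep by auto
    have "i - 1 < 2 * k" "odd i \<Longrightarrow> even (i - 1)" using i(1) by auto
    then show "e \<in> C \<inter> a" using i alt by (auto simp: cycle_edges_eq)
  qed
qed

text \<open>
  The position of the other end of the path in \<open>rest\<close> that starts at position \<open>i\<close>.
\<close>

definition mate where
  "mate i = (THE j. j < 2 * k \<and> j \<noteq> i \<and> (vs ! i, vs ! j) \<in> (edge_rel rest)\<^sup>*)"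

lemma mate:
  assumes i: "i < 2 * k"
  shows "mate i < 2 * k" "mate i \<noteq> i" "(vs ! i, vs ! mate i) \<in> (edge_rel rest)\<^sup>*"
    "\<And>j. j < 2 * k \<Longrightarrow> (vs ! i, vs ! j) \<in> (edge_rel rest)\<^sup>* \<longleftrightarrow> j = i \<or> j = mate i"
proof -
  have "\<exists>!t. t \<in> set vs \<and> t \<noteq> vs ! i \<and> (vs ! i, t) \<in> (edge_rel rest)\<^sup>*"
  proof (rule unique_other_end[OF rest_graph set_N])
    show "degree_in rest v = 1" if v: "v \<in> set vs" for v
    proof -
      obtain j where "j < 2 * k" "v = vs ! j" using v by (rule set_exhaust)
      then show ?thesis using incident_rest(2)[of j] by simp
    qed
  qed (use degree_rest_off_cycle in_set[OF i] in auto)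
  then obtain t where t: "t \<in> set vs" "t \<noteq> vs ! i" "(vs ! i, t) \<in> (edge_rel rest)\<^sup>*"
    and t_uniq: "\<And>u. u \<in> set vs \<Longrightarrow> u \<noteq> vs ! i \<Longrightarrow> (vs ! i, u) \<in> (edge_rel rest)\<^sup>* \<Longrightarrow> u = t"
    by (elim ex1E) blast
  obtain j where j: "j < 2 * k" "t = vs ! j" using t(1) by (rule set_exhaust)
  have "mate i = j"
    unfolding mate_def
  proof (rule the_equality)
    show "j < 2 * k \<and> j \<noteq> i \<and> (vs ! i, vs ! j) \<in> (edge_rel rest)\<^sup>*" using j t by auto
    fix l assume l: "l < 2 * k \<and> l \<noteq> i \<and> (vs ! i, vs ! l) \<in> (edge_rel rest)\<^sup>*"
    then have "vs ! l = t" using t_uniq[of "vs ! l"] in_set nth_eq i by blast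
    then show "l = j" using nth_eq l j by simp
  qed
  then show m: "mate i < 2 * k" "mate i \<noteq> i" "(vs ! i, vs ! mate i) \<in> (edge_rel rest)\<^sup>*"
    using j t by auto
  fix l assume l: "l < 2 * k"
  show "(vs ! i, vs ! l) \<in> (edge_rel rest)\<^sup>* \<longleftrightarrow> l = i \<or> l = mate i"
  proof
    assume r: "(vs ! i, vs ! l) \<in> (edge_rel rest)\<^sup>*"
    show "l = i \<or> l = mate i"
    proof (cases "l = i")
      case False
      then have "vs ! l = t" using t_uniq[of "vs ! l"] in_set nth_eq i l r by blast
      then show ?thesis using nth_eq l j \<open>mate i = j\<close> by simp
    qed simp
  qed (use m in auto)
qed

lemma mate_mate: assumes i: "i < 2 * k" shows "mate (mate i) = i"
proof -
  have "(vs ! mate i, vs ! i) \<in> (edge_rel rest)\<^sup>*" using mate(3)[OF i] by (rule edge_rel_sym)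
  then show ?thesis using mate(4)[OF mate(1)[OF i] i] mate(2)[OF i] by simp
qed

lemma num_components_complements:
  shows "num_components N (E - flipped) =
      num_classes {v. v < N \<and> (\<forall>t\<in>set vs. (t, v) \<notin> (edge_rel rest)\<^sup>*)} (edge_rel rest) +
      num_classes {0..<2 * k} (link_rel (2 * k) mate even_partner)"
    and "num_components N (E - a) =
      num_classes {v. v < N \<and> (\<forall>t\<in>set vs. (t, v) \<notin> (edge_rel rest)\<^sup>*)} (edge_rel rest) +
      num_classes {0..<2 * k} (link_rel (2 * k) mate (odd_partner (2 * k)))"
proof -
  note link = num_components_link[OF rest_graph set_N dist len, of mate]
  have ep: "even_partner i < 2 * k" "even_partner (even_partner i) = i" if "i < 2 * k" for i
    using that by (auto simp: even_partner_def)
  have op: "odd_partner (2 * k) i < 2 * k \<and> odd_partner (2 * k) (odd_partner (2 * k) i) = i" if "i < 2 * k" for i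
  proof -
    have "odd_partner (2 * k) i = (if odd i then Suc i mod (2 * k) else prev i)"
      by (simp add: odd_partner_def prev_def)
    moreover have "prev (Suc i mod (2 * k)) = i"
      using incident_cycle_edges[of "Suc i mod (2 * k)" i] that k by (cases "Suc i = 2 * k") (auto simp: prev_def)
    ultimately show ?thesis
      using prev[OF that] k by (auto simp: odd_partner_def prev_def[symmetric] mod_Suc)
  qed
  show "num_components N (E - flipped) =
      num_classes {v. v < N \<and> (\<forall>t\<in>set vs. (t, v) \<notin> (edge_rel rest)\<^sup>*)} (edge_rel rest) +
      num_classes {0..<2 * k} (link_rel (2 * k) mate even_partner)"
    unfolding complement_eq by (rule link[OF mate(1) mate(4) ep C_inter_a])
  show "num_components N (E - a) =
      num_classes {v. v < N \<and> (\<forall>t\<in>set vs. (t, v) \<notin> (edge_rel rest)\<^sup>*)} (edge_rel rest) +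
      num_classes {0..<2 * k} (link_rel (2 * k) mate (odd_partner (2 * k)))"
    unfolding complement_eq
    by (rule link[OF mate(1) mate(4) conjunct1[OF op] conjunct2[OF op] C_minus_a])
qed

end

section \<open>Alternating cycles in the plane\<close>

locale plane_graph =
  fixes N :: nat and E :: "nat set set" and pos :: "nat \<Rightarrow> complex" and \<gamma> :: "nat set \<Rightarrow> real \<Rightarrow> complex"
  assumes plane_simple: "simple_graph N E" and drawing: "plane_drawing N E pos \<gamma>"
begin

lemma arc_edge: "e \<in> E \<Longrightarrow> arc (\<gamma> e)"
  using drawing by (simp add: plane_drawing_def)

lemma ends_edge: "e \<in> E \<Longrightarrow> {pathstart (\<gamma> e), pathfinish (\<gamma> e)} = pos ` e"
  using drawing by (simp add: plane_drawing_def)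

lemma edges_meet:
  "e \<in> E \<Longrightarrow> e' \<in> E \<Longrightarrow> e \<noteq> e' \<Longrightarrow> path_image (\<gamma> e) \<inter> path_image (\<gamma> e') \<subseteq> pos ` (e \<inter> e')"
  using drawing by (simp add: plane_drawing_def)

lemma pos_eq: "u < N \<Longrightarrow> v < N \<Longrightarrow> pos u = pos v \<longleftrightarrow> u = v"
  using drawing unfolding plane_drawing_def by (auto simp: inj_on_def)

lemma edge_vertex: "e \<in> E \<Longrightarrow> v \<in> e \<Longrightarrow> v < N"
  using plane_simple unfolding simple_graph_def by fastforce

lemma pos_in_edge: assumes "e \<in> E" "v \<in> e" shows "pos v \<in> path_image (\<gamma> e)"
proof -
  have "pos v \<in> {pathstart (\<gamma> e), pathfinish (\<gamma> e)}" using ends_edge[OF assms(1)] assms(2) by simp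
  then show ?thesis using pathstart_in_path_image[of "\<gamma> e"] pathfinish_in_path_image[of "\<gamma> e"] by fastforce
qed

lemma edge_arc_between:
  assumes "{x, y} \<in> E"
  obtains g where "arc g" "pathstart g = pos x" "pathfinish g = pos y" "path_image g = path_image (\<gamma> {x, y})"
proof -
  have arc: "arc (\<gamma> {x, y})" using assms by (rule arc_edge)
  have "{pathstart (\<gamma> {x, y}), pathfinish (\<gamma> {x, y})} = {pos x, pos y}" using ends_edge[OF assms] by simp
  then consider "pathstart (\<gamma> {x, y}) = pos x" "pathfinish (\<gamma> {x, y}) = pos y"
    | "pathstart (\<gamma> {x, y}) = pos y" "pathfinish (\<gamma> {x, y}) = pos x"
    by (auto simp: doubleton_eq_iff)
  then show ?thesis
  proof cases
    case 1
    then show ?thesis using that[of "\<gamma> {x, y}"] arc by simp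
  next
    case 2
    then show ?thesis using that[of "reversepath (\<gamma> {x, y})"] arc by (simp add: arc_reversepath)
  qed
qed

text \<open>
  The indices are shifted because a walk around a cycle starts at an arbitrary position; \<open>Suc d\<close>
  is the number of edges, which must be positive for the curve to be an arc.
\<close>

lemma arc_along_walk:
  assumes "inj_on f {s..s + Suc d}" "\<And>l. s \<le> l \<Longrightarrow> l < s + Suc d \<Longrightarrow> {f l, f (Suc l)} \<in> E"
  shows "\<exists>g. arc g \<and> pathstart g = pos (f s) \<and> pathfinish g = pos (f (s + Suc d)) \<and>
    path_image g = (\<Union>l\<in>{s..<s + Suc d}. path_image (\<gamma> {f l, f (Suc l)}))"
  using assms
proof (induction d)
  case 0
  then have "{f s, f (Suc s)} \<in> E" by simp
  then obtain g where "arc g" "pathstart g = pos (f s)" "pathfinish g = pos (f (Suc s))"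
    "path_image g = path_image (\<gamma> {f s, f (Suc s)})" by (rule edge_arc_between)
  then show ?case by (intro exI[of _ g]) (simp add: atLeastLessThanSuc)
next
  case (Suc d)
  let ?m = "s + Suc d"
  have "inj_on f {s..s + Suc d}" using Suc.prems(1) by (rule inj_on_subset) auto
  then obtain g where g: "arc g" "pathstart g = pos (f s)" "pathfinish g = pos (f ?m)"
    "path_image g = (\<Union>l\<in>{s..<?m}. path_image (\<gamma> {f l, f (Suc l)}))"
    using Suc.IH Suc.prems(2) by force
  have "{f ?m, f (Suc ?m)} \<in> E" using Suc.prems(2) by simp
  then obtain h where h: "arc h" "pathstart h = pos (f ?m)" "pathfinish h = pos (f (Suc ?m))"
    "path_image h = path_image (\<gamma> {f ?m, f (Suc ?m)})" by (rule edge_arc_between)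
  have feq: "f p = f q \<longleftrightarrow> p = q" if "s \<le> p" "p \<le> Suc ?m" "s \<le> q" "q \<le> Suc ?m" for p q
    using inj_on_eq_iff[OF Suc.prems(1), of p q] that by simp
  have "path_image g \<inter> path_image h \<subseteq> {pathstart h}"
  proof
    fix z assume "z \<in> path_image g \<inter> path_image h"
    then obtain l where l: "s \<le> l" "l < ?m" "z \<in> path_image (\<gamma> {f l, f (Suc l)})"
      "z \<in> path_image (\<gamma> {f ?m, f (Suc ?m)})" unfolding g(4) h(4) by auto
    have ne: "f (Suc ?m) \<noteq> f l" "f (Suc ?m) \<noteq> f (Suc l)"
      using l feq[of "Suc ?m" l] feq[of "Suc ?m" "Suc l"] by auto
    have "{f l, f (Suc l)} \<noteq> {f ?m, f (Suc ?m)}" using ne by (auto simp: doubleton_eq_iff)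
    moreover have "{f l, f (Suc l)} \<in> E" "{f ?m, f (Suc ?m)} \<in> E" using Suc.prems(2) l by auto
    ultimately have "z \<in> pos ` ({f l, f (Suc l)} \<inter> {f ?m, f (Suc ?m)})"
      using edges_meet l(3,4) by blast
    then show "z \<in> {pathstart h}" using ne h(2) by auto
  qed
  then have "arc (g +++ h)" using g(1,3) h(1,2) by (intro arc_join) auto
  moreover have "path_image (g +++ h) = (\<Union>l\<in>{s..<s + Suc (Suc d)}. path_image (\<gamma> {f l, f (Suc l)}))"
    using g(3,4) h(2,4) by (simp add: path_image_join atLeastLessThanSuc Un_commute)
  ultimately show ?case using g h by (intro exI[of _ "g +++ h"]) simp
qed

end

locale drawn_alternating_cycle = alternating_cycle N E a vs k + plane_graph N E pos \<gamma>
  for N E a vs k pos \<gamma>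
begin

abbreviation curve where "curve \<equiv> cycle_curve \<gamma> vs"

text \<open>
  A vertex of the cycle is assigned the side of its third edge, any other vertex the side on which
  it lies. In this way both ends of an edge of \<open>rest\<close> are on the same side.
\<close>

definition inner where
  "inner v \<longleftrightarrow> (if v \<in> set vs then in_vertex E \<gamma> vs v else pos v \<in> inside curve)"

definition open_edge where "open_edge e = path_image (\<gamma> e) - pos ` (e \<inter> set vs)"

lemma rest_E: "e \<in> rest \<Longrightarrow> e \<in> E" "e \<in> rest \<Longrightarrow> e \<notin> C" by (auto simp: rest_def)

lemma vs_lt: "i < 2 * k \<Longrightarrow> vs ! i < N"
  using subsetD[OF set_N in_set] by simp

lemma pos_in_curve: assumes "v \<in> set vs" shows "pos v \<in> curve"
proof -
  obtain i where i: "i < 2 * k" "v = vs ! i" using assms by (rule set_exhaust)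
  then have "cyc_edge i \<in> C" "v \<in> cyc_edge i" by (auto simp: cycle_edges_eq)
  then show ?thesis using pos_in_edge[of "cyc_edge i" v] CE unfolding cycle_curve_def by blast
qed

lemma edge_meets_curve:
  assumes "e \<in> E" "e \<notin> C"
  shows "path_image (\<gamma> e) \<inter> curve \<subseteq> pos ` (e \<inter> set vs)"
proof
  fix z assume "z \<in> path_image (\<gamma> e) \<inter> curve"
  then obtain e' where e': "e' \<in> C" "z \<in> path_image (\<gamma> e')" "z \<in> path_image (\<gamma> e)"
    by (auto simp: cycle_curve_def)
  then have "z \<in> pos ` (e \<inter> e')" using edges_meet[of e e'] assms CE by blast
  then show "z \<in> pos ` (e \<inter> set vs)" using C_subset[OF e'(1)] by blast
qed

lemma open_edge:
  assumes e: "e \<in> E" "e \<notin> C"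
  shows "connected (open_edge e)" "open_edge e \<inter> curve = {}" "open_edge e \<noteq> {}"
    "open_edge e \<subseteq> inside curve \<or> open_edge e \<subseteq> outside curve"
proof -
  have ends: "pos ` (e \<inter> set vs) \<subseteq> {pathstart (\<gamma> e), pathfinish (\<gamma> e)}"
    using ends_edge[OF e(1)] by auto
  show conn: "connected (open_edge e)"
    unfolding open_edge_def by (rule connected_arc_minus_ends[OF arc_edge[OF e(1)] ends])
  show disj: "open_edge e \<inter> curve = {}" using edge_meets_curve[OF e] by (auto simp: open_edge_def)
  show "open_edge e \<noteq> {}" using arc_midpoint[OF arc_edge[OF e(1)]] ends unfolding open_edge_def by blast
  show "open_edge e \<subseteq> inside curve \<or> open_edge e \<subseteq> outside curve"
    by (rule connected_inside_or_outside[OF conn disj])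
qed

lemma edge_image_subset: "e \<in> E \<Longrightarrow> path_image (\<gamma> e) \<subseteq> open_edge e \<union> curve"
  using pos_in_curve by (auto simp: open_edge_def)

text \<open>
  An edge of \<open>rest\<close> meets the curve at most in its end points on the cycle. Without these it is
  connected, so it lies on one side, and it contains its end points off the cycle.
\<close>

lemma inner_iff_open_edge_inside:
  assumes e: "e \<in> rest" and v: "v \<in> e"
  shows "inner v \<longleftrightarrow> open_edge e \<subseteq> inside curve"
proof -
  note eE = rest_E[OF e]
  have io: "inside curve \<inter> outside curve = {}" "inside curve \<inter> curve = {}"
    using inside_Int_outside inside_no_overlap by auto
  show ?thesis
  proof (cases "v \<in> set vs")
    case False
    have "v < N" using edge_vertex[OF eE(1) v] .
    then have "pos v \<notin> pos ` (e \<inter> set vs)"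
      using pos_eq edge_vertex[OF eE(1)] False by (auto simp: image_iff)
    then have "pos v \<in> open_edge e" using pos_in_edge[OF eE(1) v] by (simp add: open_edge_def)
    moreover have "inner v \<longleftrightarrow> pos v \<in> inside curve" using False by (simp add: inner_def)
    ultimately show ?thesis using open_edge(4)[OF eE] io(1) by blast
  next
    case True
    then obtain i where i: "i < 2 * k" "v = vs ! i" by (rule set_exhaust)
    have uniq: "e' = e" if e': "e' \<in> E - C" "v \<in> e'" for e'
    proof -
      have "card {e \<in> E - C. v \<in> e} = 1"
        using incident_rest[OF i(1)] unfolding i(2) degree_in_def by simp
      then obtain e0 where "{e \<in> E - C. v \<in> e} = {e0}" by (auto simp: card_1_singleton_iff)
      moreover have "e \<in> {e \<in> E - C. v \<in> e}" using eE v by blast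
      moreover have "e' \<in> {e \<in> E - C. v \<in> e}" using e' by blast
      ultimately show ?thesis by simp
    qed
    have "in_vertex E \<gamma> vs v \<longleftrightarrow> path_image (\<gamma> e) \<subseteq> curve \<union> inside curve"
      unfolding in_vertex_def using uniq eE v by blast
    also have "\<dots> \<longleftrightarrow> open_edge e \<subseteq> inside curve"
      using edge_image_subset[OF eE(1)] open_edge(2)[OF eE] unfolding open_edge_def by blast
    finally show ?thesis using True by (simp add: inner_def)
  qed
qed

lemma inner_const:
  assumes "(x, y) \<in> (edge_rel rest)\<^sup>*"
  shows "inner y \<longleftrightarrow> inner x"
  using assms
proof (induction rule: rtrancl_induct)
  case (step y z)
  then have "{y, z} \<in> rest" by simp
  then have "inner y \<longleftrightarrow> inner z" using inner_iff_open_edge_inside by blast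
  then show ?case using step by simp
qed simp

text \<open>
  The side of the curve that contains the path starting at position \<open>i\<close>, and the edges of that path.
\<close>

definition side where "side i = (if inner (vs ! i) then inside curve else outside curve)"

definition branch where "branch i = {e \<in> rest. \<forall>v\<in>e. (vs ! i, v) \<in> (edge_rel rest)\<^sup>*}"

text \<open>
  The edges of the path in \<open>rest\<close> from position \<open>i\<close> are path connected, so they contain an arc
  between its two ends. All of them lie on the same side of the curve, and no other vertex of
  the cycle is on them.
\<close>

lemma chord_arc:
  assumes i: "i < 2 * k"
  obtains g where "arc g" "pathstart g = pos (vs ! i)" "pathfinish g = pos (vs ! mate i)"
    "path_image g \<subseteq> (\<Union>e\<in>branch i. path_image (\<gamma> e))"
    "path_image g - {pos (vs ! i), pos (vs ! mate i)} \<subseteq> side i"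
proof -
  define X where "X = (\<Union>e\<in>branch i. path_image (\<gamma> e))"
  have iN: "vs ! i < N" "vs ! mate i < N" using vs_lt mate(1) i by blast+
  have "path_component X (pos (vs ! i)) (pos v)" if "(vs ! i, v) \<in> (edge_rel rest)\<^sup>*" "v \<noteq> vs ! i" for v
  proof -
    have "v = vs ! i \<or> path_component X (pos (vs ! i)) (pos v)"
      using that(1)
    proof (induction rule: rtrancl_induct)
      case (step y z)
      then have yz: "{y, z} \<in> rest" by simp
      have "(vs ! i, z) \<in> (edge_rel rest)\<^sup>*" using step by (meson rtrancl.rtrancl_into_rtrancl)
      then have "{y, z} \<in> branch i" using step yz by (simp add: branch_def)
      then have sub: "path_image (\<gamma> {y, z}) \<subseteq> X" by (auto simp: X_def)
      obtain g where "arc g" "pathstart g = pos y" "pathfinish g = pos z" "path_image g = path_image (\<gamma> {y, z})"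
        by (rule edge_arc_between[OF rest_E(1)[OF yz]])
      then have "path_component X (pos y) (pos z)"
        using sub arc_imp_path unfolding path_component_def by blast
      then show ?case using step.IH path_component_trans by blast
    qed simp
    then show ?thesis using that(2) by simp
  qed
  moreover have neq: "vs ! mate i \<noteq> vs ! i" using nth_eq mate i by simp
  ultimately have "path_component X (pos (vs ! i)) (pos (vs ! mate i))" using mate(3)[OF i] by blast
  then obtain h where h: "path h" "path_image h \<subseteq> X" "pathstart h = pos (vs ! i)" "pathfinish h = pos (vs ! mate i)"
    unfolding path_component_def by blast
  have "pos (vs ! i) \<noteq> pos (vs ! mate i)" using pos_eq iN neq by simp
  then obtain g where g: "arc g" "path_image g \<subseteq> path_image h" "pathstart g = pos (vs ! i)" "pathfinish g = pos (vs ! mate i)"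
    using path_contains_arc[OF h(1,3,4)] by metis
  have "X - {pos (vs ! i), pos (vs ! mate i)} \<subseteq> side i"
  proof
    fix z assume z: "z \<in> X - {pos (vs ! i), pos (vs ! mate i)}"
    then obtain e where e: "e \<in> branch i" "z \<in> path_image (\<gamma> e)" by (auto simp: X_def)
    have er: "e \<in> rest" using e(1) by (simp add: branch_def)
    have ends: "pos v \<in> {pos (vs ! i), pos (vs ! mate i)}" if v: "v \<in> e" "v \<in> set vs" for v
    proof -
      obtain j where j: "j < 2 * k" "v = vs ! j" using v(2) by (rule set_exhaust)
      have "(vs ! i, vs ! j) \<in> (edge_rel rest)\<^sup>*" using e(1) v(1) j(2) by (simp add: branch_def)
      then have "j = i \<or> j = mate i" using mate(4)[OF i j(1)] by simp
      then show ?thesis using j(2) by blast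
    qed
    then have zo: "z \<in> open_edge e" using e(2) z unfolding open_edge_def by blast
    have "e \<noteq> {}" using edge_subset[OF rest_E(1)[OF er]] by auto
    then obtain v where v: "v \<in> e" by blast
    then have "inner v \<longleftrightarrow> inner (vs ! i)" using e(1) inner_const by (simp add: branch_def)
    then show "z \<in> side i"
      using inner_iff_open_edge_inside[OF er v] open_edge(4)[OF rest_E[OF er]] zo unfolding side_def by auto
  qed
  then show ?thesis using that[OF g(1,3,4)] g(2) h(2) unfolding X_def by blast
qed

lemma branch_disjoint:
  assumes i: "i < 2 * k" and l: "l < 2 * k" and ne: "l \<noteq> i" "l \<noteq> mate i"
  shows "(\<Union>e\<in>branch i. path_image (\<gamma> e)) \<inter> (\<Union>e\<in>branch l. path_image (\<gamma> e)) = {}"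
proof -
  have "path_image (\<gamma> e) \<inter> path_image (\<gamma> e') = {}" if e: "e \<in> branch i" and e': "e' \<in> branch l" for e e'
  proof -
    have eE: "e \<in> E" "e' \<in> E" using e e' rest_E(1) by (auto simp: branch_def)
    have disj: "e \<inter> e' = {}"
    proof (rule ccontr)
      assume "e \<inter> e' \<noteq> {}"
      then obtain v where "v \<in> e" "v \<in> e'" by blast
      then have iv: "(vs ! i, v) \<in> (edge_rel rest)\<^sup>*" and lv: "(vs ! l, v) \<in> (edge_rel rest)\<^sup>*"
        using e e' by (auto simp: branch_def)
      have "(vs ! i, vs ! l) \<in> (edge_rel rest)\<^sup>*" by (rule rtrancl_trans[OF iv edge_rel_sym[OF lv]])
      then show False using mate(4)[OF i l] ne by simp
    qed
    moreover have "e \<noteq> {}" using edge_subset[OF eE(1)] by auto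
    ultimately have "e \<noteq> e'" by blast
    then show ?thesis using edges_meet[OF eE] disj by simp
  qed
  then show ?thesis by blast
qed

text \<open>
  The second arc runs from position \<open>j\<close> through the end of the list to position \<open>i + 2 * k\<close>, where
  positions are read modulo \<open>2 * k\<close>.
\<close>

lemma cycle_arcs:
  assumes ij: "i < j" "j < 2 * k"
  obtains c1 c2 where
    "arc c1" "pathstart c1 = pos (vs ! i)" "pathfinish c1 = pos (vs ! j)"
    "arc c2" "pathstart c2 = pos (vs ! i)" "pathfinish c2 = pos (vs ! j)"
    "path_image c1 \<union> path_image c2 = curve"
    "path_image c1 \<inter> path_image c2 = {pos (vs ! i), pos (vs ! j)}"
    "\<forall>l\<in>{i..j}. pos (vs ! l) \<in> path_image c1"
    "\<forall>l<2 * k. l \<le> i \<or> j \<le> l \<longrightarrow> pos (vs ! l) \<in> path_image c2"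
proof -
  define f where "f p = vs ! (p mod (2 * k))" for p
  have f_lt: "f p = vs ! p" if "p < 2 * k" for p using that by (simp add: f_def)
  have f_add: "f (p + 2 * k) = vs ! p" if "p < 2 * k" for p using that by (simp add: f_def)
  have f_eq: "f p = f q \<longleftrightarrow> p mod (2 * k) = q mod (2 * k)" for p q
    using nth_eq[of "p mod (2 * k)" "q mod (2 * k)"] k by (simp add: f_def)
  have f_inj: "f p = f q \<longleftrightarrow> p = q" if "s \<le> p" "p < s + 2 * k" "s \<le> q" "q < s + 2 * k" for p q s
  proof -
    have le: "p = q" if "p mod (2 * k) = q mod (2 * k)" "p \<le> q" "q < p + 2 * k" for p q :: nat
    proof -
      have "2 * k dvd q - p" using that(1) mod_eq_dvd_iff_nat[OF that(2), of "2 * k"] by simp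
      moreover have "q - p < 2 * k" using that by simp
      ultimately have "q - p = 0" using nat_dvd_not_less by blast
      then show ?thesis using that(2) by simp
    qed
    show ?thesis
      unfolding f_eq using le[of p q] le[of q p] that by (cases "p \<le> q") auto
  qed
  have f_cyc_edge: "{f p, f (Suc p)} = cyc_edge (p mod (2 * k))" for p
    by (simp add: f_def next_vertex mod_Suc_eq)
  have f_C: "{f p, f (Suc p)} \<in> C" for p using k unfolding f_cyc_edge cycle_edges_eq by auto
  obtain c1 where c1: "arc c1" "pathstart c1 = pos (f i)" "pathfinish c1 = pos (f j)"
    "path_image c1 = (\<Union>l\<in>{i..<j}. path_image (\<gamma> {f l, f (Suc l)}))"
  proof -
    have j: "i + Suc (j - Suc i) = j" using ij by simp
    have "inj_on f {i..j}" by (rule inj_onI) (use f_inj[of i] ij in auto)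
    then show ?thesis using arc_along_walk[of f i "j - Suc i"] f_C CE that unfolding j by blast
  qed
  obtain c2 where c2: "arc c2" "pathstart c2 = pos (f j)" "pathfinish c2 = pos (f (i + 2 * k))"
    "path_image c2 = (\<Union>l\<in>{j..<i + 2 * k}. path_image (\<gamma> {f l, f (Suc l)}))"
  proof -
    have j: "j + Suc (i + 2 * k - Suc j) = i + 2 * k" using ij by simp
    have "inj_on f {j..i + 2 * k}" by (rule inj_onI) (use f_inj[of j] ij in auto)
    then show ?thesis using arc_along_walk[of f j "i + 2 * k - Suc j"] f_C CE that unfolding j by blast
  qed
  have f_ij: "f i = vs ! i" "f j = vs ! j" "f (i + 2 * k) = vs ! i" using f_lt f_add ij by auto
  have cov: "pos (f l) \<in> path_image c1" if "i \<le> l" "l \<le> j" for l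
  proof (cases "l = j")
    case True
    then show ?thesis using c1(3) pathfinish_in_path_image[of c1] by simp
  next
    case False
    then have "l \<in> {i..<j}" using that by simp
    moreover have "pos (f l) \<in> path_image (\<gamma> {f l, f (Suc l)})" using f_C CE by (intro pos_in_edge) auto
    ultimately show ?thesis unfolding c1(4) by blast
  qed
  have cov2: "pos (f l) \<in> path_image c2" if "j \<le> l" "l \<le> i + 2 * k" for l
  proof (cases "l = i + 2 * k")
    case True
    then show ?thesis using c2(3) pathfinish_in_path_image[of c2] by simp
  next
    case False
    then have "l \<in> {j..<i + 2 * k}" using that by simp
    moreover have "pos (f l) \<in> path_image (\<gamma> {f l, f (Suc l)})" using f_C CE by (intro pos_in_edge) auto
    ultimately show ?thesis unfolding c2(4) by blast
  qed
  have "path_image c1 \<union> path_image c2 = curve"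
  proof -
    have eq: "(\<lambda>p. {f p, f (Suc p)}) ` ({i..<j} \<union> {j..<i + 2 * k}) = C"
    proof (intro equalityI subsetI)
      fix e assume "e \<in> C"
      then obtain q where q: "q < 2 * k" "e = cyc_edge q" by (auto simp: cycle_edges_eq)
      define p where "p = (if i \<le> q then q else q + 2 * k)"
      have "p mod (2 * k) = q" "p \<in> {i..<j} \<union> {j..<i + 2 * k}" using q(1) ij by (auto simp: p_def)
      then show "e \<in> (\<lambda>p. {f p, f (Suc p)}) ` ({i..<j} \<union> {j..<i + 2 * k})"
        unfolding q(2) f_cyc_edge by blast
    qed (use f_C in blast)
    have "curve = (\<Union>p\<in>{i..<j} \<union> {j..<i + 2 * k}. path_image (\<gamma> {f p, f (Suc p)}))"
      unfolding cycle_curve_def eq[symmetric] image_image ..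
    then show ?thesis unfolding c1(4) c2(4) by blast
  qed
  moreover have "path_image c1 \<inter> path_image c2 = {pos (vs ! i), pos (vs ! j)}"
  proof
    show "{pos (vs ! i), pos (vs ! j)} \<subseteq> path_image c1 \<inter> path_image c2"
      using cov[of i] cov[of j] cov2[of j] cov2[of "i + 2 * k"] ij unfolding f_ij by simp
    show "path_image c1 \<inter> path_image c2 \<subseteq> {pos (vs ! i), pos (vs ! j)}"
    proof
      fix z assume "z \<in> path_image c1 \<inter> path_image c2"
      then obtain p q where p: "i \<le> p" "p < j" "z \<in> path_image (\<gamma> {f p, f (Suc p)})"
        and q: "j \<le> q" "q < i + 2 * k" "z \<in> path_image (\<gamma> {f q, f (Suc q)})"
        unfolding c1(4) c2(4) by auto
      have common: "f x \<in> {f i, f j}" if x: "i \<le> x" "x \<le> j" "j \<le> y" "y \<le> i + 2 * k" "f x = f y" for x y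
      proof (cases "y = i + 2 * k")
        case True
        then show ?thesis using x(5) f_ij by simp
      next
        case False
        then have "x = y" using f_inj[of i x y] x ij by simp
        then show ?thesis using x by simp
      qed
      have sub: "{f p, f (Suc p)} \<inter> {f q, f (Suc q)} \<subseteq> {f i, f j}"
      proof
        fix v assume "v \<in> {f p, f (Suc p)} \<inter> {f q, f (Suc q)}"
        then obtain x y where xy: "x = p \<or> x = Suc p" "v = f x" "y = q \<or> y = Suc q" "v = f y" by blast
        then have bounds: "i \<le> x" "x \<le> j" "j \<le> y" "y \<le> i + 2 * k" using p q by auto
        have "f x = f y" using xy(2,4) by simp
        with bounds have "f x \<in> {f i, f j}" by (rule common)
        then show "v \<in> {f i, f j}" using xy(2) by simp
      qed
      have "{f p, f (Suc p)} \<noteq> {f q, f (Suc q)}"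
      proof
        assume "{f p, f (Suc p)} = {f q, f (Suc q)}"
        then have "p mod (2 * k) = q mod (2 * k)" unfolding f_cyc_edge using k by (intro cyc_edge_inj) auto
        then have "f p = f q" using f_eq by simp
        then show False using f_inj[of i p q] p q ij by simp
      qed
      then have "z \<in> pos ` ({f p, f (Suc p)} \<inter> {f q, f (Suc q)})"
        using edges_meet f_C CE p(3) q(3) by blast
      then have "z \<in> pos ` {f i, f j}" by (rule subsetD[OF image_mono[OF sub]])
      then show "z \<in> {pos (vs ! i), pos (vs ! j)}" by (simp add: f_ij)
    qed
  qed
  moreover have "\<forall>l\<in>{i..j}. pos (vs ! l) \<in> path_image c1"
  proof
    fix l assume "l \<in> {i..j}"
    then show "pos (vs ! l) \<in> path_image c1" using cov[of l] f_lt[of l] ij by simp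
  qed
  moreover have "\<forall>l<2 * k. l \<le> i \<or> j \<le> l \<longrightarrow> pos (vs ! l) \<in> path_image c2"
  proof (intro allI impI)
    fix l assume l: "l < 2 * k" and "l \<le> i \<or> j \<le> l"
    from this(2) show "pos (vs ! l) \<in> path_image c2"
    proof
      assume "l \<le> i"
      then show ?thesis using cov2[of "l + 2 * k"] f_add[OF l] ij by simp
    next
      assume "j \<le> l"
      then show ?thesis using cov2[of l] f_lt[OF l] l by simp
    qed
  qed
  ultimately show ?thesis
    using that[of c1 "reversepath c2"] c1(1-3) c2(1-3) f_ij by (simp add: arc_reversepath)
qed

lemma chords_do_not_cross:
  assumes i: "i < 2 * k" "i < mate i" and l: "i < l" "l < mate i"
    and same: "inner (vs ! l) \<longleftrightarrow> inner (vs ! i)"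
  shows "i < mate l \<and> mate l < mate i"
proof (rule ccontr)
  assume cross: "\<not> ?thesis"
  let ?j = "mate i" and ?m = "mate l"
  have j: "?j < 2 * k" and l2: "l < 2 * k" using mate(1)[OF i(1)] l by auto
  have m: "?m < 2 * k" using mate(1)[OF l2] .
  have mi: "?m \<noteq> i" using mate_mate[OF l2] l by auto
  have mj: "?m \<noteq> ?j" using mate_mate[OF l2] mate_mate[OF i(1)] l by auto
  from mi mj have m_out: "?m < i \<or> ?j < ?m" using cross by auto
  obtain c1 c2 where c1: "arc c1" "pathstart c1 = pos (vs ! i)" "pathfinish c1 = pos (vs ! ?j)"
    and c2: "arc c2" "pathstart c2 = pos (vs ! i)" "pathfinish c2 = pos (vs ! ?j)"
    and un: "path_image c1 \<union> path_image c2 = curve"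
    and meet: "path_image c1 \<inter> path_image c2 = {pos (vs ! i), pos (vs ! ?j)}"
    and cov1: "\<forall>l\<in>{i..?j}. pos (vs ! l) \<in> path_image c1"
    and cov2: "\<forall>l<2 * k. l \<le> i \<or> ?j \<le> l \<longrightarrow> pos (vs ! l) \<in> path_image c2"
    by (rule cycle_arcs[OF i(2) j])
  obtain c where c: "arc c" "pathstart c = pos (vs ! i)" "pathfinish c = pos (vs ! ?j)"
    "path_image c \<subseteq> (\<Union>e\<in>branch i. path_image (\<gamma> e))" "path_image c - {pos (vs ! i), pos (vs ! ?j)} \<subseteq> side i"
    by (rule chord_arc[OF i(1)])
  obtain d where d: "arc d" "pathstart d = pos (vs ! l)" "pathfinish d = pos (vs ! ?m)"
    "path_image d \<subseteq> (\<Union>e\<in>branch l. path_image (\<gamma> e))" "path_image d - {pos (vs ! l), pos (vs ! ?m)} \<subseteq> side l"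
    by (rule chord_arc[OF l2])
  have pos_vs: "pos (vs ! x) = pos (vs ! y) \<longleftrightarrow> x = y" if "x < 2 * k" "y < 2 * k" for x y
    using pos_eq[OF vs_lt[OF that(1)] vs_lt[OF that(2)]] nth_eq[OF that] by simp
  show False
  proof (rule no_crossing_chords[OF c1 c2 c(1-3) d(1) _ _ meet])
    have "pos (vs ! l) \<in> path_image c1" using cov1 l by simp
    moreover have "pos (vs ! l) \<noteq> pos (vs ! i)" "pos (vs ! l) \<noteq> pos (vs ! ?j)"
      using pos_vs[OF l2 i(1)] pos_vs[OF l2 j] l by simp_all
    ultimately show "pathstart d \<in> path_image c1 - {pos (vs ! i), pos (vs ! ?j)}"
      unfolding d(2) by blast
    have "pos (vs ! ?m) \<in> path_image c2" using cov2 m m_out by (meson less_imp_le)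
    moreover have "pos (vs ! ?m) \<noteq> pos (vs ! i)" "pos (vs ! ?m) \<noteq> pos (vs ! ?j)"
      using pos_vs[OF m i(1)] pos_vs[OF m j] mi mj by simp_all
    ultimately show "pathfinish d \<in> path_image c2 - {pos (vs ! i), pos (vs ! ?j)}"
      unfolding d(3) by blast
    show "path_image c \<inter> path_image d = {}"
      using branch_disjoint[OF i(1) l2] l c(4) d(4) by blast
    show "side i = inside (path_image c1 \<union> path_image c2) \<or> side i = outside (path_image c1 \<union> path_image c2)"
      unfolding un side_def by simp
    show "path_image c - {pos (vs ! i), pos (vs ! ?j)} \<subseteq> side i" by (rule c(5))
    show "path_image d - {pathstart d, pathfinish d} \<subseteq> side i"
      using d(5) same unfolding d(2,3) side_def by simp
  qed
qed

text \<open>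
  Chords on the same side do not cross, so the vertices of one kind between two mates are paired
  among themselves; this is the evenness required of the chord diagram.
\<close>

theorem complement_components_parity:
  assumes tension: "tension E \<gamma> vs = 0"
  shows "even (num_components N (E - flipped) + num_components N (E - a) + k + 1)"
proof -
  define In where "In i = inner (vs ! i)" for i
  have In: "In i = in_vertex E \<gamma> vs (vs ! i)" if "i < 2 * k" for i
    using in_set[OF that] by (simp add: In_def inner_def)
  have In_mate: "In (mate i) = In i" if "i < 2 * k" for i
    using inner_const[OF mate(3)[OF that]] by (simp add: In_def)
  have "even (num_classes {0..<2 * k} (link_rel (2 * k) mate even_partner)
    + num_classes {0..<2 * k} (link_rel (2 * k) mate (odd_partner (2 * k))) + k + 1)"
  proof (rule chord_diagram_parity)
    show "even (card {l. i < l \<and> l < mate i \<and> In l = In i})" if i: "i < 2 * k" "i < mate i" for i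
    proof (rule even_card_involution[where f = mate])
      fix l assume "l \<in> {l. i < l \<and> l < mate i \<and> In l = In i}"
      then have l: "i < l" "l < mate i" "In l = In i" by auto
      then have l2: "l < 2 * k" using mate(1)[OF i(1)] by simp
      show "mate l \<in> {l. i < l \<and> l < mate i \<and> In l = In i}"
        using chords_do_not_cross[OF i l(1,2)] l(3) In_mate[OF l2] by (simp add: In_def)
      show "mate (mate l) = l" "mate l \<noteq> l" using mate_mate[OF l2] mate(2)[OF l2] by auto
    qed simp
    have sets: "{i. i < length vs \<and> even i \<and> \<not> in_vertex E \<gamma> vs (vs ! i)} = {i. i < 2 * k \<and> even i \<and> \<not> In i}"
      "{i. i < length vs \<and> odd i \<and> \<not> in_vertex E \<gamma> vs (vs ! i)} = {i. i < 2 * k \<and> odd i \<and> \<not> In i}"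
      using In by (auto simp: len)
    show "card {i. i < 2 * k \<and> even i \<and> \<not> In i} = card {i. i < 2 * k \<and> odd i \<and> \<not> In i}"
      using tension unfolding tension_def sets by simp
    show "0 < k" using k by simp
  qed (simp_all add: mate mate_mate In_mate)
  moreover have "even (A + B + k + 1) \<Longrightarrow> even (K + A + (K + B) + k + 1)" for A B K :: nat
    by presburger
  ultimately show ?thesis unfolding num_components_complements by blast
qed

end

section \<open>The sign of a matching along an alternating cycle\<close>

text \<open>
  The sign of a matching is defined by a listing directed along the orientation. An arbitrary
  listing differs from it by a factor \<open>- 1\<close> for every edge listed in the opposite direction, and
  the matrix with weights 1 provides these factors.
\<close>

lemma matching_sgn_eq:
  fixes \<sigma> :: "nat \<Rightarrow> nat"
  assumes E: "simple_graph (2 * n) E" and D: "is_orientation E D"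
    and \<sigma>: "lists_matching n a \<sigma>" and aE: "a \<subseteq> E"
  defines "A \<equiv> skew_adjacency (2 * n) D (\<lambda>e. 1 :: rat)"
  shows "of_int (matching_sgn n D a) = of_int (sign \<sigma>) * (\<Prod>m<n. A $$ (\<sigma> (2 * m), \<sigma> (2 * m + 1)))"
proof -
  have D1: "(i, j) \<in> D \<longleftrightarrow> (j, i) \<notin> D" if "{i, j} \<in> E" for i j
    using D that by (auto simp: is_orientation_def)
  have DE: "{i, j} \<in> E" if "(i, j) \<in> D" for i j using D that by (auto simp: is_orientation_def)
  have entry: "A $$ (i, j) = (if (i, j) \<in> D then 1 else if (j, i) \<in> D then - 1 else 0)"
    if "i < 2 * n" "j < 2 * n" for i j
    using that by (simp add: A_def skew_adjacency_def)
  have skew: "A $$ (j, i) = - A $$ (i, j)" if "i < 2 * n" "j < 2 * n" for i j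
    using D1[OF DE, of i j] D1[OF DE, of j i] that by (auto simp: entry)
  define S where "S = {m. m < n \<and> (\<sigma> (2 * m), \<sigma> (2 * m + 1)) \<notin> D}"
  have S: "finite S" "S \<subseteq> {..<n}" by (auto simp: S_def)
  define \<tau>0 where "\<tau>0 = \<sigma> \<circ> flip_perm S"
  have t: "\<tau>0 (2 * m) = (if m \<in> S then \<sigma> (2 * m + 1) else \<sigma> (2 * m))"
    "\<tau>0 (2 * m + 1) = (if m \<in> S then \<sigma> (2 * m) else \<sigma> (2 * m + 1))" for m
    by (auto simp: \<tau>0_def flip_perm_def)
  have "{\<tau>0 (2 * m), \<tau>0 (2 * m + 1)} = {\<sigma> (2 * m), \<sigma> (2 * m + 1)}" for m
    by (auto simp only: t split: if_splits)
  moreover have "\<tau>0 permutes {0..<2 * n}"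
    unfolding \<tau>0_def using \<sigma> conjunct1[OF flip_perm[OF S]]
    by (intro permutes_compose) (auto simp: lists_matching_def)
  ultimately have "lists_matching n a \<tau>0" using \<sigma> by (simp add: lists_matching_def)
  moreover have "(\<tau>0 (2 * m), \<tau>0 (2 * m + 1)) \<in> D" if "m < n" for m
  proof -
    have "{\<sigma> (2 * m), \<sigma> (2 * m + 1)} \<in> E" using \<sigma> aE that by (auto simp: lists_matching_def)
    then show ?thesis using D1 that unfolding t by (auto simp: S_def)
  qed
  ultimately have "\<exists>\<tau>. lists_matching n a \<tau> \<and> (\<forall>k<n. (\<tau> (2 * k), \<tau> (2 * k + 1)) \<in> D)" by blast
  from someI_ex[OF this] obtain \<tau> where sgn: "matching_sgn n D a = sign \<tau>"
    and \<tau>: "lists_matching n a \<tau>" "\<And>k. k < n \<Longrightarrow> (\<tau> (2 * k), \<tau> (2 * k + 1)) \<in> D"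
    unfolding matching_sgn_def by blast
  have "\<tau> i < 2 * n" if "i < 2 * n" for i
    using \<tau>(1) that permutes_in_image[of \<tau> "{0..<2 * n}" i] by (auto simp: lists_matching_def)
  then have "(\<Prod>m<n. A $$ (\<tau> (2 * m), \<tau> (2 * m + 1))) = 1"
    by (intro prod.neutral) (auto simp: entry \<tau>(2)[simplified])
  then show ?thesis using pfaffian_term_cong[OF \<sigma> \<tau>(1) skew] by (simp add: sgn)
qed

lemma perfect_matchings_mono: "E \<subseteq> E' \<Longrightarrow> perfect_matchings V E \<subseteq> perfect_matchings V E'"
  by (auto simp: perfect_matchings_def)

lemma prod_consecutive_pairs:
  fixes f :: "nat \<Rightarrow> 'b::comm_monoid_mult"
  shows "(\<Prod>i\<in>{i. i < 2 * k \<and> even i}. f i * f (Suc i)) = (\<Prod>i<2 * k. f i)"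
proof (induction k)
  case (Suc k)
  have "{i. i < 2 * Suc k \<and> even i} = insert (2 * k) {i. i < 2 * k \<and> even i}"
    by (auto simp: less_Suc_eq)
  then have "(\<Prod>i\<in>{i. i < 2 * Suc k \<and> even i}. f i * f (Suc i))
      = f (2 * k) * f (Suc (2 * k)) * (\<Prod>i\<in>{i. i < 2 * k \<and> even i}. f i * f (Suc i))"
    by simp
  then show ?case using Suc by (simp add: mult_ac)
qed simp

context alternating_cycle
begin

text \<open>
  Reversing the traversal turns forward edges into backward edges. So the number of forward edges
  of an even cycle has the same parity in both directions.
\<close>

lemma forward_edges_rev:
  assumes D: "is_orientation E D"
  shows "forward_edges D (rev vs) + forward_edges D vs = 2 * k"
proof -
  define F where "F = {i. i < 2 * k \<and> (vs ! i, next_vertex vs i) \<in> D}"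
  define h where "h i = (if Suc i = 2 * k then i else 2 * k - 2 - i)" for i
  have h: "h i < 2 * k" "h (h i) = i" if "i < 2 * k" for i using that by (auto simp: h_def)
  have rev_edge: "(rev vs ! i, next_vertex (rev vs) i) = (next_vertex vs (h i), vs ! h i)" if i: "i < 2 * k" for i
  proof (cases "Suc i = 2 * k")
    case True
    then have "2 * k - Suc 0 = i" by simp
    then show ?thesis using True i k by (simp add: next_vertex_def rev_nth len h_def)
  next
    case False
    then have "Suc i < 2 * k" "Suc (2 * k - 2 - i) = 2 * k - Suc i" using i by auto
    then show ?thesis using i False by (simp add: next_vertex_def rev_nth len h_def)
  qed
  have "{i. i < length (rev vs) \<and> (rev vs ! i, next_vertex (rev vs) i) \<in> D}
      = {i. i < 2 * k \<and> (next_vertex vs (h i), vs ! h i) \<in> D}"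
    using rev_edge by (auto simp: len)
  also have "\<dots> = {i. i < 2 * k \<and> h i \<notin> F}"
  proof -
    have "(next_vertex vs (h i), vs ! h i) \<in> D \<longleftrightarrow> h i \<notin> F" if "i < 2 * k" for i
      using D edge[OF h(1)[OF that]] h(1)[OF that] unfolding is_orientation_def F_def by blast
    then show ?thesis by blast
  qed
  finally have "forward_edges D (rev vs) = card {i. i < 2 * k \<and> h i \<notin> F}" by (simp add: forward_edges_def)
  also have "\<dots> = card {i. i < 2 * k \<and> i \<notin> F}"
    by (rule bij_betw_same_card[of h], rule bij_betwI[where g = h]) (use h in auto)
  also have "\<dots> + card F = 2 * k"
  proof -
    have "card {i. i < 2 * k} = card {i \<in> {i. i < 2 * k}. i \<notin> F} + card {i \<in> {i. i < 2 * k}. \<not> i \<notin> F}"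
      by (rule card_split) simp
    moreover have "{i \<in> {i. i < 2 * k}. \<not> i \<notin> F} = F" by (auto simp: F_def)
    ultimately show ?thesis by simp
  qed
  moreover have "forward_edges D vs = card F" by (simp add: forward_edges_def F_def len)
  ultimately show ?thesis by simp
qed

definition rotation where "rotation = cycle_of_list vs"

text \<open>
  Moving every vertex of the cycle to the next one turns the matching into \<open>flipped\<close>, hence listings
  of the former into listings of the latter.
\<close>

lemma rotation:
  "rotation permutes set vs" "i < 2 * k \<Longrightarrow> rotation (vs ! i) = next_vertex vs i"
  "sign rotation = - 1"
proof -
  show "rotation permutes set vs" unfolding rotation_def by (rule cycle_permutes)
  show "i < 2 * k \<Longrightarrow> rotation (vs ! i) = next_vertex vs i"
    using cycle_of_list_nth[OF dist, of i] by (simp add: rotation_def next_vertex len)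
  have "odd (2 * k - 1)" "vs \<noteq> []" using k len by auto
  then show "sign rotation = - 1" using sign_cycle_of_list[OF dist] by (simp add: rotation_def len)
qed

lemma rotation_cyc_edge:
  assumes "i < 2 * k"
  shows "rotation ` cyc_edge i = cyc_edge (Suc i mod (2 * k))"
proof -
  have "Suc i mod (2 * k) < 2 * k" using k by simp
  then show ?thesis using rotation(2)[OF assms] rotation(2)[of "Suc i mod (2 * k)"] by (simp add: next_vertex)
qed

lemma rotation_off_cycle: "e \<in> a \<Longrightarrow> e \<notin> C \<Longrightarrow> v \<in> e \<Longrightarrow> rotation v = v"
proof -
  assume e: "e \<in> a" "e \<notin> C" "v \<in> e"
  have "v \<notin> set vs"
  proof
    assume "v \<in> set vs"
    then obtain i where "i < 2 * k" "v = vs ! i" by (rule set_exhaust)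
    then show False using matching_edge_on_cycle(1)[of i e] e by blast
  qed
  then show "rotation v = v" by (rule permutes_not_in[OF rotation(1)])
qed

lemma rotation_matching: "(`) rotation ` a = flipped"
proof (intro equalityI subsetI)
  fix e assume "e \<in> (`) rotation ` a"
  then obtain e' where e': "e' \<in> a" "e = rotation ` e'" by blast
  show "e \<in> flipped"
  proof (cases "e' \<in> C")
    case True
    then obtain i where i: "i < 2 * k" "e' = cyc_edge i" by (auto simp: cycle_edges_eq)
    have "even i" using alt[OF i(1)] e'(1) i(2) by simp
    then have s: "Suc i < 2 * k" "odd (Suc i)" using i(1) by presburger+
    have "cyc_edge (Suc i) \<notin> a" using alt[OF s(1)] s(2) by simp
    moreover have "cyc_edge (Suc i) \<in> C" using s(1) unfolding cycle_edges_eq by blast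
    moreover have "e = cyc_edge (Suc i)" using e'(2) i(2) rotation_cyc_edge[OF i(1)] s(1) by simp
    ultimately show ?thesis by (simp add: flipped_def)
  next
    case False
    then have "rotation ` e' = e'" using rotation_off_cycle[OF e'(1)] by (simp cong: image_cong)
    then show ?thesis using e' False by (simp add: flipped_def)
  qed
next
  fix e assume "e \<in> flipped"
  then consider "e \<in> a" "e \<notin> C" | "e \<in> C" "e \<notin> a" by (auto simp: flipped_def)
  then show "e \<in> (`) rotation ` a"
  proof cases
    case 1
    then have "rotation ` e = e" using rotation_off_cycle by (simp cong: image_cong)
    then show ?thesis using 1 by (metis imageI)
  next
    case 2
    then obtain i where i: "i < 2 * k" "e = cyc_edge i" by (auto simp: cycle_edges_eq)
    have "prev i < 2 * k" "even (prev i)" using prev[OF i(1)] alt[OF i(1)] 2 i(2) by auto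
    then have "cyc_edge (prev i) \<in> a" using alt by simp
    moreover have "rotation ` cyc_edge (prev i) = e" using rotation_cyc_edge[of "prev i"] prev[OF i(1)] i(2) by simp
    ultimately show ?thesis by blast
  qed
qed

text \<open>
  The listings of \<open>a\<close> and of \<open>flipped\<close> by \<open>\<sigma>\<close> and \<open>rotation \<circ> \<sigma>\<close> have opposite signs. In the product of
  their matrix entries a matching edge off the cycle gives a square, and the edges of the cycle contribute
  all entries along one traversal, whether or not \<open>\<sigma>\<close> lists them in that direction: if it does not,
  the entry of an edge in \<open>a\<close> and that of its rotated edge change their signs together.
\<close>

theorem matching_sgn_flipped:
  assumes N: "N = 2 * n" and D: "is_orientation E D"
  shows "matching_sgn n D a * matching_sgn n D flipped = - ((- 1) ^ forward_edges D vs)"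
proof -
  define A where "A = skew_adjacency (2 * n) D (\<lambda>e. 1 :: rat)"
  have E: "simple_graph (2 * n) E" using graph N by simp
  have D1: "(i, j) \<in> D \<longleftrightarrow> (j, i) \<notin> D" if "{i, j} \<in> E" for i j
    using D that by (auto simp: is_orientation_def)
  have entry: "A $$ (i, j) = (if (i, j) \<in> D then 1 else - 1)" if "{i, j} \<in> E" for i j
    using edge_subset[OF that] D1[OF that] N by (simp add: A_def skew_adjacency_def)
  have skew: "A $$ (j, i) = - A $$ (i, j)" if "{i, j} \<in> E" for i j
    using entry[of i j] entry[of j i] that D1[OF that] by (auto simp: insert_commute)
  have square: "A $$ (i, j) * A $$ (i, j) = 1" if "{i, j} \<in> E" for i j
    using entry[OF that] by simp
  have "E \<subseteq> {e. e \<subseteq> {0..<2 * n} \<and> card e = 2}" using edge_subset N by auto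
  then have "a \<in> perfect_matchings {0..<2 * n} {e. e \<subseteq> {0..<2 * n} \<and> card e = 2}"
    using subsetD[OF perfect_matchings_mono a] N by simp
  then obtain \<sigma> where \<sigma>: "lists_matching n a \<sigma>" using ex_matching_perm by blast
  define ev where "ev m = {\<sigma> (2 * m), \<sigma> (2 * m + 1)}" for m
  have ps: "\<sigma> permutes {0..<2 * n}" and ev: "ev ` {..<n} = a" using \<sigma> by (auto simp: lists_matching_def ev_def)
  have ev_inj: "inj_on ev {..<n}"
  proof (rule inj_onI)
    have inj: "\<sigma> i = \<sigma> j \<longleftrightarrow> i = j" for i j using permutes_inj[OF ps] by (simp add: inj_eq)
    fix m m' assume "ev m = ev m'"
    then show "m = m'" by (auto simp: ev_def doubleton_eq_iff inj)
  qed
  let ?\<tau> = "rotation \<circ> \<sigma>"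
  have \<tau>: "lists_matching n flipped ?\<tau>"
  proof -
    have "rotation permutes {0..<2 * n}" using permutes_subset[OF rotation(1)] set_N N by simp
    then have "?\<tau> permutes {0..<2 * n}" by (rule permutes_compose[OF ps])
    moreover have "(\<lambda>m. {?\<tau> (2 * m), ?\<tau> (2 * m + 1)}) ` {..<n} = (`) rotation ` (ev ` {..<n})"
      unfolding image_image ev_def by simp
    ultimately show ?thesis unfolding lists_matching_def ev rotation_matching by simp
  qed
  have sign\<tau>: "sign ?\<tau> = - sign \<sigma>"
  proof -
    have "permutation rotation" "permutation \<sigma>" using rotation(1) ps permutation_permutes by blast+
    then show ?thesis using rotation(3) by (simp add: sign_compose)
  qed
  define B where "B i = A $$ (vs ! i, next_vertex vs i)" for i
  \<comment> \<open>For an edge \<open>cyc_edge i\<close> of the matching this product has the single factor for \<open>i\<close>; for an edge off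
    the cycle it is empty.\<close>
  define G where "G e = (\<Prod>i\<in>{i \<in> {i. i < 2 * k \<and> even i}. cyc_edge i = e}. B i * B (Suc i mod (2 * k)))" for e
  have block: "A $$ (x, y) * A $$ (rotation x, rotation y) = G {x, y}" if xy: "{x, y} \<in> a" for x y
  proof (cases "{x, y} \<in> C")
    case False
    then have "{i \<in> {i. i < 2 * k \<and> even i}. cyc_edge i = {x, y}} = {}" by (auto simp: cycle_edges_eq)
    then have "G {x, y} = 1" unfolding G_def by (simp only: prod.empty)
    moreover have "rotation x = x" "rotation y = y" using rotation_off_cycle[OF xy False] by auto
    moreover have "A $$ (x, y) * A $$ (x, y) = 1" using square xy aE by blast
    ultimately show ?thesis by simp
  next
    case True
    then obtain i where i: "i < 2 * k" "{x, y} = cyc_edge i" by (auto simp: cycle_edges_eq)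
    have "even i" using alt[OF i(1)] xy i(2) by simp
    have "j = i" if "j < 2 * k" "cyc_edge j = {x, y}" for j
      by (rule cyc_edge_inj[OF that(1) i(1)]) (use that(2) i(2) in simp)
    then have "{i \<in> {i. i < 2 * k \<and> even i}. cyc_edge i = {x, y}} = {i}" using i \<open>even i\<close> by blast
    then have G: "G {x, y} = B i * B (Suc i mod (2 * k))" unfolding G_def by (simp only: prod.insert prod.empty finite.emptyI) simp
    let ?s = "Suc i mod (2 * k)"
    have s: "?s < 2 * k" using k by simp
    have rot: "rotation (vs ! i) = vs ! ?s" "rotation (vs ! ?s) = next_vertex vs ?s"
      using rotation(2)[OF i(1)] rotation(2)[OF s] by (simp_all add: next_vertex)
    have B: "B i = A $$ (vs ! i, vs ! ?s)" "B ?s = A $$ (vs ! ?s, next_vertex vs ?s)"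
      by (simp_all add: B_def next_vertex)
    have "{x, y} = {vs ! i, vs ! ?s}" using i(2) by (simp add: next_vertex)
    then consider "x = vs ! i" "y = vs ! ?s" | "x = vs ! ?s" "y = vs ! i" by (auto simp: doubleton_eq_iff)
    then show ?thesis
    proof cases
      case 1
      then show ?thesis unfolding G B by (simp add: rot)
    next
      case 2
      have "A $$ (vs ! ?s, vs ! i) = - A $$ (vs ! i, vs ! ?s)"
        using skew[of "vs ! i" "vs ! ?s"] edge[OF i(1)] by (simp add: next_vertex)
      moreover have "A $$ (next_vertex vs ?s, vs ! ?s) = - A $$ (vs ! ?s, next_vertex vs ?s)"
        using skew[of "vs ! ?s" "next_vertex vs ?s"] edge[OF s] by simp
      ultimately show ?thesis unfolding G B unfolding 2 rot by simp
    qed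
  qed
  have "(\<Prod>m<n. A $$ (\<sigma> (2 * m), \<sigma> (2 * m + 1))) * (\<Prod>m<n. A $$ (?\<tau> (2 * m), ?\<tau> (2 * m + 1)))
      = (\<Prod>m<n. G (ev m))"
    unfolding prod.distrib[symmetric]
  proof (rule prod.cong)
    fix m assume "m \<in> {..<n}"
    then have "{\<sigma> (2 * m), \<sigma> (2 * m + 1)} \<in> a" unfolding ev[symmetric] ev_def by blast
    from block[OF this] show "A $$ (\<sigma> (2 * m), \<sigma> (2 * m + 1)) * A $$ (?\<tau> (2 * m), ?\<tau> (2 * m + 1)) = G (ev m)"
      by (simp add: ev_def)
  qed simp
  also have "\<dots> = (\<Prod>e\<in>a. G e)" unfolding ev[symmetric] by (simp add: prod.reindex[OF ev_inj])
  also have "\<dots> = (\<Prod>i\<in>{i. i < 2 * k \<and> even i}. B i * B (Suc i mod (2 * k)))"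
    unfolding G_def
  proof (rule prod.group)
    show "finite a" using aE finE finite_subset by blast
    show "cyc_edge ` {i. i < 2 * k \<and> even i} \<subseteq> a" using alt by auto
  qed simp
  also have "\<dots> = (\<Prod>i\<in>{i. i < 2 * k \<and> even i}. B i * B (Suc i))"
  proof (rule prod.cong)
    fix i assume "i \<in> {i. i < 2 * k \<and> even i}"
    then have "i < 2 * k" "even i" by auto
    then have "Suc i < 2 * k" by presburger
    then show "B i * B (Suc i mod (2 * k)) = B i * B (Suc i)" by simp
  qed simp
  also have "\<dots> = (\<Prod>i<2 * k. B i)" by (rule prod_consecutive_pairs)
  also have "\<dots> = (\<Prod>i<2 * k. if (vs ! i, next_vertex vs i) \<in> D then 1 else - 1)"
    by (rule prod.cong) (simp_all add: B_def entry edge)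
  also have "\<dots> = (\<Prod>i\<in>{i. i < 2 * k \<and> (vs ! i, next_vertex vs i) \<notin> D}. - 1)"
    by (rule prod.mono_neutral_cong_right) auto
  also have "\<dots> = (- 1) ^ card {i. i < 2 * k \<and> (vs ! i, next_vertex vs i) \<notin> D}" by simp
  also have "\<dots> = (- 1) ^ forward_edges D vs"
  proof -
    have "card {i. i < 2 * k} = card {i \<in> {i. i < 2 * k}. (vs ! i, next_vertex vs i) \<in> D} +
        card {i \<in> {i. i < 2 * k}. (vs ! i, next_vertex vs i) \<notin> D}"
      by (rule card_split) simp
    then have "2 * k = forward_edges D vs + card {i. i < 2 * k \<and> (vs ! i, next_vertex vs i) \<notin> D}"
      by (simp add: forward_edges_def len)
    then have "even (card {i. i < 2 * k \<and> (vs ! i, next_vertex vs i) \<notin> D}) \<longleftrightarrow> even (forward_edges D vs)"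
      by presburger
    then show ?thesis by (simp add: minus_one_power_iff)
  qed
  finally have prods: "(\<Prod>m<n. A $$ (\<sigma> (2 * m), \<sigma> (2 * m + 1))) * (\<Prod>m<n. A $$ (?\<tau> (2 * m), ?\<tau> (2 * m + 1)))
      = (- 1) ^ forward_edges D vs" .
  have fE: "flipped \<subseteq> E" using flipped by (simp add: perfect_matchings_def)
  have "of_int (matching_sgn n D a) * of_int (matching_sgn n D flipped) =
      of_int (sign \<sigma>) * of_int (sign ?\<tau>) * ((\<Prod>m<n. A $$ (\<sigma> (2 * m), \<sigma> (2 * m + 1))) *
        (\<Prod>m<n. A $$ (?\<tau> (2 * m), ?\<tau> (2 * m + 1))))"
    unfolding matching_sgn_eq[OF E D \<sigma> aE, folded A_def] matching_sgn_eq[OF E D \<tau> fE, folded A_def]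
    by (simp only: mult_ac)
  also have "\<dots> = - ((- 1) ^ forward_edges D vs)"
  proof -
    have "of_int (sign \<sigma>) * of_int (sign ?\<tau>) = (of_int (sign \<sigma> * - sign \<sigma>) :: rat)"
      unfolding sign\<tau> by (simp only: of_int_mult)
    also have "\<dots> = - 1" by simp
    finally show ?thesis unfolding prods by simp
  qed
  finally have "rat_of_int (matching_sgn n D a * matching_sgn n D flipped) = of_int (- ((- 1) ^ forward_edges D vs))"
    by simp
  then show ?thesis by (simp only: of_int_eq_iff)
qed

end

section \<open>All perfect matchings give the same sign\<close>

definition partner :: "nat set set \<Rightarrow> nat \<Rightarrow> nat" where
  "partner M v = (THE u. {v, u} \<in> M)"

lemma partner:
  assumes G: "simple_graph N E" and M: "M \<in> perfect_matchings {0..<N} E" and v: "v < N"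
  shows "{v, partner M v} \<in> M" "\<And>u. {v, u} \<in> M \<Longrightarrow> partner M v = u"
    "partner M v < N" "partner M v \<noteq> v" "partner M (partner M v) = v"
proof -
  have ME: "M \<subseteq> E" using M by (simp add: perfect_matchings_def)
  have two: "e \<subseteq> {0..<N} \<and> card e = 2" if "e \<in> M" for e
    using G ME that by (auto simp: simple_graph_def)
  have vN: "v \<in> {0..<N}" using v by simp
  obtain e where e: "e \<in> M" "v \<in> e" by (rule perfect_matching_edge_ex[OF M vN])
  obtain x y where "e = {x, y}" using two[OF e(1)] by (auto simp: card_2_iff)
  then obtain u where u: "{v, u} \<in> M" using e by (auto simp: insert_commute)
  have uniq: "u' = u" if "{v, u'} \<in> M" for u'
  proof -
    have "{v, u'} = {v, u}" by (rule perfect_matching_edge_unique[OF M vN that _ u]) simp_all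
    then show ?thesis by (auto simp: doubleton_eq_iff)
  qed
  have p: "partner M v = u" unfolding partner_def using u uniq by (rule the_equality)
  show "{v, partner M v} \<in> M" using u p by simp
  show "partner M v = u'" if "{v, u'} \<in> M" for u' using uniq[OF that] p by simp
  have uN: "u \<in> {0..<N}" and "v \<noteq> u" using two[OF u] by auto
  then show "partner M v < N" "partner M v \<noteq> v" using p by auto
  have vu: "w = v" if "{u, w} \<in> M" for w
  proof -
    have "{u, w} = {v, u}" by (rule perfect_matching_edge_unique[OF M uN that _ u]) simp_all
    then show ?thesis by (auto simp: doubleton_eq_iff)
  qed
  have "{u, v} \<in> M" using u by (simp add: insert_commute)
  then have "(THE w. {u, w} \<in> M) = v" using vu by (rule the_equality)
  then show "partner M (partner M v) = v" unfolding p unfolding partner_def .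
qed

text \<open>
  Start at a vertex with different partners in \<^term>\<open>a\<close> and \<^term>\<open>b\<close> and move alternately to the partner in
  \<^term>\<open>a\<close> and in \<^term>\<open>b\<close>. The first repeated vertex must be the starting point, and it must be reached
  by an edge of \<^term>\<open>b\<close>: otherwise the vertex before the second occurrence is also a neighbour of the
  first occurrence in the walk, which is an earlier repetition.
\<close>

lemma exists_alternating_cycle:
  assumes G: "simple_graph N E" "cubic N E"
    and a: "a \<in> perfect_matchings {0..<N} E" and b: "b \<in> perfect_matchings {0..<N} E" and ab: "a \<noteq> b"
  obtains vs k where "alternating_cycle N E a vs k" "cycle_edges vs \<subseteq> (a - b) \<union> (b - a)"
proof -
  note pa = partner[OF G(1) a] and pb = partner[OF G(1) b]
  have aE: "a \<subseteq> E" and bE: "b \<subseteq> E" using a b by (auto simp: perfect_matchings_def)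
  have two: "\<exists>x y. e = {x, y} \<and> x < N" if "e \<in> E" for e
  proof -
    have "e \<subseteq> {0..<N}" "card e = 2" using G(1) that by (auto simp: simple_graph_def)
    then show ?thesis by (auto simp: card_2_iff)
  qed
  have "\<exists>v<N. partner a v \<noteq> partner b v"
  proof (rule ccontr)
    assume eq: "\<not> ?thesis"
    have "{x, y} \<in> a \<longleftrightarrow> {x, y} \<in> b" if "x < N" for x y
    proof -
      have same: "partner a x = partner b x" using eq that by blast
      show ?thesis
      proof
        assume "{x, y} \<in> a"
        then have "partner b x = y" using pa(2)[OF that, of y] same by simp
        then show "{x, y} \<in> b" using pb(1)[OF that] by simp
      next
        assume "{x, y} \<in> b"
        then have "partner a x = y" using pb(2)[OF that, of y] same by simp
        then show "{x, y} \<in> a" using pa(1)[OF that] by simp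
      qed
    qed
    then have "e \<in> a \<longleftrightarrow> e \<in> b" if "e \<in> E" for e using two[OF that] by blast
    then show False using ab aE bE by blast
  qed
  then obtain v0 where v0: "v0 < N" "partner a v0 \<noteq> partner b v0" by blast
  define f where "f i = (if even i then partner a else partner b)" for i :: nat
  define u where "u = rec_nat v0 (\<lambda>i w. f i w)"
  have u0: "u 0 = v0" and uS: "u (Suc i) = f i (u i)" for i by (simp_all add: u_def)
  have f: "f i v < N" "f i v \<noteq> v" "f i (f i v) = v" if "v < N" for i v
    using pa(3-5)[OF that] pb(3-5)[OF that] by (auto simp: f_def)
  have u: "u i < N \<and> partner a (u i) \<noteq> partner b (u i)" for i
  proof (induction i)
    case (Suc i)
    have w: "u (Suc i) < N" using f(1) Suc by (simp add: uS)
    have "partner a (u (Suc i)) \<noteq> partner b (u (Suc i))"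
    proof
      assume eq: "partner a (u (Suc i)) = partner b (u (Suc i))"
      have "f i (u (Suc i)) = u i" using f(3) Suc by (simp add: uS)
      then have "partner a (u (Suc i)) = u i" "partner b (u (Suc i)) = u i"
        using eq by (auto simp: f_def split: if_splits)
      then have "partner a (u i) = u (Suc i)" "partner b (u i) = u (Suc i)"
        using pa(5)[OF w] pb(5)[OF w] by auto
      then show False using Suc by simp
    qed
    then show ?case using w by simp
  qed (use v0 u0 in simp)
  have ret: "f i (u (Suc i)) = u i" for i using f(3) u by (simp add: uS)
  have f_parity: "f i = f j" if "even i \<longleftrightarrow> even j" for i j using that by (simp add: f_def)
  have "\<not> inj_on u {0..N}"
  proof
    assume "inj_on u {0..N}"
    then have "card {0..N} \<le> card {0..<N}" by (rule card_inj_on_le) (use u in auto)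
    then show False by simp
  qed
  then obtain p q where "p \<noteq> q" "u p = u q" by (auto simp: inj_on_def)
  then have ex: "\<exists>j. \<exists>i<j. u i = u j" by (cases "p < q") (metis nat_neq_iff)+
  define j where "j = (LEAST j. \<exists>i<j. u i = u j)"
  have "\<exists>i<j. u i = u j" unfolding j_def by (rule LeastI_ex[OF ex])
  then obtain i where i: "i < j" "u i = u j" by blast
  have least: "u p \<noteq> u q" if "p < q" "q < j" for p q
    using not_less_Least[of q "\<lambda>j. \<exists>i<j. u i = u j"] that unfolding j_def by blast
  obtain j' where j': "j = Suc j'" using i(1) by (cases j) auto
  have bj: "f j' (u j) = u j'" using ret[of j'] by (simp add: j')
  have "i = 0"
  proof (rule ccontr)
    assume "i \<noteq> 0"
    then obtain i' where i': "i = Suc i'" by (cases i) auto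
    show False
    proof (cases "even j' \<longleftrightarrow> even i'")
      case True
      then have "u j' = u i'" using bj ret[of i'] f_parity[OF True] i(2) i' by simp
      then show False using least[of i' j'] i(1) i' j' by simp
    next
      case False
      then have par: "even j' \<longleftrightarrow> even i" by (simp add: i')
      have eq: "u j' = u (Suc i)" using bj f_parity[OF par] i(2) by (simp add: uS)
      have "i \<noteq> j'"
      proof
        assume "i = j'"
        then show False using i(2) f(2)[of "u i" i] u[of i] by (simp add: j' uS)
      qed
      moreover have "Suc i \<noteq> j'" using par by auto
      ultimately have "Suc i < j'" using i(1) j' by simp
      then show False using least[of "Suc i" j'] eq j' by simp
    qed
  qed
  then have uj: "u j = u 0" using i(2) by simp
  have "odd j'"
  proof
    assume ev: "even j'"
    then have eq: "u j' = u (Suc 0)" using bj f_parity[of j' 0] uj by (simp add: uS)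
    have "j' \<noteq> 0"
    proof
      assume "j' = 0"
      then show False using uj f(2)[of "u 0" 0] u[of 0] by (simp add: j' uS)
    qed
    then have "Suc 0 < j'" using ev by presburger
    then show False using least[of "Suc 0" j'] eq j' by simp
  qed
  then have "even j" by (simp add: j')
  then obtain k where k: "j = 2 * k" by (elim evenE)
  have "k \<noteq> 0" using k j' by auto
  have "k \<noteq> 1"
  proof
    assume "k = 1"
    then have "u (Suc (Suc 0)) = u 0" using uj k by (simp add: numeral_2_eq_2 \<open>k = 1\<close>)
    then have "partner b (u 1) = u 0" by (simp add: uS f_def)
    moreover have "partner a (u 1) = u 0" using ret[of 0] by (simp add: f_def)
    ultimately show False using u[of 1] by simp
  qed
  then have k2: "2 \<le> k" using \<open>k \<noteq> 0\<close> by simp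
  define vs where "vs = map u [0..<2 * k]"
  have len: "length vs = 2 * k" and nth: "\<And>i. i < 2 * k \<Longrightarrow> vs ! i = u i" by (simp_all add: vs_def)
  have next_vs: "next_vertex vs i = u (Suc i)" if "i < 2 * k" for i
  proof (cases "Suc i = 2 * k")
    case True
    then show ?thesis using uj k nth[of 0] by (simp add: next_vertex_def len)
  next
    case False
    then show ?thesis using that nth[of "Suc i"] by (simp add: next_vertex_def len)
  qed
  have in_a: "{u i, u (Suc i)} \<in> a \<and> {u i, u (Suc i)} \<notin> b" if "even i" for i
    using pa(1)[of "u i"] pb(2)[of "u i" "u (Suc i)"] u[of i] that by (auto simp: uS f_def)
  have in_b: "{u i, u (Suc i)} \<in> b \<and> {u i, u (Suc i)} \<notin> a" if "odd i" for i
    using pb(1)[of "u i"] pa(2)[of "u i" "u (Suc i)"] u[of i] that by (auto simp: uS f_def)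
  have "distinct vs"
  proof -
    have "inj_on u {0..<2 * k}"
    proof (rule inj_onI)
      fix p q assume "p \<in> {0..<2 * k}" "q \<in> {0..<2 * k}" "u p = u q"
      then show "p = q" using least[of p q] least[of q p] k by (cases p q rule: linorder_cases) auto
    qed
    then show ?thesis by (simp add: vs_def distinct_map)
  qed
  then have "alternating_cycle N E a vs k"
    using G a k2 len in_a in_b aE bE by unfold_locales (auto simp: nth next_vs)
  moreover have "cycle_edges vs \<subseteq> (a - b) \<union> (b - a)"
    unfolding cycle_edges_def using in_a in_b by (auto simp: len nth next_vs)
  ultimately show ?thesis by (rule that)
qed

lemma even_order_if_cubic:
  assumes "simple_graph N E" "cubic N E"
  shows "even N"
proof -
  have e: "e \<subseteq> {0..<N} \<and> card e = 2" if "e \<in> E" for e using assms(1) that by (auto simp: simple_graph_def)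
  have "finite E" by (rule finite_subset[of _ "Pow {0..<N}"]) (use e in auto)
  then have "(\<Sum>v\<in>{0..<N}. degree_in E v) = 2 * card E" by (rule handshake) (use e in auto)
  moreover have "(\<Sum>v\<in>{0..<N}. degree_in E v) = (\<Sum>v\<in>{0..<N}. 3)"
    using assms(2) by (intro sum.cong) (auto simp: cubic_def)
  ultimately have "N * 3 = 2 * card E" by simp
  then show ?thesis by presburger
qed

text \<open>
  At each vertex the degrees in a set of edges and in its complement add up to 3.
\<close>

lemma cycle_covers_eq_complements:
  assumes G: "simple_graph N E" "cubic N E"
  shows "cycle_covers N E = (\<lambda>a. E - a) ` perfect_matchings {0..<N} E"
proof -
  have e: "e \<subseteq> {0..<N}" if "e \<in> E" for e using G(1) that by (auto simp: simple_graph_def)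
  have fin: "finite E" by (rule finite_subset[of _ "Pow {0..<N}"]) (use e in auto)
  have deg: "degree_in (E - a) v + degree_in a v = 3" if "a \<subseteq> E" "v < N" for a v
  proof -
    have "card {e \<in> E. v \<in> e} = card {e \<in> {e \<in> E. v \<in> e}. e \<notin> a} + card {e \<in> {e \<in> E. v \<in> e}. \<not> e \<notin> a}"
      using fin by (intro card_split) simp
    moreover have "{e \<in> {e \<in> E. v \<in> e}. e \<notin> a} = {e \<in> E - a. v \<in> e}"
      "{e \<in> {e \<in> E. v \<in> e}. \<not> e \<notin> a} = {e \<in> a. v \<in> e}" using that(1) by auto
    ultimately show ?thesis using G(2) that(2) by (simp add: cubic_def degree_in_def)
  qed
  have one: "degree_in a v = 1 \<longleftrightarrow> (\<exists>!e. e \<in> a \<and> v \<in> e)" for a v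
  proof
    assume "degree_in a v = 1"
    then obtain e where eq: "{e \<in> a. v \<in> e} = {e}" by (auto simp: degree_in_def card_1_singleton_iff)
    show "\<exists>!e. e \<in> a \<and> v \<in> e"
    proof (rule ex1I[of _ e])
      show "e \<in> a \<and> v \<in> e" using eq by blast
      fix f assume "f \<in> a \<and> v \<in> f"
      then have "f \<in> {e \<in> a. v \<in> e}" by simp
      then show "f = e" unfolding eq by simp
    qed
  next
    assume "\<exists>!e. e \<in> a \<and> v \<in> e"
    then obtain e where "e \<in> a \<and> v \<in> e" "\<And>f. f \<in> a \<and> v \<in> f \<Longrightarrow> f = e" by (elim ex1E) blast
    then have "{e \<in> a. v \<in> e} = {e}" by blast
    then show "degree_in a v = 1" by (simp add: degree_in_def)
  qed
  have pm: "a \<in> perfect_matchings {0..<N} E \<longleftrightarrow> a \<subseteq> E \<and> (\<forall>v<N. degree_in a v = 1)" for a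
  proof
    assume "a \<in> perfect_matchings {0..<N} E"
    then show "a \<subseteq> E \<and> (\<forall>v<N. degree_in a v = 1)" unfolding one by (simp add: perfect_matchings_def)
  next
    assume a: "a \<subseteq> E \<and> (\<forall>v<N. degree_in a v = 1)"
    show "a \<in> perfect_matchings {0..<N} E"
      unfolding perfect_matchings_def
    proof (intro CollectI conjI ballI)
      show "\<exists>!e. e \<in> a \<and> v \<in> e" if "v \<in> {0..<N}" for v using a that unfolding one by simp
      show "f \<subseteq> {0..<N}" if "f \<in> a" for f using a e that by blast
    qed (use a in blast)
  qed
  show ?thesis
  proof (intro equalityI subsetI)
    fix c assume "c \<in> cycle_covers N E"
    then have c: "c \<subseteq> E" "\<And>v. v < N \<Longrightarrow> degree_in c v = 2" by (auto simp: cycle_covers_def)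
    have "degree_in (E - c) v = 1" if "v < N" for v using deg[OF c(1) that] c(2)[OF that] by simp
    then have "E - c \<in> perfect_matchings {0..<N} E" by (simp add: pm)
    moreover have "c = E - (E - c)" using c(1) by blast
    ultimately show "c \<in> (\<lambda>a. E - a) ` perfect_matchings {0..<N} E" by blast
  next
    fix c assume "c \<in> (\<lambda>a. E - a) ` perfect_matchings {0..<N} E"
    then obtain a where a0: "c = E - a" "a \<in> perfect_matchings {0..<N} E" by blast
    then have a: "c = E - a" "a \<subseteq> E" "\<And>v. v < N \<Longrightarrow> degree_in a v = 1" unfolding pm by blast+
    have "degree_in c v = 2" if "v < N" for v using deg[OF a(2) that] a(3)[OF that] a(1) by simp
    then show "c \<in> cycle_covers N E" using a(1) by (simp add: cycle_covers_def)
  qed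
qed

text \<open>
  The sign of a perfect matching in the Pfaffian, times the sign of the complementary cycle cover
  in the undirected determinant.
\<close>

definition complement_sign :: "nat \<Rightarrow> nat set set \<Rightarrow> (nat \<times> nat) set \<Rightarrow> nat set set \<Rightarrow> int" where
  "complement_sign N E D a = matching_sgn (N div 2) D a * (- 1) ^ num_components N (E - a)"

lemma matching_sgn_square: "matching_sgn n D a * matching_sgn n D a = 1"
  by (simp add: matching_sgn_def)

text \<open>
  Both factors change by \<open>(- 1) ^ (k + 1)\<close>.
\<close>

lemma complement_sign_flipped:
  assumes G: "simple_graph N E" "cubic N E"
    and draw: "plane_drawing N E pos \<gamma>" and tension: "without_tension N E \<gamma>"
    and D: "is_orientation E D" "semi_pfaffian N E D"
    and alt: "alternating_cycle N E a vs k"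
  shows "complement_sign N E D (alternating_cycle.flipped a vs) = complement_sign N E D a"
proof -
  interpret drawn_alternating_cycle N E a vs k pos \<gamma>
    using alt G(1) draw by (simp add: drawn_alternating_cycle_def plane_graph_def)
  have N: "N = 2 * (N div 2)" using even_order_if_cubic[OF G] by simp
  have "oddly_oriented D vs \<longleftrightarrow> odd k"
    using D(2) is_cycle central len unfolding semi_pfaffian_def by blast
  then have fwd: "even (forward_edges D vs) \<longleftrightarrow> even k"
    using forward_edges_rev[OF D(1)] unfolding oddly_oriented_def by presburger
  have "tension E \<gamma> vs = 0"
    using tension is_cycle central len unfolding without_tension_def by simp
  then have comp: "even (num_components N (E - flipped) + num_components N (E - a) + k + 1)"
    by (rule complement_components_parity)
  define s t where "s = matching_sgn (N div 2) D a" and "t = matching_sgn (N div 2) D flipped"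
  have st: "s * t = - ((- 1) ^ k)" unfolding s_def t_def matching_sgn_flipped[OF N D(1)]
    using fwd by (simp add: minus_one_power_iff)
  have "t = s * (s * t)" using matching_sgn_square[of "N div 2" D a] by (simp add: s_def flip: mult.assoc)
  also have "\<dots> = - (s * (- 1) ^ k)" unfolding st by simp
  finally have t: "t = - (s * (- 1) ^ k)" .
  show ?thesis
    unfolding complement_sign_def s_def[symmetric] t_def[symmetric] t
    using comp by (auto simp: minus_one_power_iff)
qed

text \<open>
  The alternating cycle lies in the symmetric difference of the two matchings, so flipping
  \<open>a\<close> along it brings \<open>a\<close> closer to \<open>b\<close>.
\<close>

lemma complement_sign_constant:
  assumes G: "simple_graph N E" "cubic N E"
    and draw: "plane_drawing N E pos \<gamma>" and tension: "without_tension N E \<gamma>"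
    and D: "is_orientation E D" "semi_pfaffian N E D"
    and a: "a \<in> perfect_matchings {0..<N} E" and b: "b \<in> perfect_matchings {0..<N} E"
  shows "complement_sign N E D a = complement_sign N E D b"
  using a
proof (induction "card (a - b)" arbitrary: a rule: less_induct)
  case less
  show ?case
  proof (cases "a = b")
    case False
    obtain vs k where cyc: "alternating_cycle N E a vs k" and sub: "cycle_edges vs \<subseteq> (a - b) \<union> (b - a)"
      by (rule exists_alternating_cycle[OF G less.prems b False])
    interpret alternating_cycle N E a vs k by (rule cyc)
    have "0 < 2 * k" using k by simp
    then have "cyc_edge 0 \<in> a" "cyc_edge 0 \<in> C" using alt[of 0] unfolding cycle_edges_eq by blast+
    moreover have "flipped - b \<subseteq> (a - b) - C" using sub by (auto simp: flipped_def)
    ultimately have "flipped - b \<subset> a - b" using sub by blast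
    moreover have "finite (a - b)" using aE finE finite_subset by blast
    ultimately have "card (flipped - b) < card (a - b)" by (rule psubset_card_mono[rotated])
    then have "complement_sign N E D flipped = complement_sign N E D b"
      using flipped by (rule less.hyps)
    then show ?thesis using complement_sign_flipped[OF G draw tension D cyc] by simp
  qed simp
qed

lemma map_inverse_skew_adjacency:
  fixes w :: "nat set \<Rightarrow> 'a::field"
  assumes "is_orientation E D" "\<forall>e\<in>E. w e \<noteq> 0"
  shows "map_mat (\<lambda>x. if x = 0 then 0 else inverse x) (skew_adjacency N D w)
    = skew_adjacency N D (\<lambda>e. inverse (w e))"
proof (rule eq_matI)
  fix i j assume "i < dim_row (skew_adjacency N D (\<lambda>e. inverse (w e)))"
    "j < dim_col (skew_adjacency N D (\<lambda>e. inverse (w e)))"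
  then have ij: "i < N" "j < N" by (auto simp: skew_adjacency_def)
  have "w {i, j} \<noteq> 0" if "(i, j) \<in> D \<or> (j, i) \<in> D"
  proof -
    have DE: "{x, y} \<in> E" if "(x, y) \<in> D" for x y using assms(1) that by (auto simp: is_orientation_def)
    have "{i, j} \<in> E" using that DE[of i j] DE[of j i] by (metis insert_commute)
    then show ?thesis using assms(2) by simp
  qed
  then show "map_mat (\<lambda>x. if x = 0 then 0 else inverse x) (skew_adjacency N D w) $$ (i, j)
      = skew_adjacency N D (\<lambda>e. inverse (w e)) $$ (i, j)"
    using ij by (auto simp: skew_adjacency_def nonzero_inverse_minus_eq)
qed (simp_all add: skew_adjacency_def)


section \<open>The undirected determinant as a Pfaffian\<close>

theorem theorem6p18:
  fixes N :: nat and E :: "nat set set" and w :: "nat set \<Rightarrow> 'a::field"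
    and D :: "(nat \<times> nat) set"
    and pos :: "nat \<Rightarrow> complex" and \<gamma> :: "nat set \<Rightarrow> real \<Rightarrow> complex"
    and p :: 'a and A A_inv :: "'a mat"
  assumes "CHAR('a) \<noteq> 2"
    and "simple_graph N E" and "cubic N E"
    and "plane_drawing N E pos \<gamma>" and "without_tension N E \<gamma>"
    and "is_orientation E D" and "semi_pfaffian N E D"
    and "\<forall>e\<in>E. w e \<noteq> 0"
  defines "p \<equiv> \<Prod>e\<in>E. w e"
    and "A \<equiv> skew_adjacency N D w"
    and "A_inv \<equiv> map_mat (\<lambda>x. if x = 0 then 0 else inverse x) A"
  shows "u_det N E w = p * pfaffian A_inv \<or> u_det N E w = - (p * pfaffian A_inv)"
proof -
  note G = assms(2,3) and D = assms(6,7)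
  let ?PM = "perfect_matchings {0..<N} E" and ?n = "N div 2"
  let ?sgn = "matching_sgn ?n D"
  let ?W = "\<lambda>a. \<Prod>e\<in>E - a. w e"
  have N: "N = 2 * ?n" using even_order_if_cubic[OF G] by simp
  have e: "e \<subseteq> {0..<N}" if "e \<in> E" for e using G(1) that by (auto simp: simple_graph_def)
  have fin: "finite E" by (rule finite_subset[of _ "Pow {0..<N}"]) (use e in auto)
  have aE: "a \<subseteq> E" if "a \<in> ?PM" for a using that by (simp add: perfect_matchings_def)
  have inj: "inj_on (\<lambda>a. E - a) ?PM"
  proof (rule inj_onI)
    fix a b assume "a \<in> ?PM" "b \<in> ?PM" "E - a = E - b"
    then show "a = b" using aE[of a] aE[of b] by blast
  qed
  have "(- 1 :: 'a) ^ N = 1" using N by (metis power_minus1_even)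
  then have udet: "u_det N E w = (\<Sum>a\<in>?PM. (- 1) ^ num_components N (E - a) * ?W a)"
    unfolding u_det_def cycle_covers_eq_complements[OF G] by (simp add: sum.reindex[OF inj])
  have "pfaffian A_inv = pfaffian (skew_adjacency (2 * ?n) D (\<lambda>e. inverse (w e)))"
    unfolding A_inv_def A_def map_inverse_skew_adjacency[OF D(1) assms(8)] N[symmetric] ..
  also have "\<dots> = (\<Sum>a\<in>?PM. of_int (?sgn a) * (\<Prod>e\<in>a. inverse (w e)))"
    using pfaffian_skew_adjacency[of ?n E D] G(1) D(1) unfolding N[symmetric] by blast
  finally have "p * pfaffian A_inv = (\<Sum>a\<in>?PM. of_int (?sgn a) * (p * (\<Prod>e\<in>a. inverse (w e))))"
    by (simp add: sum_distrib_left mult.left_commute)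
  also have "\<dots> = (\<Sum>a\<in>?PM. of_int (?sgn a) * ?W a)"
  proof (rule sum.cong)
    fix a assume "a \<in> ?PM"
    then have a: "a \<subseteq> E" by (rule aE)
    have "(\<Prod>e\<in>a. w e) * (\<Prod>e\<in>a. inverse (w e)) = 1"
      unfolding prod.distrib[symmetric] by (rule prod.neutral) (use assms(8) a in auto)
    moreover have "p = ?W a * (\<Prod>e\<in>a. w e)"
      unfolding p_def by (rule prod.subset_diff[OF a fin])
    ultimately have "p * (\<Prod>e\<in>a. inverse (w e)) = ?W a" by (simp add: mult.assoc)
    then show "of_int (?sgn a) * (p * (\<Prod>e\<in>a. inverse (w e))) = of_int (?sgn a) * ?W a" by simp
  qed simp
  finally have pf: "p * pfaffian A_inv = (\<Sum>a\<in>?PM. of_int (?sgn a) * ?W a)" .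
  show ?thesis
  proof (cases "?PM = {}")
    case True
    then show ?thesis by (simp add: udet pf)
  next
    case False
    then obtain a0 where a0: "a0 \<in> ?PM" by blast
    define s where "s = complement_sign N E D a0"
    have s: "(- 1) ^ num_components N (E - a) = s * ?sgn a" if "a \<in> ?PM" for a
    proof -
      have "s = ?sgn a * (- 1) ^ num_components N (E - a)"
        using complement_sign_constant[OF G assms(4,5) D a0 that] by (simp add: s_def complement_sign_def)
      then have "s * ?sgn a = (?sgn a * ?sgn a) * (- 1) ^ num_components N (E - a)" by (simp only: mult_ac)
      then show ?thesis by (simp add: matching_sgn_square)
    qed
    have "(- 1 :: 'a) ^ num_components N (E - a) = of_int s * of_int (?sgn a)" if "a \<in> ?PM" for a
      using arg_cong[OF s[OF that], of "of_int :: int \<Rightarrow> 'a"] by simp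
    then have "u_det N E w = (\<Sum>a\<in>?PM. of_int s * (of_int (?sgn a) * ?W a))"
      unfolding udet by (intro sum.cong) (simp_all add: mult.assoc)
    also have "\<dots> = of_int s * (p * pfaffian A_inv)" by (simp only: pf sum_distrib_left)
    finally have "u_det N E w = of_int s * (p * pfaffian A_inv)" .
    moreover have "s = 1 \<or> s = - 1"
      unfolding s_def complement_sign_def matching_sgn_def
      by (cases rule: sign_cases[of "SOME \<sigma>. lists_matching ?n a0 \<sigma> \<and> (\<forall>k<?n. (\<sigma> (2 * k), \<sigma> (2 * k + 1)) \<in> D)"])
        (simp_all add: minus_one_power_iff)
    ultimately show ?thesis by auto
  qed
qed

end
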